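(* Let $A$ be a finite set and let $X \subset A^{\mathbb{Z}}$ be a subshift of finite type. Then the following conditions are equivalent: (a) $X$ is surjunctive; (b) $X$ is Moore; (c) every irreducible component of $X$ is extremal and every infinite irreducible component of $X$ is isolated (in the poset of irreducible components of $X$); (d) $X$ has Cantor-Bendixson rank at most $2$ and the perfect kernel of $X$ is the union of the isolated infinite irreducible components of $X$; (e) $X$ is the disjoint union of a non-wandering subshift of finite type and of a countable subshift of finite type having Cantor-Bendixson rank at most $2$.
   Context: $A^{\mathbb{Z}}$ carries the product topology ($A$ discrete) and the shift homeomorphism $\sigma$, $(\sigma(x))_i = x_{i+1}$. A subshift is a closed subset $X\subset A^{\mathbb{Z}}$ with $\sigma(X)=X$ (possibly empty). It is of finite type if there are an integer $n\ge 0$ and $S\subset A^n$ such that $X$ is the set of all $x\in A^{\mathbb{Z}}$ with $(x_{i+1},\dots,x_{i+n})\in S$ for all $i\in\mathbb{Z}$. An endomorphism of $X$ is a continuous map $\tau\colon X\to X$ commuting with $\sigma$. $X$ is surjunctive if every injective endomorphism of $X$ is surjective. Two configurations $x,y\in X$ are homoclinic if $\{i\in\mathbb{Z}: x_i\ne y_i\}$ is finite; an endomorphism is pre-injective if its restriction to every homoclinicity class of $X$ is injective. $X$ is Moore if every surjective endomorphism of $X$ is pre-injective. A point $x\in X$ is non-wandering if for every neighborhood $U$ of $x$ in $X$ there is $n\ge 1$ with $U\cap\sigma^n(U)\ne\varnothing$; $\mathrm{NW}(X)$ is the set of non-wandering points of $X$, and $X$ is non-wandering if $\mathrm{NW}(X)=X$.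 A subshift $Y$ is irreducible if it is non-empty and for all non-empty open $U,W\subset Y$ there is $n\ge 1$ with $U\cap\sigma^n(W)\ne\varnothing$. For a subshift of finite type $X$, there is a unique finite partition $\mathcal{C}$ of $\mathrm{NW}(X)$ into irreducible subshifts; its elements are the irreducible components of $X$. For $x\in X$, $\alpha(x)$ (resp. $\omega(x)$) is the set of limits of convergent sequences $(\sigma^{-n_k}(x))_k$ (resp. $(\sigma^{n_k}(x))_k$) with $(n_k)$ a strictly increasing sequence of non-negative integers; there are unique $C_\alpha(x),C_\omega(x)\in\mathcal{C}$ with $\alpha(x)\subset C_\alpha(x)$, $\omega(x)\subset C_\omega(x)$. $\mathcal{C}$ is partially ordered by: $C\preceq C'$ iff there is $x\in X$ with $C_\alpha(x)=C$ and $C_\omega(x)=C'$. An element of a poset is extremal if it is minimal or maximal, and isolated if it is both minimal and maximal. For a topological space $X$: $Y'$ denotes the set of limit points of $Y$; $X^{(0)}=X$, $X^{(\alpha+1)}=(X^{(\alpha)})'$, $X^{(\lambda)}=\bigcap_{\alpha<\lambda}X^{(\alpha)}$ for limit ordinals $\lambda$. The Cantor-Bendixson rank of $X$ is the least ordinal $\alpha_0$ such that $X^{(\alpha)}=X^{(\alpha_0)}$ for all $\alpha\ge\alpha_0$. The perfect kernel of a Polish space $X$ is the unique perfect closed subset $P\subset X$ (closed, without isolated points, possibly empty) such that $X\setminus P$ is countable. Countable means finite or countably infinite. *)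

theory Defs
  imports "HOL-Analysis.Analysis" "HOL-Library.Disjoint_Sets"
begin

section \<open>Subshifts\<close>

text \<open>The alphabet is a carrier set \<open>A\<close> (possibly empty), and a configuration is a function
  \<^typ>\<open>int \<Rightarrow> 'a\<close> with values in \<open>A\<close>.\<close>

definition full_shift :: "'a set \<Rightarrow> (int \<Rightarrow> 'a) topology"
  where "full_shift A = product_topology (\<lambda>_. discrete_topology A) UNIV"

abbreviation shift_top :: "'a set \<Rightarrow> (int \<Rightarrow> 'a) set \<Rightarrow> (int \<Rightarrow> 'a) topology"
  where "shift_top A X \<equiv> subtopology (full_shift A) X"

definition shift :: "(int \<Rightarrow> 'a) \<Rightarrow> int \<Rightarrow> 'a"
  where "shift x = (\<lambda>i. x (i + 1))"

definition subshift :: "'a set \<Rightarrow> (int \<Rightarrow> 'a) set \<Rightarrow> bool"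
  where "subshift A X \<longleftrightarrow> closedin (full_shift A) X \<and> shift ` X = X"

definition finite_type :: "'a set \<Rightarrow> (int \<Rightarrow> 'a) set \<Rightarrow> bool"
  where "finite_type A X \<longleftrightarrow>
    (\<exists>(n::nat) S. S \<subseteq> {w. length w = n \<and> set w \<subseteq> A} \<and>
      X = {x \<in> topspace (full_shift A). \<forall>i. map (\<lambda>k. x (i + int k)) [1..<n+1] \<in> S})"

definition sft :: "'a set \<Rightarrow> (int \<Rightarrow> 'a) set \<Rightarrow> bool"
  where "sft A X \<longleftrightarrow> subshift A X \<and> finite_type A X"

section \<open>Surjunctive and Moore subshifts\<close>

text \<open>An endomorphism is a total HOL function, of which only the restriction to \<open>X\<close> matters.\<close>

definition endomorphism ::
  "'a set \<Rightarrow> (int \<Rightarrow> 'a) set \<Rightarrow> ((int \<Rightarrow> 'a) \<Rightarrow> int \<Rightarrow> 'a) \<Rightarrow> bool"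
  where "endomorphism A X \<tau> \<longleftrightarrow>
    continuous_map (shift_top A X) (shift_top A X) \<tau> \<and> (\<forall>x\<in>X. \<tau> (shift x) = shift (\<tau> x))"

definition surjunctive :: "'a set \<Rightarrow> (int \<Rightarrow> 'a) set \<Rightarrow> bool"
  where "surjunctive A X \<longleftrightarrow> (\<forall>\<tau>. endomorphism A X \<tau> \<and> inj_on \<tau> X \<longrightarrow> \<tau> ` X = X)"

definition homoclinic :: "(int \<Rightarrow> 'a) \<Rightarrow> (int \<Rightarrow> 'a) \<Rightarrow> bool"
  where "homoclinic x y \<longleftrightarrow> finite {i. x i \<noteq> y i}"

definition pre_injective :: "(int \<Rightarrow> 'a) set \<Rightarrow> ((int \<Rightarrow> 'a) \<Rightarrow> int \<Rightarrow> 'a) \<Rightarrow> bool"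
  where "pre_injective X \<tau> \<longleftrightarrow> (\<forall>x\<in>X. inj_on \<tau> {y \<in> X. homoclinic x y})"

definition moore :: "'a set \<Rightarrow> (int \<Rightarrow> 'a) set \<Rightarrow> bool"
  where "moore A X \<longleftrightarrow> (\<forall>\<tau>. endomorphism A X \<tau> \<and> \<tau> ` X = X \<longrightarrow> pre_injective X \<tau>)"

section \<open>Non-wandering points and the poset of irreducible components\<close>

definition NW :: "'a set \<Rightarrow> (int \<Rightarrow> 'a) set \<Rightarrow> (int \<Rightarrow> 'a) set"
  where "NW A X = {x \<in> X. \<forall>U\<subseteq>X. (\<exists>V. openin (shift_top A X) V \<and> x \<in> V \<and> V \<subseteq> U) \<longrightarrow>
    (\<exists>n\<ge>1. U \<inter> (shift ^^ n) ` U \<noteq> {})}"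

definition non_wandering :: "'a set \<Rightarrow> (int \<Rightarrow> 'a) set \<Rightarrow> bool"
  where "non_wandering A X \<longleftrightarrow> NW A X = X"

definition irreducible_subshift :: "'a set \<Rightarrow> (int \<Rightarrow> 'a) set \<Rightarrow> bool"
  where "irreducible_subshift A Y \<longleftrightarrow> subshift A Y \<and> Y \<noteq> {} \<and>
    (\<forall>U W. openin (shift_top A Y) U \<and> U \<noteq> {} \<and> openin (shift_top A Y) W \<and> W \<noteq> {} \<longrightarrow>
      (\<exists>n\<ge>1. U \<inter> (shift ^^ n) ` W \<noteq> {}))"

text \<open>For \<open>X\<close> of finite type such a partition exists and is unique.\<close>

definition irred_components :: "'a set \<Rightarrow> (int \<Rightarrow> 'a) set \<Rightarrow> (int \<Rightarrow> 'a) set set"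
  where "irred_components A X =
    (THE \<C>. finite \<C> \<and> partition_on (NW A X) \<C> \<and> (\<forall>C\<in>\<C>. irreducible_subshift A C))"

definition alpha_limit :: "'a set \<Rightarrow> (int \<Rightarrow> 'a) \<Rightarrow> (int \<Rightarrow> 'a) set"
  where "alpha_limit A x =
    {y. \<exists>n::nat \<Rightarrow> nat. strict_mono n \<and>
      limitin (full_shift A) (\<lambda>k. (inv shift ^^ n k) x) y sequentially}"

definition omega_limit :: "'a set \<Rightarrow> (int \<Rightarrow> 'a) \<Rightarrow> (int \<Rightarrow> 'a) set"
  where "omega_limit A x =
    {y. \<exists>n::nat \<Rightarrow> nat. strict_mono n \<and>
      limitin (full_shift A) (\<lambda>k. (shift ^^ n k) x) y sequentially}"

definition C_alpha :: "'a set \<Rightarrow> (int \<Rightarrow> 'a) set \<Rightarrow> (int \<Rightarrow> 'a) \<Rightarrow> (int \<Rightarrow> 'a) set"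
  where "C_alpha A X x = (THE C. C \<in> irred_components A X \<and> alpha_limit A x \<subseteq> C)"

definition C_omega :: "'a set \<Rightarrow> (int \<Rightarrow> 'a) set \<Rightarrow> (int \<Rightarrow> 'a) \<Rightarrow> (int \<Rightarrow> 'a) set"
  where "C_omega A X x = (THE C. C \<in> irred_components A X \<and> omega_limit A x \<subseteq> C)"

definition comp_le ::
  "'a set \<Rightarrow> (int \<Rightarrow> 'a) set \<Rightarrow> (int \<Rightarrow> 'a) set \<Rightarrow> (int \<Rightarrow> 'a) set \<Rightarrow> bool"
  where "comp_le A X C D \<longleftrightarrow> (\<exists>x\<in>X. C_alpha A X x = C \<and> C_omega A X x = D)"

definition minimal_comp :: "'a set \<Rightarrow> (int \<Rightarrow> 'a) set \<Rightarrow> (int \<Rightarrow> 'a) set \<Rightarrow> bool"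
  where "minimal_comp A X C \<longleftrightarrow>
    C \<in> irred_components A X \<and> (\<forall>D\<in>irred_components A X. comp_le A X D C \<longrightarrow> D = C)"

definition maximal_comp :: "'a set \<Rightarrow> (int \<Rightarrow> 'a) set \<Rightarrow> (int \<Rightarrow> 'a) set \<Rightarrow> bool"
  where "maximal_comp A X C \<longleftrightarrow>
    C \<in> irred_components A X \<and> (\<forall>D\<in>irred_components A X. comp_le A X C D \<longrightarrow> D = C)"

definition extremal_comp :: "'a set \<Rightarrow> (int \<Rightarrow> 'a) set \<Rightarrow> (int \<Rightarrow> 'a) set \<Rightarrow> bool"
  where "extremal_comp A X C \<longleftrightarrow> minimal_comp A X C \<or> maximal_comp A X C"

definition isolated_comp :: "'a set \<Rightarrow> (int \<Rightarrow> 'a) set \<Rightarrow> (int \<Rightarrow> 'a) set \<Rightarrow> bool"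
  where "isolated_comp A X C \<longleftrightarrow> minimal_comp A X C \<and> maximal_comp A X C"

section \<open>Cantor-Bendixson rank and perfect kernel\<close>

text \<open>The ordinals used as indices for a space with points in \<^typ>\<open>'p\<close> are the elements of the
  initial ordinal \<open>\<kappa>\<^sup>+\<close>, where \<open>\<kappa>\<close> is the (infinite) cardinality of \<^typ>\<open>nat + 'p\<close>.
  A strictly decreasing transfinite sequence of subsets of \<^typ>\<open>'p\<close> has length less than
  \<open>\<kappa>\<^sup>+\<close>, so the Cantor-Bendixson derivatives become constant at some index of this kind, and it is
  constant also at all larger ordinals.\<close>

abbreviation ords :: "(nat + 'p) set rel"
  where "ords \<equiv> cardSuc (card_of (UNIV :: (nat + 'p) set))"

text \<open>The sequence \<open>X\<^sup>(\<^sup>\<alpha>\<^sup>)\<close>: the three branches are zero, successor and limit ordinals.\<close>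

definition cb_derivative :: "'p topology \<Rightarrow> (nat + 'p) set \<Rightarrow> 'p set"
  where "cb_derivative X = wo_rel.worec ords (\<lambda>Y a.
    if Order_Relation.underS ords a = {} then topspace X
    else if \<exists>b \<in> Order_Relation.underS ords a. a = wo_rel.suc ords {b}
    then X derived_set_of (Y (THE b. b \<in> Order_Relation.underS ords a \<and> a = wo_rel.suc ords {b}))
    else (\<Inter>b \<in> Order_Relation.underS ords a. Y b))"

definition cb_rank :: "'p topology \<Rightarrow> (nat + 'p) set"
  where "cb_rank X = wo_rel.minim ords
    {a \<in> Field ords. \<forall>b. (a, b) \<in> ords \<longrightarrow> cb_derivative X b = cb_derivative X a}"

primrec nat_ord :: "nat \<Rightarrow> (nat + 'p) set"
  where
    "nat_ord 0 = wo_rel.minim ords (Field ords)"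
  | "nat_ord (Suc n) = wo_rel.suc ords {nat_ord n}"

definition cb_rank_le :: "'p topology \<Rightarrow> nat \<Rightarrow> bool"
  where "cb_rank_le X n \<longleftrightarrow> (cb_rank X, nat_ord n) \<in> ords"

definition perfect_in :: "'p topology \<Rightarrow> 'p set \<Rightarrow> bool"
  where "perfect_in X P \<longleftrightarrow> closedin X P \<and> \<not> (\<exists>x\<in>P. openin (subtopology X P) {x})"

text \<open>For a Polish space such a subset exists and is unique.\<close>

definition perfect_kernel :: "'p topology \<Rightarrow> 'p set"
  where "perfect_kernel X = (THE P. perfect_in X P \<and> countable (topspace X - P))"

subsection \<open>The recursion equations of the derivatives, and existence of the rank\<close>

lemma wo_rel_ords: "wo_rel (ords :: (nat + 'p) set rel)"
  using cardSuc_Card_order[OF card_of_Card_order] by (auto simp: wo_rel_def card_order_on_def)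

lemma infinite_ords: "infinite (Field (ords :: (nat + 'p) set rel))"
  using cardSuc_finite[OF card_of_Card_order, of "UNIV :: (nat + 'p) set"]
  by (simp add: Field_card_of finite_Plus_UNIV_iff)

lemma ords_greater:
  assumes "a \<in> Field (ords :: (nat + 'p) set rel)"
  shows "Order_Relation.AboveS (ords :: (nat + 'p) set rel) {a} \<noteq> {}"
proof -
  obtain b where "b \<in> Field (ords :: (nat + 'p) set rel)" "a \<noteq> b" "(a, b) \<in> (ords :: (nat + 'p) set rel)"
    using infinite_Card_order_limit[OF cardSuc_Card_order[OF card_of_Card_order] infinite_ords] assms
    by blast
  then show ?thesis by (auto simp: AboveS_def)
qed

lemma ords_suc:
  assumes "a \<in> Field (ords :: (nat + 'p) set rel)"
  shows "wo_rel.suc ords {a} \<in> Field (ords :: (nat + 'p) set rel)"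
    "a \<in> Order_Relation.underS ords (wo_rel.suc ords {a})"
  using wo_rel.suc_greater[OF wo_rel_ords _ ords_greater[OF assms], of a]
    wo_rel.suc_inField[OF wo_rel_ords _ ords_greater[OF assms]] assms
  by (auto simp: underS_def)

lemma ords_suc_least:
  assumes "(a, b) \<in> (ords :: (nat + 'p) set rel)" "a \<noteq> b"
  shows "(wo_rel.suc ords {a}, b) \<in> (ords :: (nat + 'p) set rel)"
  using assms by (intro wo_rel.suc_least_AboveS[OF wo_rel_ords]) (auto simp: AboveS_def FieldI2)

lemma ords_suc_inj:
  fixes a b :: "(nat + 'p) set"
  assumes "a \<in> Field ords" "b \<in> Field ords" "wo_rel.suc ords {a} = wo_rel.suc ords {b}"
  shows "a = b"
proof (rule ccontr)
  assume ne: "a \<noteq> b"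
  have *: False if ab: "(a, b) \<in> ords" "a \<noteq> b" "b \<in> Field ords"
    "wo_rel.suc ords {a} = wo_rel.suc ords {b}" for a b :: "(nat + 'p) set"
    using ords_suc_least[OF ab(1,2)] ords_suc(2)[OF ab(3)] ab(4)
      wo_rel.ANTISYM[OF wo_rel_ords] by (auto simp: underS_def antisym_def)
  show False
    using *[of a b] *[of b a] ne assms wo_rel.TOTALS[OF wo_rel_ords, rule_format, of a b] by auto
qed

lemma cb_derivative_unfold:
  "cb_derivative X a =
    (if Order_Relation.underS ords a = {} then topspace X
     else if \<exists>b \<in> Order_Relation.underS ords a. a = wo_rel.suc ords {b}
     then X derived_set_of cb_derivative X
       (THE b. b \<in> Order_Relation.underS ords a \<and> a = wo_rel.suc ords {b})
     else (\<Inter>b \<in> Order_Relation.underS ords a. cb_derivative X b))"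
proof -
  have the: "(THE b. b \<in> Order_Relation.underS ords a \<and> a = wo_rel.suc ords {b})
      \<in> Order_Relation.underS ords a"
    if ex: "\<exists>b \<in> Order_Relation.underS ords a. a = wo_rel.suc ords {b}" for a :: "(nat + 'a) set"
  proof -
    from ex obtain b where b: "b \<in> Order_Relation.underS ords a" "a = wo_rel.suc ords {b}" by blast
    have F: "c \<in> Field ords" if "c \<in> Order_Relation.underS ords a" for c
      using that by (auto simp: underS_def intro: FieldI1)
    have "c = b" if "c \<in> Order_Relation.underS ords a \<and> a = wo_rel.suc ords {c}" for c
      using ords_suc_inj[of c b] F that b by metis
    then show ?thesis using b by (subst the_equality[of _ b]) auto
  qed
  let ?H = "\<lambda>Y (a :: (nat + 'a) set). if Order_Relation.underS ords a = {} then topspace X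
    else if \<exists>b \<in> Order_Relation.underS ords a. a = wo_rel.suc ords {b}
    then X derived_set_of (Y (THE b. b \<in> Order_Relation.underS ords a \<and> a = wo_rel.suc ords {b}))
    else (\<Inter>b \<in> Order_Relation.underS ords a. Y b)"
  have "wo_rel.adm_wo ords ?H"
    unfolding wo_rel.adm_wo_def[OF wo_rel_ords]
  proof (intro allI impI)
    fix Y Z :: "(nat + 'a) set \<Rightarrow> 'a set" and c :: "(nat + 'a) set"
    assume eq: "\<forall>b \<in> Order_Relation.underS ords c. Y b = Z b"
    show "?H Y c = ?H Z c"
    proof (cases "\<exists>b \<in> Order_Relation.underS ords c. c = wo_rel.suc ords {b}")
      case True
      from bspec[OF eq the[OF this]] show ?thesis by (simp only: True if_True)
    next
      case False
      from eq have "(\<Inter>b \<in> Order_Relation.underS ords c. Y b) = (\<Inter>b \<in> Order_Relation.underS ords c. Z b)"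
        by (intro INF_cong) auto
      then show ?thesis by (simp only: False if_False)
    qed
  qed
  from wo_rel.worec_fixpoint[OF wo_rel_ords this] show ?thesis
    unfolding cb_derivative_def by (rule fun_cong)
qed

lemma cb_derivative_zero: "cb_derivative X (nat_ord 0) = topspace X"
proof -
  let ?z = "nat_ord 0 :: (nat + 'a) set"
  have "b = ?z" if b: "(b, ?z) \<in> ords" for b
  proof -
    have "(?z, b) \<in> ords"
      unfolding nat_ord.simps
      by (rule wo_rel.minim_least[OF wo_rel_ords subset_refl FieldI1[OF b]])
    with b show ?thesis by (rule antisymD[OF wo_rel.ANTISYM[OF wo_rel_ords]])
  qed
  then have "Order_Relation.underS ords ?z = {}"
    unfolding underS_def by blast
  then show ?thesis by (subst cb_derivative_unfold) (simp only: if_True simp_thms)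
qed

lemma cb_derivative_suc:
  assumes "a \<in> Field ords"
  shows "cb_derivative X (wo_rel.suc ords {a}) = X derived_set_of cb_derivative X a"
proof -
  note s = ords_suc[OF assms]
  have "(THE b. b \<in> Order_Relation.underS ords (wo_rel.suc ords {a}) \<and>
      wo_rel.suc ords {a} = wo_rel.suc ords {b}) = a"
    using s assms by (intro the_equality) (auto dest!: ords_suc_inj[rotated 2] simp: underS_def intro: FieldI1)
  moreover have "\<exists>b \<in> Order_Relation.underS ords (wo_rel.suc ords {a}).
      wo_rel.suc ords {a} = wo_rel.suc ords {b}"
    using s by blast
  moreover have "Order_Relation.underS ords (wo_rel.suc ords {a}) \<noteq> {}"
    using s by blast
  ultimately show ?thesis
    by (subst cb_derivative_unfold) (simp only: if_False if_True)
qed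

lemma ords_le_pred:
  fixes a c :: "(nat + 'p) set"
  assumes "(a, wo_rel.suc ords {c}) \<in> ords" "a \<noteq> wo_rel.suc ords {c}" "c \<in> Field ords"
  shows "(a, c) \<in> ords"
proof (rule ccontr)
  assume n: "(a, c) \<notin> ords"
  have aF: "a \<in> Field ords" using assms(1) by (rule FieldI1)
  have "(c, a) \<in> ords"
    using wo_rel.TOTALS[OF wo_rel_ords] assms(3) aF n by blast
  moreover from this have "c \<noteq> a" using n by blast
  ultimately have "(wo_rel.suc ords {c}, a) \<in> ords" by (rule ords_suc_least)
  then show False
    using antisymD[OF wo_rel.ANTISYM[OF wo_rel_ords] assms(1)] assms(2) by blast
qed

lemma cb_derivative_limit:
  assumes "Order_Relation.underS ords a \<noteq> {}"
    and "\<And>b. b \<in> Order_Relation.underS ords a \<Longrightarrow> a \<noteq> wo_rel.suc ords {b}"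
  shows "cb_derivative X a = (\<Inter>b \<in> Order_Relation.underS ords a. cb_derivative X b)"
proof -
  from assms(2) have "\<not> (\<exists>b \<in> Order_Relation.underS ords a. a = wo_rel.suc ords {b})" by blast
  with assms(1) show ?thesis
    by (subst cb_derivative_unfold) (simp only: if_False if_True)
qed

lemma cb_derivative_shrinks: "X derived_set_of cb_derivative X a \<subseteq> cb_derivative X a"
proof (induction a rule: wo_rel.well_order_induct[OF wo_rel_ords])
  case (1 a)
  then have IH: "X derived_set_of cb_derivative X b \<subseteq> cb_derivative X b"
    if "b \<in> Order_Relation.underS ords a" for b
    using that by (auto simp: underS_def)
  show ?case
  proof (cases "Order_Relation.underS ords a = {}")
    case True
    then have "cb_derivative X a = topspace X"
      by (subst cb_derivative_unfold) (simp only: if_True simp_thms)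
    then show ?thesis by (simp only: derived_set_of_subset_topspace)
  next
    case ne: False
    show ?thesis
    proof (cases "\<exists>b \<in> Order_Relation.underS ords a. a = wo_rel.suc ords {b}")
      case True
      then obtain b where b: "b \<in> Order_Relation.underS ords a" "a = wo_rel.suc ords {b}" by auto
      then have "b \<in> Field ords" by (auto simp: underS_def intro: FieldI1)
      from cb_derivative_suc[OF this, of X] derived_set_of_mono[OF IH[OF b(1)], of X] show ?thesis
        unfolding b(2) by (simp only:)
    next
      case False
      then have eq: "cb_derivative X a = (\<Inter>b \<in> Order_Relation.underS ords a. cb_derivative X b)"
        using cb_derivative_limit[OF ne] by blast
      have "X derived_set_of cb_derivative X a \<subseteq> cb_derivative X b"
        if b: "b \<in> Order_Relation.underS ords a" for b
      proof -
        have "cb_derivative X a \<subseteq> cb_derivative X b" using eq b by auto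
        from derived_set_of_mono[OF this, of X] IH[OF b] show ?thesis by blast
      qed
      then show ?thesis unfolding eq[symmetric] using eq by blast
    qed
  qed
qed

lemma cb_derivative_antimono:
  "(a, b) \<in> ords \<Longrightarrow> cb_derivative X b \<subseteq> cb_derivative X a"
proof (induction b rule: wo_rel.well_order_induct[OF wo_rel_ords])
  case (1 b)
  show ?case
  proof (cases "a = b")
    case False
    with 1 have a: "a \<in> Order_Relation.underS ords b" by (auto simp: underS_def)
    show ?thesis
    proof (cases "\<exists>c \<in> Order_Relation.underS ords b. b = wo_rel.suc ords {c}")
      case True
      then obtain c where c: "c \<in> Order_Relation.underS ords b" "b = wo_rel.suc ords {c}" by auto
      then have cF: "c \<in> Field ords" by (auto simp: underS_def intro: FieldI1)
      have "(a, c) \<in> ords"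
        using ords_le_pred[of a c] 1(2) False c(2) cF by blast
      with 1 c have "cb_derivative X c \<subseteq> cb_derivative X a" by (auto simp: underS_def)
      then show ?thesis
        using cb_derivative_shrinks[of X c] cb_derivative_suc[OF cF, of X] c by auto
    next
      case False
      then show ?thesis using cb_derivative_limit[of b X] a by blast
    qed
  qed simp
qed

lemma cb_derivative_const:
  assumes "X derived_set_of cb_derivative X a = cb_derivative X a"
  shows "(a, b) \<in> ords \<Longrightarrow> cb_derivative X b = cb_derivative X a"
proof (induction b rule: wo_rel.well_order_induct[OF wo_rel_ords])
  case (1 b)
  show ?case
  proof (cases "a = b")
    case False
    with 1 have a: "a \<in> Order_Relation.underS ords b" by (auto simp: underS_def)
    show ?thesis
    proof (cases "\<exists>c \<in> Order_Relation.underS ords b. b = wo_rel.suc ords {c}")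
      case True
      then obtain c where c: "c \<in> Order_Relation.underS ords b" "b = wo_rel.suc ords {c}" by auto
      then have cF: "c \<in> Field ords" by (auto simp: underS_def intro: FieldI1)
      have "(a, c) \<in> ords"
        using ords_le_pred[of a c] 1(2) False c(2) cF by blast
      with 1 c have "cb_derivative X c = cb_derivative X a" by (auto simp: underS_def)
      then show ?thesis
        using cb_derivative_suc[OF cF, of X] c assms by auto
    next
      case False
      then have eq: "cb_derivative X b = (\<Inter>c \<in> Order_Relation.underS ords b. cb_derivative X c)"
        using cb_derivative_limit[of b X] a by blast
      have "cb_derivative X a \<subseteq> cb_derivative X c" if c: "c \<in> Order_Relation.underS ords b" for c
      proof (cases "(a, c) \<in> ords")
        case True then show ?thesis using 1 c by (auto simp: underS_def)
      next
        case False
        then have "(c, a) \<in> ords"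
          using wo_rel.TOTALS[OF wo_rel_ords] c a by (meson FieldI1 underS_E)
        then show ?thesis by (rule cb_derivative_antimono)
      qed
      then show ?thesis using eq a by blast
    qed
  qed simp
qed

text \<open>The set whose minimum is the rank is non-empty.\<close>

lemma cb_rank_exists:
  fixes X :: "'p topology"
  shows "\<exists>a \<in> Field ords. \<forall>b. (a, b) \<in> ords \<longrightarrow> cb_derivative X b = cb_derivative X a"
proof (rule ccontr)
  assume "\<not> ?thesis"
  then have "\<forall>a \<in> Field ords. \<exists>p. p \<in> cb_derivative X a - cb_derivative X (wo_rel.suc ords {a})"
    using cb_derivative_const[of X] cb_derivative_suc[of _ X] cb_derivative_shrinks[of X] by blast
  then obtain p where p: "\<And>a. a \<in> Field ords \<Longrightarrow>
      p a \<in> cb_derivative X a - cb_derivative X (wo_rel.suc ords {a})"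
    by metis
  have lt: False if "(a, b) \<in> ords" "a \<noteq> b" "p a = p b" "a \<in> Field ords" "b \<in> Field ords" for a b
    using cb_derivative_antimono[OF ords_suc_least[OF that(1,2)], of X] p[OF that(4)] p[OF that(5)] that(3)
    by auto
  have "inj_on p (Field ords)"
  proof (rule inj_onI, rule ccontr)
    fix a b assume ab: "a \<in> Field ords" "b \<in> Field ords" "p a = p b" "a \<noteq> b"
    from wo_rel.TOTALS[OF wo_rel_ords] ab(1,2) have "(a, b) \<in> ords \<or> (b, a) \<in> ords" by blast
    then show False using lt[of a b] lt[of b a] ab by auto
  qed
  then have "inj_on (\<lambda>a. Inr (p a) :: nat + 'p) (Field ords)" by (auto simp: inj_on_def)
  then have "(card_of (Field (ords :: (nat + 'p) set rel)), card_of (UNIV :: (nat + 'p) set)) \<in> ordLeq"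
    using card_of_ordLeq by blast
  moreover have "(card_of (UNIV :: (nat + 'p) set), ords :: (nat + 'p) set rel) \<in> ordLess"
    by (rule cardSuc_greater[OF card_of_Card_order])
  moreover have "(ords :: (nat + 'p) set rel, card_of (Field (ords :: (nat + 'p) set rel))) \<in> ordLeq"
    using Card_order_iff_ordLeq_card_of cardSuc_Card_order[OF card_of_Card_order] by blast
  ultimately show False
    by (meson not_ordLess_ordLeq ordLeq_transitive)
qed

lemma nat_ord_Field: "nat_ord n \<in> Field (ords :: (nat + 'p) set rel)"
proof (induction n)
  case 0
  have "Field (ords :: (nat + 'p) set rel) \<noteq> {}"
    by (rule infinite_imp_nonempty[OF infinite_ords])
  then show ?case by (simp add: wo_rel.minim_in[OF wo_rel_ords])
qed (simp add: ords_suc)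

lemma cb_rank_le_iff:
  "cb_rank_le X n \<longleftrightarrow> ((derived_set_of) X ^^ Suc n) (topspace X) = ((derived_set_of) X ^^ n) (topspace X)"
proof -
  let ?S = "{a \<in> Field ords. \<forall>b. (a, b) \<in> ords \<longrightarrow> cb_derivative X b = cb_derivative X a}"
  have cb: "cb_derivative X (nat_ord n) = ((derived_set_of) X ^^ n) (topspace X)" for n
  proof (induction n)
    case (Suc n) then show ?case by (simp add: cb_derivative_suc nat_ord_Field)
  qed (use cb_derivative_zero in simp)
  have S: "cb_rank X \<in> ?S" unfolding cb_rank_def
    by (rule wo_rel.minim_in[OF wo_rel_ords]) (use cb_rank_exists[of X] in auto)
  have "cb_rank_le X n \<longleftrightarrow> nat_ord n \<in> ?S"
  proof
    assume le: "cb_rank_le X n"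
    have "cb_derivative X b = cb_derivative X (nat_ord n)" if "(nat_ord n, b) \<in> ords" for b
      using S le that wo_rel.TRANS[OF wo_rel_ords] unfolding cb_rank_le_def
      by (auto dest: transD)
    then show "nat_ord n \<in> ?S" using nat_ord_Field by blast
  next
    assume "nat_ord n \<in> ?S"
    then show "cb_rank_le X n" unfolding cb_rank_le_def cb_rank_def
      by (intro wo_rel.minim_least[OF wo_rel_ords]) auto
  qed
  also have "\<dots> \<longleftrightarrow> X derived_set_of cb_derivative X (nat_ord n) = cb_derivative X (nat_ord n)"
  proof
    assume S: "nat_ord n \<in> ?S"
    have "(nat_ord n, wo_rel.suc ords {nat_ord n}) \<in> (ords :: (nat + 'a) set rel)"
      using ords_suc(2)[OF nat_ord_Field] unfolding underS_def by blast
    then have "cb_derivative X (wo_rel.suc ords {nat_ord n}) = cb_derivative X (nat_ord n)"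
      using S by blast
    then show "X derived_set_of cb_derivative X (nat_ord n) = cb_derivative X (nat_ord n)"
      unfolding cb_derivative_suc[OF nat_ord_Field] .
  next
    assume "X derived_set_of cb_derivative X (nat_ord n) = cb_derivative X (nat_ord n)"
    from cb_derivative_const[OF this] show "nat_ord n \<in> ?S"
      using nat_ord_Field by blast
  qed
  finally show ?thesis by (simp add: cb)
qed

end

theory Submission
  imports Defs
begin

text \<open>Everything is read off the directed graph whose vertices are the words of a fixed length
  \<open>N\<close> occurring in \<open>X\<close>: irreducible components are the strongly connected classes of recurrent
  vertices, and the order is reachability.

  If (c) fails, there is a maximal class (after reversing time if necessary) into which transient
  points fall and for which a loop can be inserted, at a place marked by the moment of entry, in
  an injective way: the part of the point to the right is shifted, which is the shift on the
  component itself. Deleting that loop is a left inverse \<open>h\<close> of the insertion \<open>g\<close>, so \<open>g\<close> is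
  injective and \<open>h\<close> surjective; as \<open>g (h y)\<close> is homoclinic to and different from \<open>y\<close> for some \<open>y\<close>,
  neither is \<open>g\<close> surjective nor \<open>h\<close> pre-injective.

  If (c) holds, the transient points are isolated and form finitely many orbits. An injective
  endomorphism permutes the points of each period, hence maps the closure \<open>NW(X)\<close> of the periodic
  points onto itself, and the finitely many transient orbits are permuted as well. A surjective
  endomorphism also permutes these orbits and the components, which reduces the Moore property to
  irreducible subshifts, where counting words gives it. The conditions on the rank follow from the
  position of the transient points relative to the components.\<close>

section \<open>Configurations and the product topology\<close>

text \<open>The obstacle is continuity. A point close to the component of the maximal class has
  entered that class far to the left, so near the origin a surgery at the entry time acts as the
  shift by the change of length \<open>D\<close>, and the map must be that shift on the component.
  If the component is finite, \<open>D\<close> is a multiple of its period, the shift by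
  \<open>D\<close> is trivial there, and it is enough to alter the points that enter along one
  chosen word; the inserted loop then sits at an earlier class, before the entry. If it is infinite,
  the shift is a genuine one, so every entering point must be altered, also by the left inverse:
  where there is no loop to delete, a path of length \<open>T + d\<close> after the entry is
  replaced by one of length \<open>T\<close> with the same ends. \<open>len_shrink\<close> supplies
  it, and it also makes room for a forbidden word in every path of a suitable length in the proof of
  the Moore property. Surgery is done at a maximal class because there the entry time is
  unique.\<close>

definition agree :: "nat \<Rightarrow> (int \<Rightarrow> 'a) \<Rightarrow> (int \<Rightarrow> 'a) \<Rightarrow> bool"
  where "agree m x y \<longleftrightarrow> (\<forall>i. \<bar>i\<bar> \<le> int m \<longrightarrow> x i = y i)"

definition sh :: "int \<Rightarrow> (int \<Rightarrow> 'a) \<Rightarrow> int \<Rightarrow> 'a"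
  where "sh n x = (\<lambda>i. x (i + n))"

lemma agree_refl [simp]: "agree m x x"
  by (simp add: agree_def)

lemma agree_sym: "agree m x y \<Longrightarrow> agree m y x"
  by (simp add: agree_def)

lemma agree_trans: "agree m x y \<Longrightarrow> agree m y z \<Longrightarrow> agree m x z"
  by (simp add: agree_def)

lemma agree_mono: "agree m x y \<Longrightarrow> n \<le> m \<Longrightarrow> agree n x y"
  by (simp add: agree_def)

lemma agreeD: "agree m x y \<Longrightarrow> \<bar>i\<bar> \<le> int m \<Longrightarrow> x i = y i"
  by (simp add: agree_def)

lemma sh_0 [simp]: "sh 0 x = x"
  by (simp add: sh_def)

lemma sh_sh [simp]: "sh m (sh n x) = sh (m + n) x"
  by (simp add: sh_def fun_eq_iff algebra_simps)

lemma sh_apply: "sh n x i = x (i + n)"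
  by (simp add: sh_def)

lemma sh_eq_iff: "sh n x = sh n y \<longleftrightarrow> x = y"
  by (metis sh_0 sh_sh add.left_inverse)

lemma shift_eq_sh: "shift = sh 1"
  by (simp add: fun_eq_iff shift_def sh_def)

lemma inv_shift: "inv shift = sh (-1)"
proof (rule inv_unique_comp)
qed (auto simp: shift_eq_sh fun_eq_iff)

lemma shift_pow: "shift ^^ n = sh (int n)"
  by (induction n) (auto simp: shift_eq_sh fun_eq_iff sh_def algebra_simps)

lemma inv_shift_pow: "inv shift ^^ n = sh (- int n)"
  by (induction n) (auto simp: inv_shift fun_eq_iff sh_def algebra_simps)

lemma topspace_full_shift: "topspace (full_shift A) = {x. \<forall>i. x i \<in> A}"
  by (auto simp: full_shift_def PiE_UNIV_domain)

text \<open>The sets \<open>{y. agree m x y}\<close> form a neighborhood basis at \<open>x\<close>,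
  because a product neighborhood restricts finitely many coordinates and these lie in some
  \<open>[-m, m]\<close>.\<close>

lemma openin_full_shift:
  "openin (full_shift A) U \<longleftrightarrow>
     U \<subseteq> topspace (full_shift A) \<and>
     (\<forall>x\<in>U. \<exists>m. \<forall>y\<in>topspace (full_shift A). agree m x y \<longrightarrow> y \<in> U)"
proof
  assume U: "openin (full_shift A) U"
  show "U \<subseteq> topspace (full_shift A) \<and>
     (\<forall>x\<in>U. \<exists>m. \<forall>y\<in>topspace (full_shift A). agree m x y \<longrightarrow> y \<in> U)"
  proof (intro conjI ballI)
    fix x assume "x \<in> U"
    with U obtain V where V: "finite {i. V i \<noteq> A}" "\<And>i. V i \<subseteq> A" "x \<in> Pi\<^sub>E UNIV V"
      "Pi\<^sub>E UNIV V \<subseteq> U"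
      unfolding full_shift_def openin_product_topology_alt by auto
    have "finite ((\<lambda>i. \<bar>i\<bar>) ` {i. V i \<noteq> A})" using V(1) by blast
    then obtain k where k: "\<forall>i\<in>{i. V i \<noteq> A}. \<bar>i\<bar> \<le> k"
      using bdd_above_finite unfolding bdd_above.unfold by (metis image_eqI)
    have "y \<in> U" if y: "y \<in> topspace (full_shift A)" "agree (nat k) x y" for y
    proof -
      have "y i \<in> V i" for i
      proof (cases "V i = A")
        case True then show ?thesis using y by (auto simp: topspace_full_shift)
      next
        case False
        then have "\<bar>i\<bar> \<le> k" using k by auto
        then have "\<bar>i\<bar> \<le> int (nat k)" by auto
        then have "y i = x i" using y(2) agreeD by metis
        then show ?thesis using V(3) by (auto simp: PiE_UNIV_domain)
      qed
      then show ?thesis using V(4) by (auto simp: PiE_UNIV_domain)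
    qed
    then show "\<exists>m. \<forall>y\<in>topspace (full_shift A). agree m x y \<longrightarrow> y \<in> U" by blast
  qed (use U openin_subset in blast)
next
  assume R: "U \<subseteq> topspace (full_shift A) \<and>
     (\<forall>x\<in>U. \<exists>m. \<forall>y\<in>topspace (full_shift A). agree m x y \<longrightarrow> y \<in> U)"
  show "openin (full_shift A) U"
    unfolding full_shift_def openin_product_topology_alt
  proof (rule ballI)
    fix x assume x: "x \<in> U"
    with R obtain m where m: "\<And>y. y\<in>topspace (full_shift A) \<Longrightarrow> agree m x y \<Longrightarrow> y \<in> U" by blast
    have xA: "x i \<in> A" for i using x R by (auto simp: topspace_full_shift)
    let ?V = "\<lambda>i. if \<bar>i\<bar> \<le> int m then {x i} else A"
    have "{i. ?V i \<noteq> A} \<subseteq> {- int m..int m}" by auto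
    then have "finite {i. ?V i \<noteq> A}" using finite_subset by blast
    moreover have "\<forall>i. ?V i \<subseteq> A" using xA by auto
    moreover have "x \<in> Pi\<^sub>E UNIV ?V" using xA by auto
    moreover have "Pi\<^sub>E UNIV ?V \<subseteq> U"
    proof
      fix y assume y: "y \<in> Pi\<^sub>E UNIV ?V"
      then have "y i \<in> ?V i" for i by (rule PiE_mem) simp
      then have "y \<in> topspace (full_shift A)" "agree m x y"
        using xA unfolding topspace_full_shift agree_def by (force split: if_splits)+
      then show "y \<in> U" by (rule m)
    qed
    ultimately show "\<exists>U'. finite {i \<in> UNIV. U' i \<noteq> topspace (discrete_topology A)} \<and>
      (\<forall>i\<in>UNIV. openin (discrete_topology A) (U' i)) \<and> x \<in> Pi\<^sub>E UNIV U' \<and> Pi\<^sub>E UNIV U' \<subseteq> U"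
      by (intro exI[of _ ?V]) simp
  qed
qed

lemma topspace_shift_top: "Y \<subseteq> topspace (full_shift A) \<Longrightarrow> topspace (shift_top A Y) = Y"
  by auto

lemma openin_shift_top:
  assumes Y: "Y \<subseteq> topspace (full_shift A)"
  shows "openin (shift_top A Y) U \<longleftrightarrow> U \<subseteq> Y \<and> (\<forall>x\<in>U. \<exists>m. \<forall>y\<in>Y. agree m x y \<longrightarrow> y \<in> U)"
proof
  assume "openin (shift_top A Y) U"
  then obtain T where T: "openin (full_shift A) T" "U = T \<inter> Y" by (auto simp: openin_subtopology)
  show "U \<subseteq> Y \<and> (\<forall>x\<in>U. \<exists>m. \<forall>y\<in>Y. agree m x y \<longrightarrow> y \<in> U)"
  proof (intro conjI ballI)
    fix x assume "x \<in> U"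
    then obtain m where "\<forall>y\<in>topspace (full_shift A). agree m x y \<longrightarrow> y \<in> T"
      using T unfolding openin_full_shift by blast
    then show "\<exists>m. \<forall>y\<in>Y. agree m x y \<longrightarrow> y \<in> U" using T Y by blast
  qed (use T in auto)
next
  assume R: "U \<subseteq> Y \<and> (\<forall>x\<in>U. \<exists>m. \<forall>y\<in>Y. agree m x y \<longrightarrow> y \<in> U)"
  \<comment> \<open>The union of all cylinders around points of \<open>U\<close> whose trace on
    \<open>Y\<close> lies in \<open>U\<close>: an open set of the full shift with trace
    \<open>U\<close>.\<close>
  let ?T = "{z \<in> topspace (full_shift A). \<exists>x\<in>U. \<exists>m. (\<forall>y\<in>Y. agree m x y \<longrightarrow> y \<in> U) \<and> agree m x z}"
  have "openin (full_shift A) ?T"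
    unfolding openin_full_shift
  proof (intro conjI ballI)
    fix z assume "z \<in> ?T"
    then obtain x m where "x \<in> U" "\<forall>y\<in>Y. agree m x y \<longrightarrow> y \<in> U" "agree m x z" by auto
    then have "\<forall>y\<in>topspace (full_shift A). agree m z y \<longrightarrow> y \<in> ?T"
      using agree_trans by blast
    then show "\<exists>m. \<forall>y\<in>topspace (full_shift A). agree m z y \<longrightarrow> y \<in> ?T" by blast
  qed auto
  moreover have "U = ?T \<inter> Y" using R Y agree_refl by blast
  ultimately show "openin (shift_top A Y) U" unfolding openin_subtopology by blast
qed

text \<open>Here \<open>m\<close> may depend on the point and on the coordinate; finitely many
  coordinates of the image are handled at once by a maximum. The uniform version for endomorphisms
  is \<open>endo_radius\<close>.\<close>

lemma continuous_map_shift_top: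
  assumes Y: "Y \<subseteq> topspace (full_shift A)" and Z: "Z \<subseteq> topspace (full_shift A)"
  shows "continuous_map (shift_top A Y) (shift_top A Z) f \<longleftrightarrow>
    f \<in> Y \<rightarrow> Z \<and> (\<forall>x\<in>Y. \<forall>i. \<exists>m. \<forall>y\<in>Y. agree m x y \<longrightarrow> f y i = f x i)"
proof
  assume f: "continuous_map (shift_top A Y) (shift_top A Z) f"
  then have fYZ: "f \<in> Y \<rightarrow> Z" using Y Z by (auto simp: continuous_map_def Int_absorb1)
  have "\<exists>m. \<forall>y\<in>Y. agree m x y \<longrightarrow> f y i = f x i" if x: "x \<in> Y" for x i
  proof -
    let ?U = "{z \<in> Z. z i = f x i}"
    have "openin (shift_top A Z) ?U"
      unfolding openin_shift_top[OF Z]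
    proof (intro conjI ballI)
      fix z assume "z \<in> ?U"
      then have "\<forall>y\<in>Z. agree (nat \<bar>i\<bar>) z y \<longrightarrow> y \<in> ?U"
        by (auto simp: agree_def)
      then show "\<exists>m. \<forall>y\<in>Z. agree m z y \<longrightarrow> y \<in> ?U" by blast
    qed auto
    then have "openin (shift_top A Y) {y \<in> topspace (shift_top A Y). f y \<in> ?U}"
      using f by (rule openin_continuous_map_preimage[rotated])
    then have "openin (shift_top A Y) {y \<in> Y. f y \<in> ?U}" unfolding topspace_shift_top[OF Y] .
    moreover have "x \<in> {y \<in> Y. f y \<in> ?U}" using x fYZ by auto
    ultimately show ?thesis unfolding openin_shift_top[OF Y] by fast
  qed
  with fYZ show "f \<in> Y \<rightarrow> Z \<and> (\<forall>x\<in>Y. \<forall>i. \<exists>m. \<forall>y\<in>Y. agree m x y \<longrightarrow> f y i = f x i)" by blast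
next
  assume R: "f \<in> Y \<rightarrow> Z \<and> (\<forall>x\<in>Y. \<forall>i. \<exists>m. \<forall>y\<in>Y. agree m x y \<longrightarrow> f y i = f x i)"
  have unif: "\<exists>m. \<forall>y\<in>Y. agree m x y \<longrightarrow> agree k (f x) (f y)" if x: "x \<in> Y" for x k
  proof -
    from R x obtain m where m: "\<And>i y. y \<in> Y \<Longrightarrow> agree (m i) x y \<Longrightarrow> f y i = f x i" by metis
    let ?M = "Max (m ` {- int k..int k})"
    have "agree k (f x) (f y)" if y: "y \<in> Y" "agree ?M x y" for y
      unfolding agree_def
    proof (intro allI impI)
      fix i assume "\<bar>i\<bar> \<le> int k"
      then have "i \<in> {- int k..int k}" by auto
      then have "m i \<le> ?M" by (intro Max_ge finite_imageI imageI) auto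
      then show "f x i = f y i" using m[OF y(1)] agree_mono[OF y(2)] by metis
    qed
    then show ?thesis by blast
  qed
  show "continuous_map (shift_top A Y) (shift_top A Z) f"
    unfolding continuous_map_def topspace_shift_top[OF Y] topspace_shift_top[OF Z]
  proof (intro conjI allI impI)
    show "f \<in> Y \<rightarrow> Z" using R by blast
    fix U assume U: "openin (shift_top A Z) U"
    show "openin (shift_top A Y) {x \<in> Y. f x \<in> U}"
      unfolding openin_shift_top[OF Y]
    proof (intro conjI ballI)
      fix x assume x: "x \<in> {x \<in> Y. f x \<in> U}"
      then obtain k where k: "\<forall>y\<in>Z. agree k (f x) y \<longrightarrow> y \<in> U"
        using U unfolding openin_shift_top[OF Z] by blast
      obtain m where m: "\<forall>y\<in>Y. agree m x y \<longrightarrow> agree k (f x) (f y)" using unif x by blast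
      then have "\<forall>y\<in>Y. agree m x y \<longrightarrow> y \<in> {x \<in> Y. f x \<in> U}" using k R by blast
      then show "\<exists>m. \<forall>y\<in>Y. agree m x y \<longrightarrow> y \<in> {x \<in> Y. f x \<in> U}" by blast
    qed auto
  qed
qed

lemma closedin_full_shift:
  "closedin (full_shift A) Y \<longleftrightarrow> Y \<subseteq> topspace (full_shift A) \<and>
     (\<forall>x\<in>topspace (full_shift A). (\<forall>m. \<exists>y\<in>Y. agree m x y) \<longrightarrow> x \<in> Y)"
  unfolding closedin_def openin_full_shift by blast

lemma closedin_shift_top:
  assumes Y: "Y \<subseteq> topspace (full_shift A)"
  shows "closedin (shift_top A Y) C \<longleftrightarrow> C \<subseteq> Y \<and> (\<forall>x\<in>Y. (\<forall>m. \<exists>y\<in>C. agree m x y) \<longrightarrow> x \<in> C)"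
  unfolding closedin_def openin_shift_top[OF Y] topspace_shift_top[OF Y] by blast

lemma derived_set_shift_top:
  assumes Y: "Y \<subseteq> topspace (full_shift A)"
  shows "shift_top A Y derived_set_of T =
    {x \<in> Y. \<forall>m. \<exists>y\<in>T \<inter> Y. y \<noteq> x \<and> agree m x y}" (is "?L = ?R")
proof
  show "?L \<subseteq> ?R"
  proof
    fix x assume x: "x \<in> ?L"
    then have xY: "x \<in> Y" using Y by (auto simp: in_derived_set_of)
    have "\<exists>y\<in>T \<inter> Y. y \<noteq> x \<and> agree m x y" for m
    proof -
      have "openin (shift_top A Y) {y \<in> Y. agree m x y}"
        unfolding openin_shift_top[OF Y] using agree_trans by blast
      then show ?thesis using x xY unfolding in_derived_set_of by (metis (no_types, lifting) IntI agree_refl mem_Collect_eq)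
    qed
    then show "x \<in> ?R" using xY by blast
  qed
  show "?R \<subseteq> ?L"
  proof
    fix x assume x: "x \<in> ?R"
    show "x \<in> ?L" unfolding in_derived_set_of topspace_shift_top[OF Y]
    proof (intro conjI allI impI)
      fix U assume U: "x \<in> U \<and> openin (shift_top A Y) U"
      then obtain m where "\<forall>y\<in>Y. agree m x y \<longrightarrow> y \<in> U" using openin_shift_top[OF Y] by blast
      then show "\<exists>y. y \<noteq> x \<and> y \<in> T \<and> y \<in> U" using x by blast
    qed (use x in auto)
  qed
qed

lemma limitin_full_shift:
  assumes "\<And>n. f n \<in> topspace (full_shift A)"
  shows "limitin (full_shift A) f l F \<longleftrightarrow>
    l \<in> topspace (full_shift A) \<and> (\<forall>m. eventually (\<lambda>n. agree m l (f n)) F)"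
proof
  assume lim: "limitin (full_shift A) f l F"
  then have l: "l \<in> topspace (full_shift A)" by (simp add: limitin_def)
  have "eventually (\<lambda>n. agree m l (f n)) F" for m
  proof -
    have "openin (full_shift A) {y \<in> topspace (full_shift A). agree m l y}"
      unfolding openin_full_shift using agree_trans by blast
    then have "eventually (\<lambda>n. f n \<in> {y \<in> topspace (full_shift A). agree m l y}) F"
      using lim l by (auto simp: limitin_def)
    then show ?thesis by (rule eventually_mono) auto
  qed
  with l show "l \<in> topspace (full_shift A) \<and> (\<forall>m. eventually (\<lambda>n. agree m l (f n)) F)" by blast
next
  assume R: "l \<in> topspace (full_shift A) \<and> (\<forall>m. eventually (\<lambda>n. agree m l (f n)) F)"
  show "limitin (full_shift A) f l F"
    unfolding limitin_def
  proof (intro conjI allI impI)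
    fix U assume "openin (full_shift A) U \<and> l \<in> U"
    then obtain m where m: "\<forall>y\<in>topspace (full_shift A). agree m l y \<longrightarrow> y \<in> U"
      unfolding openin_full_shift by blast
    have "eventually (\<lambda>n. agree m l (f n)) F" using R by blast
    then show "eventually (\<lambda>n. f n \<in> U) F" by (rule eventually_mono) (use m assms in blast)
  qed (use R in auto)
qed

lemma compact_space_full_shift: "finite A \<Longrightarrow> compact_space (full_shift A)"
  unfolding full_shift_def compact_space_product_topology by (auto simp: compact_space_discrete_topology)

lemma Hausdorff_space_full_shift: "Hausdorff_space (full_shift A)"
  unfolding full_shift_def Hausdorff_space_product_topology by (auto simp: Hausdorff_space_discrete_topology)

lemma metrizable_space_full_shift: "metrizable_space (full_shift A)"
  unfolding full_shift_def metrizable_space_product_topology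
  by (auto simp: metrizable_space_discrete_topology)

lemma full_shift_convergent_subseq:
  fixes f :: "nat \<Rightarrow> int \<Rightarrow> 'a"
  assumes "finite A" "\<And>n. f n \<in> topspace (full_shift A)"
  shows "\<exists>l r. strict_mono (r::nat\<Rightarrow>nat) \<and> limitin (full_shift A) (f \<circ> r) l sequentially"
proof -
  obtain M d where Md: "Metric_space M d" "full_shift A = Metric_space.mtopology M d"
    using metrizable_space_full_shift unfolding metrizable_space_def by blast
  have "compact_space (Metric_space.mtopology M d)" using compact_space_full_shift[OF assms(1)] Md by simp
  then show ?thesis using assms(2) Md Metric_space.compact_space_sequentially[OF Md(1)]
    Metric_space.topspace_mtopology[OF Md(1)] by (metis image_subsetI)
qed

section \<open>Subshifts of finite type in window form\<close>

definition win :: "nat \<Rightarrow> (int \<Rightarrow> 'a) \<Rightarrow> int \<Rightarrow> 'a list"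
  where "win N x i = map (\<lambda>k. x (i + int k)) [0..<N]"

definition glue :: "int \<Rightarrow> (int \<Rightarrow> 'a) \<Rightarrow> (int \<Rightarrow> 'a) \<Rightarrow> int \<Rightarrow> 'a"
  where "glue t x y = (\<lambda>k. if k < t then x k else y k)"

lemma win_eq_iff: "win N x i = win N y j \<longleftrightarrow> (\<forall>k. 0 \<le> k \<and> k < int N \<longrightarrow> x (i + k) = y (j + k))"
proof
  assume eq: "win N x i = win N y j"
  show "\<forall>k. 0 \<le> k \<and> k < int N \<longrightarrow> x (i + k) = y (j + k)"
  proof (intro allI impI)
    fix k assume k: "0 \<le> k \<and> k < int N"
    have "nat k \<in> set [0..<N]" using k by auto
    then have "x (i + int (nat k)) = y (j + int (nat k))" using eq unfolding win_def map_eq_conv by blast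
    then show "x (i + k) = y (j + k)" using k by simp
  qed
qed (auto simp: win_def)

lemma win_eq_Ico: "win N x i = win N y i \<longleftrightarrow> (\<forall>k. i \<le> k \<and> k < i + int N \<longrightarrow> x k = y k)"
proof
  assume eq: "win N x i = win N y i"
  show "\<forall>k. i \<le> k \<and> k < i + int N \<longrightarrow> x k = y k"
  proof (intro allI impI)
    fix k assume "i \<le> k \<and> k < i + int N"
    then show "x k = y k" using eq[unfolded win_eq_iff, rule_format, of "k - i"] by simp
  qed
qed (simp add: win_eq_iff)

lemma win_cong: "(\<And>k. i \<le> k \<Longrightarrow> k < i + int N \<Longrightarrow> x k = y k) \<Longrightarrow> win N x i = win N y i"
  by (simp add: win_eq_Ico)

lemma win_sh: "win N (sh n x) i = win N x (i + n)"
  by (simp add: win_eq_iff sh_def algebra_simps)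

lemma length_win [simp]: "length (win N x i) = N"
  by (simp add: win_def)

lemma glue_right: "t \<le> k \<Longrightarrow> glue t x y k = y k"
  by (simp add: glue_def)

lemma win_glue_right: "t \<le> k \<Longrightarrow> win N (glue t x y) k = win N y k"
  by (auto intro!: win_cong simp: glue_def)

text \<open>The windows at \<open>t\<close> agree, so on \<open>[t, t + N)\<close> either point may
  be read. Hence windows starting at or before \<open>t\<close> are those of \<open>x\<close>, and
  the glued point has only windows of \<open>x\<close> and of \<open>y\<close>.\<close>

lemma glue_left': "win N x t = win N y t \<Longrightarrow> k < t + int N \<Longrightarrow> glue t x y k = x k"
  unfolding win_eq_Ico glue_def by auto

lemma win_glue_left: "win N x t = win N y t \<Longrightarrow> k \<le> t \<Longrightarrow> win N (glue t x y) k = win N x k"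
  by (rule win_cong, rule glue_left') auto

definition per :: "int \<Rightarrow> (int \<Rightarrow> 'a) \<Rightarrow> int \<Rightarrow> 'a"
  where "per n x = (\<lambda>k. x (k mod n))"

text \<open>The period \<open>n\<close> may be smaller than \<open>N\<close>, so a position in the
  overhang beyond \<open>n\<close> is pulled back by \<open>n\<close> repeatedly, each time by the
  equality of the two windows.\<close>

lemma per_eq:
  assumes n: "0 < n" and w: "win N x 0 = win N x n" and k: "0 \<le> k" "k < n + int N"
  shows "per n x k = x k"
  using k
proof (induction "nat k" arbitrary: k rule: less_induct)
  case less
  show ?case
  proof (cases "k < n")
    case True then show ?thesis using less by (simp add: per_def)
  next
    case False
    have "x (0 + (k - n)) = x (n + (k - n))"
      using w less.prems False unfolding win_eq_iff by fastforce
    moreover have "per n x (k - n) = x (k - n)"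
      using less.hyps[of "k - n"] less.prems False n by auto
    moreover have "per n x (k - n) = per n x k"
      by (simp add: per_def)
    ultimately show ?thesis by simp
  qed
qed

lemma sh_per: "sh n (per n x) = per n x"
  by (simp add: sh_def per_def)

lemma win_per:
  assumes n: "0 < n" and w: "win N x 0 = win N x n"
  shows "win N (per n x) k = win N x (k mod n)"
proof -
  have "per n x (k + j) = x (k mod n + j)" if "0 \<le> j" "j < int N" for j
  proof -
    have "per n x (k mod n + j) = x (k mod n + j)"
    proof (rule per_eq[OF n w])
      show "0 \<le> k mod n + j" using n that by simp
      show "k mod n + j < n + int N" using pos_mod_bound[OF n, of k] that by linarith
    qed
    moreover have "per n x (k mod n + j) = per n x (k + j)" by (simp add: per_def mod_simps)
    ultimately show ?thesis by simp
  qed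
  then show ?thesis by (simp add: win_eq_iff)
qed

text \<open>A constraint on words of length \<open>N\<close> allows switching between two points
  wherever their windows of length \<open>N\<close> agree (\<open>glue_X\<close>), so these words
  are the states of a graph; \<open>0 < N\<close> lets letters be read off windows.\<close>

locale window_shift =
  fixes A :: "'a set" and N :: nat and S :: "'a list set" and X :: "(int \<Rightarrow> 'a) set"
  assumes finite_A: "finite A" and N_pos: "0 < N"
    and S_words: "S \<subseteq> {w. length w = N \<and> set w \<subseteq> A}"
    and X_eq: "X = {x. \<forall>i. win N x i \<in> S}"
begin

abbreviation st :: "(int \<Rightarrow> 'a) \<Rightarrow> int \<Rightarrow> 'a list" where "st \<equiv> win N"

text \<open>\<open>S\<close> may contain words that occur in no point of \<open>X\<close>; these are
  left out of the graph.\<close>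

definition states :: "'a list set" where "states = {st x i | x i. x \<in> X}"

lemma finite_S: "finite S"
  using finite_subset[OF S_words] finite_lists_length_eq[OF finite_A, of N]
  by (simp add: conj_commute)

lemma X_iff: "x \<in> X \<longleftrightarrow> (\<forall>i. st x i \<in> S)"
  using X_eq by blast

lemma states_subset: "states \<subseteq> S"
  unfolding states_def using X_iff by blast

lemma finite_states: "finite states"
  using states_subset finite_S finite_subset by blast

lemma st_in_states: "x \<in> X \<Longrightarrow> st x i \<in> states"
  unfolding states_def by blast

lemma X_by_states: "(\<And>i. st x i \<in> states) \<Longrightarrow> x \<in> X"
  using X_iff states_subset by blast

lemma stateE:
  assumes "u \<in> states" obtains x where "x \<in> X" "st x 0 = u"
proof -
  obtain x i where "x \<in> X" "st x i = u" using assms unfolding states_def by blast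
  then have "sh i x \<in> X" "st (sh i x) 0 = u" using X_iff by (auto simp: win_sh)
  then show ?thesis using that by blast
qed

lemma X_topspace: "X \<subseteq> topspace (full_shift A)"
proof
  fix x assume x: "x \<in> X"
  have "x i \<in> A" for i
  proof -
    have "set (st x i) \<subseteq> A" using x X_iff S_words by blast
    then show ?thesis using N_pos unfolding win_def by force
  qed
  then show "x \<in> topspace (full_shift A)" by (simp add: topspace_full_shift)
qed

lemma sh_X: "sh n x \<in> X \<longleftrightarrow> x \<in> X"
proof -
  have "sh n x \<in> X" if "x \<in> X" for n x using that by (simp add: X_iff win_sh)
  from this[of "sh n x" "-n"] this[of x n] show ?thesis by auto
qed

lemma glue_X: "x \<in> X \<Longrightarrow> y \<in> X \<Longrightarrow> st x t = st y t \<Longrightarrow> glue t x y \<in> X"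
  by (rule X_by_states) (metis linear st_in_states win_glue_left win_glue_right)

lemma per_X: "x \<in> X \<Longrightarrow> 0 < n \<Longrightarrow> st x 0 = st x n \<Longrightarrow> per n x \<in> X"
  by (rule X_by_states) (simp add: win_per st_in_states)

lemma closed_X: "closedin (full_shift A) X"
  unfolding closedin_full_shift
proof (intro conjI ballI impI)
  fix x assume x: "\<forall>m. \<exists>y\<in>X. agree m x y"
  have "st x i \<in> states" for i
  proof -
    obtain y where y: "y \<in> X" "agree (nat \<bar>i\<bar> + N) x y" using x by blast
    have "st x i = st y i" by (rule win_cong, rule agreeD[OF y(2)]) auto
    then show ?thesis using y st_in_states by simp
  qed
  then show "x \<in> X" by (rule X_by_states)
qed (use X_topspace in auto)

lemma subshift_X: "subshift A X"
  unfolding subshift_def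
proof
  show "shift ` X = X"
  proof
    show "X \<subseteq> shift ` X"
    proof
      fix x assume "x \<in> X"
      then have "x = shift (sh (-1) x)" "sh (-1) x \<in> X" by (auto simp: shift_eq_sh sh_X)
      then show "x \<in> shift ` X" by blast
    qed
  qed (auto simp: shift_eq_sh sh_X)
qed (rule closed_X)

lemma sft_X: "sft A X"
  unfolding sft_def finite_type_def
proof (intro conjI exI)
  \<comment> \<open>\<open>finite_type\<close> reads the positions \<open>i + 1, ..., i + N\<close>,
    so its word at \<open>i\<close> is the window at \<open>i + 1\<close>.\<close>
  have w: "map (\<lambda>k. x (i + int k)) [1..<N+1] = st x (i + 1)" for x :: "int \<Rightarrow> 'a" and i
    by (rule nth_equalityI) (auto simp: win_def algebra_simps simp del: upt_Suc)
  show "X = {x \<in> topspace (full_shift A). \<forall>i. map (\<lambda>k. x (i + int k)) [1..<N+1] \<in> S}"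
    unfolding w using X_topspace X_iff by (auto; metis diff_add_cancel)
qed (use S_words subshift_X in auto)

lemma compactin_X: "compactin (full_shift A) X"
  by (rule closedin_compact_space[OF compact_space_full_shift[OF finite_A] closed_X])

section \<open>Reachability, recurrence and the classes of states\<close>

definition reach :: "'a list \<Rightarrow> 'a list \<Rightarrow> bool"
  where "reach u v \<longleftrightarrow> (\<exists>x\<in>X. \<exists>n::nat. st x 0 = u \<and> st x (int n) = v)"

definition mutual :: "'a list \<Rightarrow> 'a list \<Rightarrow> bool"
  where "mutual u v \<longleftrightarrow> reach u v \<and> reach v u"

text \<open>\<open>reach\<close> allows length 0, so every state satisfies
  \<open>mutual u u\<close>; lying on an actual loop is the extra condition of positive
  length.\<close>

definition recurrent :: "'a list \<Rightarrow> bool"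
  where "recurrent u \<longleftrightarrow> (\<exists>x\<in>X. \<exists>n>0. st x 0 = u \<and> st x n = u)"

definition Comp :: "'a list \<Rightarrow> (int \<Rightarrow> 'a) set"
  where "Comp u = {x \<in> X. \<forall>i. mutual u (st x i)}"

lemma reachI: "x \<in> X \<Longrightarrow> i \<le> j \<Longrightarrow> reach (st x i) (st x j)"
  unfolding reach_def
  by (rule bexI[of _ "sh i x"], rule exI[of _ "nat (j - i)"]) (auto simp: win_sh sh_X)

lemma reachE:
  assumes "reach u v" obtains x n where "x \<in> X" "0 \<le> n" "st x 0 = u" "st x n = v"
  using assms unfolding reach_def by (metis of_nat_0_le_iff)

lemma reach_states: "reach u v \<Longrightarrow> u \<in> states \<and> v \<in> states"
  unfolding reach_def states_def by blast

text \<open>\<open>x\<close> until \<open>i\<close>, then the path \<open>p\<close>, then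
  \<open>y\<close>. The first two pieces keep their symbols for \<open>N\<close> places beyond their
  end, because the windows coincide at the junctions.\<close>

lemma connect:
  assumes x: "x \<in> X" and y: "y \<in> X" and p: "p \<in> X" "0 \<le> l" "st p a = st x i" "st p (a + l) = st y j"
  obtains z where "z \<in> X" "\<And>k. k < i + int N \<Longrightarrow> z k = x k"
    "\<And>k. i \<le> k \<Longrightarrow> k < i + l + int N \<Longrightarrow> z k = p (k - i + a)"
    "\<And>k. i + l \<le> k \<Longrightarrow> z k = y (k - i - l + j)"
    "\<And>k. k \<le> i \<Longrightarrow> st z k = st x k"
    "\<And>k. i \<le> k \<Longrightarrow> k \<le> i + l \<Longrightarrow> st z k = st p (k - i + a)"
    "\<And>k. i + l \<le> k \<Longrightarrow> st z k = st y (k - i - l + j)"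
proof -
  let ?p = "sh (a - i) p"
  let ?y = "sh (j - i - l) y"
  let ?q = "glue (i + l) ?p ?y"
  let ?z = "glue i x ?q"
  have e1: "st ?p (i + l) = st ?y (i + l)" using p by (simp add: win_sh algebra_simps)
  have qX: "?q \<in> X" using glue_X[OF _ _ e1] p y sh_X by blast
  have e2: "st x i = st ?q i" using p win_glue_left[OF e1, of i] by (simp add: win_sh)
  have zX: "?z \<in> X" using glue_X[OF x qX e2] .
  show ?thesis
  proof (rule that[of ?z])
    show "?z \<in> X" by (rule zX)
    show "?z k = x k" if "k < i + int N" for k by (rule glue_left'[OF e2 that])
    show "?z k = p (k - i + a)" if "i \<le> k" "k < i + l + int N" for k
      unfolding glue_right[OF that(1)] glue_left'[OF e1 that(2)] by (simp add: sh_apply algebra_simps)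
    show "?z k = y (k - i - l + j)" if "i + l \<le> k" for k
      using that p(2) by (simp add: sh_apply glue_def algebra_simps)
    show "st ?z k = st x k" if "k \<le> i" for k by (rule win_glue_left[OF e2 that])
    show "st ?z k = st p (k - i + a)" if "i \<le> k" "k \<le> i + l" for k
      unfolding win_glue_right[OF that(1)] win_glue_left[OF e1 that(2)] by (simp add: win_sh algebra_simps)
    show "st ?z k = st y (k - i - l + j)" if "i + l \<le> k" for k
    proof -
      have "i \<le> k" using that p(2) by simp
      then show ?thesis unfolding win_glue_right[OF \<open>i \<le> k\<close>] win_glue_right[OF that]
        by (simp add: win_sh algebra_simps)
    qed
  qed
qed

lemma connect_reach:
  assumes x: "x \<in> X" and y: "y \<in> X" and r: "reach (st x i) (st y j)"
  obtains z l where "z \<in> X" "0 \<le> l" "\<And>k. k < i + int N \<Longrightarrow> z k = x k"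
    "\<And>k. i + l \<le> k \<Longrightarrow> z k = y (k - i - l + j)"
    "\<And>k. k \<le> i \<Longrightarrow> st z k = st x k"
    "\<And>k. i + l \<le> k \<Longrightarrow> st z k = st y (k - i - l + j)"
proof -
  obtain p l where p: "p \<in> X" "0 \<le> l" "st p 0 = st x i" "st p l = st y j" using r by (rule reachE)
  show ?thesis
    by (rule connect[OF x y p(1,2), of 0 i j]) (use p that in auto)
qed

lemma reach_trans: assumes "reach u v" "reach v w" shows "reach u w"
proof -
  obtain x n where x: "x \<in> X" "0 \<le> n" "st x 0 = u" "st x n = v" using assms(1) by (rule reachE)
  obtain y m where y: "y \<in> X" "0 \<le> m" "st y 0 = v" "st y m = w" using assms(2) by (rule reachE)
  have "reach (st x n) (st y 0)" using x y reachI[of x n n] by simp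
  then obtain z l where z: "z \<in> X" "0 \<le> l" "\<And>k. k \<le> n \<Longrightarrow> st z k = st x k"
    "\<And>k. n + l \<le> k \<Longrightarrow> st z k = st y (k - n - l + 0)"
    using connect_reach[OF x(1) y(1)] by metis
  have "st z 0 = u" "st z (n + l + m) = w" using z x y by auto
  then show ?thesis using reachI[OF z(1), of 0 "n + l + m"] x y z by auto
qed

lemma reach_refl: "u \<in> states \<Longrightarrow> reach u u"
  by (metis stateE reachI order_refl)

lemma mutual_sym: "mutual u v \<Longrightarrow> mutual v u"
  by (simp add: mutual_def)

lemma mutual_trans: "mutual u v \<Longrightarrow> mutual v w \<Longrightarrow> mutual u w"
  unfolding mutual_def using reach_trans by blast

lemma mutual_refl: "u \<in> states \<Longrightarrow> mutual u u"
  by (simp add: mutual_def reach_refl)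

lemma recurrentI: "x \<in> X \<Longrightarrow> i < j \<Longrightarrow> st x i = st x j \<Longrightarrow> recurrent (st x i)"
  unfolding recurrent_def
  by (rule bexI[of _ "sh i x"], rule exI[of _ "j - i"]) (auto simp: win_sh sh_X)

lemma recurrent_state: "recurrent u \<Longrightarrow> u \<in> states"
  unfolding recurrent_def states_def by blast

lemma mutual_between:
  assumes "z \<in> X" "i \<le> k" "k \<le> j" "mutual u (st z i)" "mutual u (st z j)"
  shows "mutual u (st z k)"
  using assms reachI[OF assms(1,2)] reachI[OF assms(1,3)] reach_trans unfolding mutual_def by blast

text \<open>A path back from \<open>st x j\<close> closes the segment of \<open>x\<close> over
  \<open>[i, j]\<close> into a loop, which is then repeated.\<close>

lemma mutual_return:
  assumes x: "x \<in> X" "i < j" "reach (st x j) (st x i)"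
  shows "\<exists>z\<in>X. \<exists>p>0. sh p z = z \<and> (\<forall>k. i \<le> k \<and> k < j + int N \<longrightarrow> z k = x k) \<and>
    (\<forall>k. i \<le> k \<and> k \<le> j \<longrightarrow> st z k = st x k)"
proof -
  \<comment> \<open>After the return, \<open>x\<close> is followed again from \<open>i\<close>, so
    the windows at \<open>i\<close> and at \<open>j + l\<close> agree and the point can be made
    periodic.\<close>
  obtain y l where y: "y \<in> X" "0 \<le> l" "\<And>k. k < j + int N \<Longrightarrow> y k = x k"
    "\<And>k. k \<le> j \<Longrightarrow> st y k = st x k" "\<And>k. j + l \<le> k \<Longrightarrow> st y k = st x (k - j - l + i)"
    using connect_reach[OF x(1) x(1) x(3)] by metis
  let ?p = "j + l - i"
  let ?y = "sh i y"
  have p: "?p > 0" using x y by linarith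
  have e: "st ?y 0 = st ?y ?p" using y x by (simp add: win_sh)
  have yX: "?y \<in> X" using y sh_X by blast
  let ?z = "sh (-i) (per ?p ?y)"
  have "?z \<in> X" using per_X[OF yX p e] sh_X by blast
  moreover have "sh ?p ?z = ?z" using sh_per[of ?p ?y] by (metis sh_sh add.commute)
  moreover have zk: "?z k = x k" if "i \<le> k" "k < j + int N" for k
  proof -
    have "per ?p ?y (k - i) = ?y (k - i)" by (rule per_eq[OF p e]) (use that y in auto)
    then show ?thesis using y(3)[of k] that by (simp add: sh_apply)
  qed
  moreover have "st ?z k = st x k" if "i \<le> k" "k \<le> j" for k
    by (rule win_cong) (use zk that in auto)
  ultimately show ?thesis using p by blast
qed

lemma sh_mult: "sh p z = z \<Longrightarrow> sh (int n * p) z = z"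
proof (induction n)
  case (Suc n)
  have "sh (int (Suc n) * p) z = sh (int n * p) (sh p z)" by (simp add: algebra_simps)
  then show ?case using Suc by simp
qed simp

text \<open>The window at \<open>j\<close> is seen again every \<open>p\<close> places, hence also
  at some place to the right of \<open>i\<close>.\<close>

lemma periodic_reach:
  assumes z: "z \<in> X" "p > 0" "sh p z = z"
  shows "reach (st z i) (st z j)"
proof -
  let ?n = "nat \<bar>i - j\<bar>"
  have e: "st z j = st z (j + int ?n * p)"
    unfolding win_sh[symmetric] sh_mult[OF z(3)] ..
  have "\<bar>i - j\<bar> * 1 \<le> \<bar>i - j\<bar> * p" using z by (intro mult_left_mono) auto
  then have "i \<le> j + int ?n * p" by auto
  then show ?thesis using reachI[OF z(1)] e by metis
qed

lemma periodic_Comp: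
  assumes z: "z \<in> X" "p > 0" "sh p z = z" and m: "mutual u (st z i)"
  shows "z \<in> Comp u"
  unfolding Comp_def using periodic_reach[OF z] m z(1) mutual_trans mutual_def by blast

lemma Comp_subset: "Comp u \<subseteq> X"
  by (auto simp: Comp_def)

lemma Comp_cong: "mutual u v \<Longrightarrow> Comp u = Comp v"
  unfolding Comp_def using mutual_trans mutual_sym by blast

lemma Comp_inter: "x \<in> Comp u \<Longrightarrow> x \<in> Comp v \<Longrightarrow> mutual u v"
  unfolding Comp_def using mutual_trans mutual_sym by blast

lemma recurrent_mutual:
  assumes u: "recurrent u" and m: "mutual u w" shows "recurrent w"
proof -
  obtain x n where x: "x \<in> X" "n > 0" "st x 0 = u" "st x n = u" using u recurrent_def by blast
  obtain y a where y: "y \<in> X" "0 \<le> a" "st y 0 = w" "st y a = u" using m mutual_def reachE by metis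
  obtain y' b where y': "y' \<in> X" "0 \<le> b" "st y' 0 = u" "st y' b = w" using m mutual_def reachE by metis
  \<comment> \<open>The loop at \<open>u\<close> is run in the middle, since both connecting paths
    may have length 0.\<close>
  obtain z where z: "z \<in> X" "\<And>k. k \<le> a \<Longrightarrow> st z k = st y k"
    "\<And>k. a + n \<le> k \<Longrightarrow> st z k = st y' (k - a - n + 0)"
    by (rule connect[OF y(1) y'(1) x(1), of n 0 a 0]) (use x y y' in auto)
  have "st z 0 = w" "st z (a + n + b) = w" using z y y' by auto
  then show ?thesis using recurrentI[OF z(1), of 0 "a + n + b"] x y y' by auto
qed

text \<open>A strong form of the density of periodic points: \<open>x\<close> has to be in the class
  only at the ends of the segment. For \<open>i < j\<close> the segment is closed by a return path;
  for \<open>i = j\<close> the return may be empty, and the recurrence of \<open>u\<close> supplies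
  a loop.\<close>

lemma periodic_approx:
  assumes u: "recurrent u" and x: "x \<in> X" "i \<le> j" "mutual u (st x i)" "mutual u (st x j)"
  shows "\<exists>z\<in>Comp u. \<exists>p>0. sh p z = z \<and> (\<forall>k. i \<le> k \<and> k < j + int N \<longrightarrow> z k = x k) \<and>
    (\<forall>k. i \<le> k \<and> k \<le> j \<longrightarrow> st z k = st x k)"
proof (cases "i = j")
  case False
  have "reach (st x j) (st x i)" using x reach_trans unfolding mutual_def by blast
  then obtain z p where "z \<in> X" "p > 0" "sh p z = z" "(\<forall>k. i \<le> k \<and> k < j + int N \<longrightarrow> z k = x k)"
    "(\<forall>k. i \<le> k \<and> k \<le> j \<longrightarrow> st z k = st x k)"
    using mutual_return[OF x(1), of i j] x(2) False by (meson order_le_imp_less_or_eq)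
  then show ?thesis using periodic_Comp[of z p u i] x by auto
next
  case True
  obtain y n where y: "y \<in> X" "n > 0" "st y 0 = st x i" "st y n = st x i"
    using recurrent_mutual[OF u x(3)] recurrent_def by metis
  let ?z = "sh (-i) (per n y)"
  have z: "st ?z i = st x i" using win_per[of n N y 0] y by (simp add: win_sh)
  then have eq: "\<forall>k. i \<le> k \<and> k < i + int N \<longrightarrow> ?z k = x k" unfolding win_eq_Ico .
  have "?z \<in> X" using per_X[of y n] y sh_X by auto
  moreover have "sh n ?z = ?z" using sh_per[of n y] by (metis sh_sh add.commute)
  ultimately have "?z \<in> Comp u" using periodic_Comp[of ?z n u i] z x y(2) by simp
  then show ?thesis using \<open>sh n ?z = ?z\<close> y(2) eq z True
    by (intro bexI[of _ ?z] exI[of _ n]) (auto dest: order_antisym)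
qed

lemma Comp_nonempty: assumes "recurrent u" shows "\<exists>x\<in>Comp u. st x 0 = u"
proof -
  obtain x where "x \<in> X" "st x 0 = u" using assms recurrent_state stateE by blast
  then show ?thesis using periodic_approx[OF assms, of x 0 0] mutual_refl recurrent_state assms by fastforce
qed

text \<open>A component is again a subshift of this kind with the same \<open>N\<close>, so
  closedness, shift invariance and gluing for components come from interpreting the locale.\<close>

lemma Comp_window: "window_shift A N (S \<inter> {w. mutual u w}) (Comp u)"
  by standard (use finite_A N_pos S_words X_iff in \<open>auto simp: Comp_def\<close>)

section \<open>Non-wandering points and their decomposition into components\<close>

lemma NW_iff: "x \<in> NW A X \<longleftrightarrow> x \<in> X \<and> (\<forall>i. reach (st x (i + 1)) (st x i))"
proof
  assume x: "x \<in> NW A X"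
  then have xX: "x \<in> X" by (simp add: NW_def)
  have "reach (st x (i + 1)) (st x i)" for i
  proof -
    \<comment> \<open>Large enough to fix the windows of \<open>x\<close> at \<open>i\<close> and at
      \<open>i + 1\<close>: a point that stays this close to \<open>x\<close> and returns passes
      from the second window to the first.\<close>
    let ?m = "nat \<bar>i\<bar> + 1 + N"
    let ?U = "{y \<in> X. agree ?m x y}"
    have "openin (shift_top A X) ?U" unfolding openin_shift_top[OF X_topspace]
      using agree_trans by blast
    moreover have "x \<in> ?U" using xX by simp
    ultimately have "\<exists>V. openin (shift_top A X) V \<and> x \<in> V \<and> V \<subseteq> ?U" by blast
    moreover have "\<forall>U\<subseteq>X. (\<exists>V. openin (shift_top A X) V \<and> x \<in> V \<and> V \<subseteq> U) \<longrightarrow>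
      (\<exists>n\<ge>1. U \<inter> (shift ^^ n) ` U \<noteq> {})" using x unfolding NW_def by blast
    ultimately have "\<exists>n\<ge>1. ?U \<inter> (shift ^^ n) ` ?U \<noteq> {}" by (elim allE[of _ ?U]) blast
    then obtain n y where n: "n \<ge> 1" "y \<in> ?U" "sh (int n) y \<in> ?U" by (auto simp: shift_pow)
    have w: "st x j = st y' j" if "agree ?m x y'" "j = i \<or> j = i + 1" for y' j
      by (rule win_cong, rule agreeD[OF that(1)]) (use that(2) in auto)
    have "st x (i + 1) = st y (i + 1)" "st x i = st y (i + int n)"
      using w[of y "i + 1"] w[of "sh (int n) y" i] n by (auto simp: win_sh)
    then show ?thesis using reachI[of y "i + 1" "i + int n"] n by auto
  qed
  with xX show "x \<in> X \<and> (\<forall>i. reach (st x (i + 1)) (st x i))" by blast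
next
  assume R: "x \<in> X \<and> (\<forall>i. reach (st x (i + 1)) (st x i))"
  have rev_path: "reach (st x (i + int n)) (st x i)" for i n
  proof (induction n)
    case 0 then show ?case using reachI[of x i i] R by simp
  next
    case (Suc n)
    have "reach (st x (i + int n + 1)) (st x (i + int n))" using R by blast
    then have "reach (st x (i + int n + 1)) (st x i)" using reach_trans Suc by blast
    then show ?case by (simp add: algebra_simps)
  qed
  show "x \<in> NW A X" unfolding NW_def
  proof (intro CollectI conjI allI impI)
    show "x \<in> X" using R by simp
    fix U assume U: "U \<subseteq> X" "\<exists>V. openin (shift_top A X) V \<and> x \<in> V \<and> V \<subseteq> U"
    then obtain m where m: "\<forall>y\<in>X. agree m x y \<longrightarrow> y \<in> U"
      unfolding openin_shift_top[OF X_topspace] by blast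
    \<comment> \<open>Conversely, the central part of \<open>x\<close> closes up to a periodic point
      in the given neighborhood, which returns to itself after its period.\<close>
    have "reach (st x (int m + 1)) (st x (- int m))"
      using rev_path[of "- int m" "2 * m + 1"] by (simp add: algebra_simps)
    then obtain z p where z: "z \<in> X" "p > 0" "sh p z = z"
      "\<forall>k. - int m \<le> k \<and> k < int m + 1 + int N \<longrightarrow> z k = x k"
      using mutual_return[of x "- int m" "int m + 1"] R by auto
    have "agree m x z" unfolding agree_def
    proof (intro allI impI)
      fix i assume "\<bar>i\<bar> \<le> int m"
      then have "- int m \<le> i \<and> i < int m + 1 + int N" by auto
      then show "x i = z i" using z(4) by metis
    qed
    then have zU: "z \<in> U" using m z by blast
    have "(shift ^^ nat p) z = z" using z by (simp add: shift_pow)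
    then have "U \<inter> (shift ^^ nat p) ` U \<noteq> {}" using zU by (metis IntI empty_iff imageI)
    then show "\<exists>n\<ge>1. U \<inter> (shift ^^ n) ` U \<noteq> {}" using z(2) by (intro exI[of _ "nat p"]) auto
  qed
qed

lemma NW_reach: assumes "x \<in> NW A X" shows "reach (st x j) (st x i)"
proof (cases "j \<le> i")
  case True then show ?thesis using reachI[of x j i] assms NW_iff by blast
next
  case False
  have "reach (st x (i + int n)) (st x i)" for n
  proof (induction n)
    case 0 then show ?case using reachI[of x i i] assms NW_iff by simp
  next
    case (Suc n)
    have "reach (st x (i + int n + 1)) (st x (i + int n))" using assms NW_iff by blast
    then have "reach (st x (i + int n + 1)) (st x i)" using reach_trans Suc by blast
    then show ?case by (simp add: algebra_simps)
  qed
  from this[of "nat (j - i)"] show ?thesis using False by simp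
qed

lemma NW_recurrent: assumes "x \<in> NW A X" shows "recurrent (st x i)"
proof -
  have "x \<in> X" using assms NW_iff by blast
  then obtain z p where z: "z \<in> X" "p > 0" "sh p z = z" "st z i = st x i"
    using mutual_return[of x i "i + 1"] NW_reach[OF assms, of "i + 1" i] by force
  have "st z (i + p) = st z i" using z(3) by (metis win_sh)
  then show ?thesis using recurrentI[OF z(1), of i "i + p"] z by auto
qed

lemma NW_Comp: assumes "x \<in> NW A X" shows "x \<in> Comp (st x i)"
  using NW_reach[OF assms] assms NW_iff unfolding Comp_def mutual_def by blast

lemma Comp_NW: "Comp u \<subseteq> NW A X"
  using NW_iff reach_trans unfolding Comp_def mutual_def by blast

lemma NW_eq: "NW A X = (\<Union>u\<in>{u. recurrent u}. Comp u)"
  using Comp_NW NW_Comp NW_recurrent by blast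

text \<open>A point that follows \<open>y \<in> W\<close> and later \<open>x \<in> U\<close>
  witnesses the passage from \<open>W\<close> to \<open>U\<close>. Its windows in between stay in
  the class because those at both ends belong to it.\<close>

lemma Comp_irreducible: assumes u: "recurrent u" shows "irreducible_subshift A (Comp u)"
proof -
  interpret C: window_shift A N "S \<inter> {w. mutual u w}" "Comp u" by (rule Comp_window)
  have "\<exists>n\<ge>1. U \<inter> (shift ^^ n) ` W \<noteq> {}"
    if U: "openin (shift_top A (Comp u)) U" "U \<noteq> {}" and W: "openin (shift_top A (Comp u)) W" "W \<noteq> {}"
    for U W
  proof -
    obtain x m1 where x: "x \<in> U" "\<forall>y\<in>Comp u. agree m1 x y \<longrightarrow> y \<in> U"
      using U unfolding openin_shift_top[OF C.X_topspace] by blast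
    obtain y m2 where y: "y \<in> W" "\<forall>z\<in>Comp u. agree m2 y z \<longrightarrow> z \<in> W"
      using W unfolding openin_shift_top[OF C.X_topspace] by blast
    have xC: "x \<in> Comp u" and yC: "y \<in> Comp u"
      using x y U W unfolding openin_shift_top[OF C.X_topspace] by blast+
    then have xX: "x \<in> X" and yX: "y \<in> X" using Comp_subset by auto
    let ?m = "m1 + m2 + 1"
    have "reach (st y (int ?m)) (st x (- int ?m))"
      using xC yC unfolding Comp_def mutual_def using reach_trans by blast
    then obtain z l where z: "z \<in> X" "0 \<le> l" "\<And>k. k < int ?m + int N \<Longrightarrow> z k = y k"
      "\<And>k. int ?m + l \<le> k \<Longrightarrow> z k = x (k - int ?m - l + - int ?m)"
      "\<And>k. k \<le> int ?m \<Longrightarrow> st z k = st y k"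
      "\<And>k. int ?m + l \<le> k \<Longrightarrow> st z k = st x (k - int ?m - l + - int ?m)"
      using connect_reach[OF yX xX] by metis
    have mu: "mutual u (st z k)" if "k \<le> int ?m" for k using z(5)[OF that] yC by (simp add: Comp_def)
    have mu': "mutual u (st z k)" if "int ?m + l \<le> k" for k using z(6)[OF that] xC by (simp add: Comp_def)
    have "mutual u (st z k)" for k
    proof (cases "k \<le> int ?m \<or> int ?m + l \<le> k")
      case False
      then show ?thesis
        by (intro mutual_between[OF z(1) _ _ mu[of "int ?m"] mu'[of "int ?m + l"]]) auto
    qed (use mu mu' in blast)
    then have zC: "z \<in> Comp u" using z by (simp add: Comp_def)
    have zW: "z \<in> W" using y(2) zC z(3) by (auto simp: agree_def)
    \<comment> \<open>Position 0 of \<open>x\<close> has been placed at \<open>?n\<close> in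
      \<open>z\<close>; the summand 1 in \<open>?m\<close> makes \<open>?n\<close> positive.\<close>
    let ?n = "int ?m + l + int ?m"
    have "sh ?n z \<in> Comp u" using zC C.sh_X by blast
    moreover have "agree m1 x (sh ?n z)" using z(4) by (auto simp: agree_def sh_apply)
    ultimately have "sh ?n z \<in> U" using x(2) by blast
    then have "(shift ^^ nat ?n) z \<in> U" using z(2) by (simp add: shift_pow)
    then have "U \<inter> (shift ^^ nat ?n) ` W \<noteq> {}" using zW by blast
    then show ?thesis using z(2) by (intro exI[of _ "nat ?n"]) auto
  qed
  then show ?thesis unfolding irreducible_subshift_def
    using C.subshift_X Comp_nonempty[OF u] by blast
qed

definition comps :: "(int \<Rightarrow> 'a) set set" where "comps = Comp ` {u. recurrent u}"

lemma finite_comps: "finite comps"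
  unfolding comps_def
  by (intro finite_imageI finite_subset[OF _ finite_states]) (auto simp: recurrent_state)

lemma partition_comps: "partition_on (NW A X) comps"
proof (rule partition_onI)
  show "\<Union> comps = NW A X" unfolding comps_def NW_eq by simp
  show "disjnt p q" if pq: "p \<in> comps" "q \<in> comps" "p \<noteq> q" for p q
  proof -
    obtain u v where "p = Comp u" "q = Comp v" using pq comps_def by auto
    then show ?thesis using Comp_inter Comp_cong pq(3) unfolding disjnt_iff by blast
  qed
  show "{} \<notin> comps" using Comp_nonempty unfolding comps_def by blast
qed

end

text \<open>An irreducible subshift is not the disjoint union of two non-empty relatively open
  invariant sets.\<close>

lemma irreducible_image_in_piece:
  assumes Y: "irreducible_subshift A Y" and fin: "finite \<D>"
    and f: "continuous_map (shift_top A Y) (shift_top A Z) f" "\<And>x. x \<in> Y \<Longrightarrow> f (shift x) = shift (f x)"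
    and Z: "Z \<subseteq> topspace (full_shift A)"
    and D: "\<And>D. D \<in> \<D> \<Longrightarrow> subshift A D" "disjoint \<D>" "Z \<subseteq> \<Union>\<D>"
  shows "\<exists>D\<in>\<D>. f ` Y \<subseteq> D"
proof -
  have Yt: "Y \<subseteq> topspace (full_shift A)" and Ysh: "shift ` Y = Y" and Yne: "Y \<noteq> {}"
    using Y unfolding irreducible_subshift_def subshift_def by (auto dest: closedin_subset)
  obtain y where y: "y \<in> Y" using Yne by blast
  have fYZ: "f x \<in> Z" if "x \<in> Y" for x using f(1) that Yt Z unfolding continuous_map_shift_top[OF Yt Z] by blast
  obtain D where D0: "D \<in> \<D>" "f y \<in> D" using fYZ[OF y] D(3) by blast
  have cl: "closedin (shift_top A Y) {x \<in> Y. f x \<in> E}" if E: "closedin (full_shift A) E" for E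
  proof -
    have "closedin (shift_top A Z) (Z \<inter> E)" using E closedin_subtopology_Int_closed by blast
    then have "closedin (shift_top A Y) {x \<in> topspace (shift_top A Y). f x \<in> Z \<inter> E}"
      using f(1) closedin_continuous_map_preimage by blast
    then have "closedin (shift_top A Y) {x \<in> Y. f x \<in> Z \<inter> E}" unfolding topspace_shift_top[OF Yt] .
    moreover have "{x \<in> Y. f x \<in> Z \<inter> E} = {x \<in> Y. f x \<in> E}" using fYZ by blast
    ultimately show ?thesis by simp
  qed
  let ?E = "\<Union>(\<D> - {D})"
  have clE: "closedin (full_shift A) ?E"
    using fin D(1) unfolding subshift_def by (intro closedin_Union) auto
  have clD: "closedin (full_shift A) D" using D(1) D0 unfolding subshift_def by blast
  have dis: "D \<inter> ?E = {}" using D(2) D0(1) unfolding disjoint_def by blast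
  let ?U = "{x \<in> Y. f x \<in> D}" and ?W = "{x \<in> Y. f x \<in> ?E}"
  have cov: "D \<union> ?E = \<Union>\<D>" using D0 by blast
  have fDE: "f x \<in> D \<union> ?E" if "x \<in> Y" for x using fYZ[OF that] D(3) unfolding cov by blast
  have "?U = Y - ?W" using fDE dis by blast
  then have oU: "openin (shift_top A Y) ?U"
    using cl[OF clE] unfolding closedin_def topspace_shift_top[OF Yt] by auto
  have "?W = Y - ?U" using fDE dis by blast
  then have oW: "openin (shift_top A Y) ?W"
    using cl[OF clD] unfolding closedin_def topspace_shift_top[OF Yt] by auto
  \<comment> \<open>The image of an orbit that starts in \<open>?W\<close> stays in one of the
    other, invariant pieces, so the orbit never meets \<open>?U\<close>, against
    irreducibility.\<close>
  have "?W = {}"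
  proof (rule ccontr)
    assume "?W \<noteq> {}"
    then obtain n where n: "?U \<inter> (shift ^^ n) ` ?W \<noteq> {}"
      using Y oU oW y D0 unfolding irreducible_subshift_def
      by (metis (mono_tags, lifting) empty_iff mem_Collect_eq)
    then obtain w where w: "w \<in> ?W" "(shift ^^ n) w \<in> ?U" by blast
    have wY: "(shift ^^ k) w \<in> Y" for k using w Ysh by (induction k) auto
    have fk: "f ((shift ^^ k) w) = (shift ^^ k) (f w)" for k
      using f(2)[OF wY] by (induction k) auto
    obtain D' where D': "D' \<in> \<D> - {D}" "f w \<in> D'" using w by blast
    have "(shift ^^ k) (f w) \<in> D'" for k
      using D(1)[of D'] D' by (induction k) (auto simp: subshift_def)
    then have "f ((shift ^^ n) w) \<in> D'" using fk by simp
    then show False using w D' dis by blast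
  qed
  then have "f ` Y \<subseteq> D" using fDE by blast
  then show ?thesis using D0 by blast
qed

lemma irreducible_in_piece:
  assumes Y: "irreducible_subshift A Y" and fin: "finite \<D>"
    and D: "\<And>D. D \<in> \<D> \<Longrightarrow> subshift A D" "disjoint \<D>" "Y \<subseteq> \<Union>\<D>"
  shows "\<exists>D\<in>\<D>. Y \<subseteq> D"
proof -
  have Yt: "Y \<subseteq> topspace (full_shift A)"
    using Y unfolding irreducible_subshift_def subshift_def by (auto dest: closedin_subset)
  from irreducible_image_in_piece[OF Y fin _ _ Yt D, of "\<lambda>x. x"] show ?thesis by auto
qed

context window_shift begin

text \<open>Uniqueness: an irreducible subshift lies in one piece of any finite partition into
  subshifts, so two such partitions refine each other.\<close>

lemma irred_components_eq: "irred_components A X = comps"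
  unfolding irred_components_def
proof (rule the_equality)
  show P: "finite comps \<and> partition_on (NW A X) comps \<and> (\<forall>C\<in>comps. irreducible_subshift A C)"
    using finite_comps partition_comps Comp_irreducible unfolding comps_def by blast
  fix \<D> assume Q: "finite \<D> \<and> partition_on (NW A X) \<D> \<and> (\<forall>C\<in>\<D>. irreducible_subshift A C)"
  have sub: "\<E> \<subseteq> \<F>" if E: "partition_on (NW A X) \<E>" "\<forall>C\<in>\<E>. irreducible_subshift A C" "finite \<E>"
    and F: "partition_on (NW A X) \<F>" "\<forall>C\<in>\<F>. irreducible_subshift A C" "finite \<F>" for \<E> \<F>
  proof
    have piece: "\<exists>D\<in>\<F>. C \<subseteq> D" if E: "partition_on (NW A X) \<E>" "\<forall>C\<in>\<E>. irreducible_subshift A C"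
      and F: "partition_on (NW A X) \<F>" "\<forall>C\<in>\<F>. irreducible_subshift A C" "finite \<F>" and C: "C \<in> \<E>" for C \<E> \<F>
    proof (rule irreducible_in_piece[of A])
      show "C \<subseteq> \<Union>\<F>" using E(1) F(1) C unfolding partition_on_def by blast
    qed (use E F C in \<open>auto simp: partition_on_def irreducible_subshift_def\<close>)
    fix C assume C: "C \<in> \<E>"
    obtain D where D: "D \<in> \<F>" "C \<subseteq> D" using piece[OF E(1,2) F C] by blast
    obtain C' where C': "C' \<in> \<E>" "D \<subseteq> C'" using piece[OF F(1,2) E(1,2,3) D(1)] by blast
    have "C \<noteq> {}" using C E(2) irreducible_subshift_def by blast
    then have "C = C'" using C C' D partition_onD2[OF E(1)] unfolding disjoint_def by blast
    then show "C \<in> \<F>" using C' D by auto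
  qed
  show "\<D> = comps" using sub[of \<D> comps] sub[of comps \<D>] P Q by blast
qed

end

lemma sft_window_shift:
  assumes A: "finite A" and X: "sft A X"
  shows "\<exists>N S. window_shift A N S X"
proof -
  obtain n S0 where S0: "S0 \<subseteq> {w. length w = n \<and> set w \<subseteq> A}"
    "X = {x \<in> topspace (full_shift A). \<forall>i. map (\<lambda>k. x (i + int k)) [1..<n+1] \<in> S0}"
    using X unfolding sft_def finite_type_def by blast
  \<comment> \<open>One letter is put in front of the words of \<open>S0\<close>. This makes the
    length positive even for \<open>n = 0\<close>, turns the positions
    \<open>i + 1, ..., i + n\<close> into the tail of the window at \<open>i\<close>, and forces all
    letters into \<open>A\<close>.\<close>
  let ?S = "{w. length w = Suc n \<and> set w \<subseteq> A \<and> tl w \<in> S0}"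
  have tl: "tl (win (Suc n) x i) = map (\<lambda>k. x (i + int k)) [1..<n+1]" for x :: "int \<Rightarrow> 'a" and i
    by (simp add: win_def map_tl[symmetric] tl_upt del: upt_Suc)
  have "window_shift A (Suc n) ?S X"
  proof
    show "X = {x. \<forall>i. win (Suc n) x i \<in> ?S}" (is "_ = ?R")
    proof
      show "X \<subseteq> ?R" using S0(2) by (auto simp: tl topspace_full_shift simp del: upt_Suc) (auto simp: win_def)
      show "?R \<subseteq> X"
      proof
        fix x assume x: "x \<in> ?R"
        have "x i \<in> A" for i
        proof -
          have "set (win (Suc n) x i) \<subseteq> A" using x by auto
          moreover have "x i = x (i + int 0)" by simp
          then have "x i \<in> set (win (Suc n) x i)" unfolding win_def set_map by (intro image_eqI[of _ _ 0]) auto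
          ultimately show ?thesis by blast
        qed
        then show "x \<in> X" using x S0(2) by (auto simp: tl topspace_full_shift simp del: upt_Suc)
      qed
    qed
  qed (use A in auto)
  then show ?thesis by blast
qed

section \<open>The poset of components\<close>

context window_shift begin

section \<open>Limit sets and the classes at both ends of a point\<close>

lemma infinite_visits:
  fixes f :: "nat \<Rightarrow> 'a list"
  assumes "\<And>n. f n \<in> states"
  shows "\<exists>j. \<forall>k\<ge>j. \<exists>i\<ge>k. f i = f j"
proof -
  have "finite (range f)" using assms finite_states finite_subset by (metis image_subsetI)
  then obtain j where "infinite {i \<in> UNIV. f i = f j}"
    using pigeonhole_infinite[of UNIV f] by auto
  then show ?thesis using infinite_nat_iff_unbounded_le by (metis (mono_tags, lifting) mem_Collect_eq)
qed

text \<open>By pigeonhole some window occurs infinitely often to the right. From one of its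
  occurrences on, every window leads back to it.\<close>

lemma forward_class:
  assumes x: "x \<in> X"
  shows "\<exists>j\<ge>b. recurrent (st x j) \<and> (\<forall>k\<ge>j. mutual (st x j) (st x k))"
proof -
  obtain j0 where j0: "\<forall>k\<ge>j0. \<exists>i\<ge>k. st x (b + int i) = st x (b + int j0)"
    using infinite_visits[of "\<lambda>n. st x (b + int n)"] x st_in_states by auto
  let ?j = "b + int j0"
  have ret: "\<exists>i>k. st x i = st x ?j" if "k \<ge> ?j" for k
  proof -
    have "j0 \<le> nat (k - b) + 1" using that by linarith
    then obtain i where "i \<ge> nat (k - b) + 1" "st x (b + int i) = st x ?j"
      using j0 by blast
    then show ?thesis by (intro exI[of _ "b + int i"]) auto
  qed
  have "mutual (st x ?j) (st x k)" if k: "k \<ge> ?j" for k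
    using ret[OF k] reachI[OF x] k unfolding mutual_def by (metis less_imp_le)
  moreover have "recurrent (st x ?j)" using ret[of ?j] recurrentI[OF x] by fastforce
  ultimately show ?thesis by (intro exI[of _ ?j]) auto
qed

lemma backward_class:
  assumes x: "x \<in> X"
  shows "\<exists>j\<le>b. recurrent (st x j) \<and> (\<forall>k\<le>j. mutual (st x j) (st x k))"
proof -
  obtain j0 where j0: "\<forall>k\<ge>j0. \<exists>i\<ge>k. st x (b - int i) = st x (b - int j0)"
    using infinite_visits[of "\<lambda>n. st x (b - int n)"] x st_in_states by auto
  let ?j = "b - int j0"
  have ret: "\<exists>i<k. st x i = st x ?j" if "k \<le> ?j" for k
  proof -
    have "j0 \<le> nat (b - k) + 1" using that by linarith
    then obtain i where "i \<ge> nat (b - k) + 1" "st x (b - int i) = st x ?j"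
      using j0 by blast
    then show ?thesis by (intro exI[of _ "b - int i"]) auto
  qed
  have "mutual (st x ?j) (st x k)" if k: "k \<le> ?j" for k
    using ret[OF k] reachI[OF x] k unfolding mutual_def by (metis less_imp_le)
  moreover have "recurrent (st x ?j)" using ret[of ?j] recurrentI[OF x] by fastforce
  ultimately show ?thesis by (intro exI[of _ ?j]) auto
qed

lemma limit_in_Comp:
  fixes f :: "nat \<Rightarrow> int"
  assumes x: "x \<in> X" and y: "limitin (full_shift A) (\<lambda>k. sh (f k) x) y sequentially"
    and ev: "\<And>i. eventually (\<lambda>k. mutual u (st x (i + f k))) sequentially"
  shows "y \<in> Comp u"
proof -
  have shx: "sh (f k) x \<in> topspace (full_shift A)" for k using x sh_X X_topspace by blast
  have "mutual u (st y i) \<and> st y i \<in> states" for i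
  proof -
    have "eventually (\<lambda>k. agree (nat \<bar>i\<bar> + N) y (sh (f k) x)) sequentially"
      using y unfolding limitin_full_shift[OF shx] by blast
    then have "eventually (\<lambda>k. mutual u (st x (i + f k)) \<and> agree (nat \<bar>i\<bar> + N) y (sh (f k) x)) sequentially"
      using ev[of i] by (simp add: eventually_conj)
    then obtain k where k: "mutual u (st x (i + f k))" "agree (nat \<bar>i\<bar> + N) y (sh (f k) x)"
      using eventually_happens'[OF sequentially_bot] by blast
    have "st y i = st (sh (f k) x) i" by (rule win_cong, rule agreeD[OF k(2)]) auto
    then show ?thesis using k x st_in_states by (simp add: win_sh)
  qed
  then show ?thesis unfolding Comp_def using X_by_states by blast
qed

lemma omega_limit_eq: "omega_limit A x = {y. \<exists>n::nat \<Rightarrow> nat. strict_mono n \<and>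
      limitin (full_shift A) (\<lambda>k. sh (int (n k)) x) y sequentially}"
  by (simp add: omega_limit_def shift_pow)

lemma alpha_limit_eq: "alpha_limit A x = {y. \<exists>n::nat \<Rightarrow> nat. strict_mono n \<and>
      limitin (full_shift A) (\<lambda>k. sh (- int (n k)) x) y sequentially}"
  by (simp add: alpha_limit_def inv_shift_pow)

lemma sh_subseq_limit:
  assumes x: "x \<in> X"
  shows "\<exists>l r. strict_mono (r :: nat \<Rightarrow> nat) \<and>
    limitin (full_shift A) (\<lambda>k. sh (f (r k)) x) l sequentially"
proof -
  have "sh (f k) x \<in> topspace (full_shift A)" for k using x sh_X X_topspace by blast
  then show ?thesis using full_shift_convergent_subseq[OF finite_A, of "\<lambda>k. sh (f k) x"]
    by (simp add: comp_def)
qed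

lemma C_omega_eq:
  assumes x: "x \<in> X" and u: "recurrent u" and m: "\<And>k. k \<ge> j \<Longrightarrow> mutual u (st x k)"
  shows "C_omega A X x = Comp u"
proof -
  have sub: "omega_limit A x \<subseteq> Comp u"
  proof
    fix y assume "y \<in> omega_limit A x"
    then obtain n :: "nat \<Rightarrow> nat" where n: "strict_mono n"
      "limitin (full_shift A) (\<lambda>k. sh (int (n k)) x) y sequentially"
      unfolding omega_limit_eq by blast
    show "y \<in> Comp u"
    proof (rule limit_in_Comp[OF x n(2)])
      fix i
      have "\<forall>k\<ge>nat (j - i). mutual u (st x (i + int (n k)))"
      proof (intro allI impI)
        fix k assume "k \<ge> nat (j - i)"
        with seq_suble[OF n(1), of k] show "mutual u (st x (i +  int (n k)))"
          by (intro m) linarith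
      qed
      then show "eventually (\<lambda>k. mutual u (st x (i + int (n k)))) sequentially"
        unfolding eventually_sequentially by blast
    qed
  qed
  \<comment> \<open>A limit point, which exists by compactness, is what singles out the component:
    an empty limit set would be contained in all of them.\<close>
  obtain y where y: "y \<in> omega_limit A x"
    using sh_subseq_limit[OF x, of "\<lambda>k. int k"] unfolding omega_limit_eq by blast
  show ?thesis unfolding C_omega_def irred_components_eq
  proof (rule the_equality)
    show "Comp u \<in> comps \<and> omega_limit A x \<subseteq> Comp u" using sub u comps_def by blast
    fix C assume C: "C \<in> comps \<and> omega_limit A x \<subseteq> C"
    then obtain v where "C = Comp v" unfolding comps_def by blast
    then show "C = Comp u" using Comp_inter[of y u v] C sub y Comp_cong by blast
  qed
qed

lemma C_alpha_eq:
  assumes x: "x \<in> X" and u: "recurrent u" and m: "\<And>k. k \<le> j \<Longrightarrow> mutual u (st x k)"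
  shows "C_alpha A X x = Comp u"
proof -
  have sub: "alpha_limit A x \<subseteq> Comp u"
  proof
    fix y assume "y \<in> alpha_limit A x"
    then obtain n :: "nat \<Rightarrow> nat" where n: "strict_mono n"
      "limitin (full_shift A) (\<lambda>k. sh (- int (n k)) x) y sequentially"
      unfolding alpha_limit_eq by blast
    show "y \<in> Comp u"
    proof (rule limit_in_Comp[OF x n(2)])
      fix i
      have "\<forall>k\<ge>nat (i - j). mutual u (st x (i + - int (n k)))"
      proof (intro allI impI)
        fix k assume "k \<ge> nat (i - j)"
        with seq_suble[OF n(1), of k] show "mutual u (st x (i + - int (n k)))"
          by (intro m) linarith
      qed
      then show "eventually (\<lambda>k. mutual u (st x (i + - int (n k)))) sequentially"
        unfolding eventually_sequentially by blast
    qed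
  qed
  obtain y where y: "y \<in> alpha_limit A x"
    using sh_subseq_limit[OF x, of "\<lambda>k. - int k"] unfolding alpha_limit_eq by blast
  show ?thesis unfolding C_alpha_def irred_components_eq
  proof (rule the_equality)
    show "Comp u \<in> comps \<and> alpha_limit A x \<subseteq> Comp u" using sub u comps_def by blast
    fix C assume C: "C \<in> comps \<and> alpha_limit A x \<subseteq> C"
    then obtain v where "C = Comp v" unfolding comps_def by blast
    then show "C = Comp u" using Comp_inter[of y u v] C sub y Comp_cong by blast
  qed
qed

lemma Comp_eq_iff: "recurrent u \<Longrightarrow> Comp u = Comp v \<longleftrightarrow> mutual u v"
  using Comp_cong[of u v] Comp_inter[of _ u v] Comp_nonempty[of u] by auto

lemma comp_le_iff:
  assumes u: "recurrent u" and v: "recurrent v"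
  shows "comp_le A X (Comp u) (Comp v) \<longleftrightarrow> reach u v"
proof
  assume "comp_le A X (Comp u) (Comp v)"
  then obtain x where x: "x \<in> X" "C_alpha A X x = Comp u" "C_omega A X x = Comp v"
    unfolding comp_le_def by blast
  obtain i where i: "i \<le> 0" "recurrent (st x i)" "\<forall>k\<le>i. mutual (st x i) (st x k)"
    using backward_class[OF x(1), of 0] by auto
  obtain j where j: "j \<ge> 0" "recurrent (st x j)" "\<forall>k\<ge>j. mutual (st x j) (st x k)"
    using forward_class[OF x(1), of 0] by auto
  have "Comp u = Comp (st x i)" using C_alpha_eq[OF x(1) i(2), of i] i x by simp
  then have "mutual u (st x i)" using Comp_eq_iff u by blast
  moreover have "Comp v = Comp (st x j)" using C_omega_eq[OF x(1) j(2), of j] j x by simp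
  then have "mutual v (st x j)" using Comp_eq_iff v by blast
  moreover have "reach (st x i) (st x j)" using reachI[OF x(1)] i(1) j(1) by simp
  ultimately show "reach u v" unfolding mutual_def using reach_trans by blast
next
  assume r: "reach u v"
  obtain x where x: "x \<in> Comp u" "st x 0 = u" using Comp_nonempty[OF u] by blast
  obtain y where y: "y \<in> Comp v" "st y 0 = v" using Comp_nonempty[OF v] by blast
  have xX: "x \<in> X" and yX: "y \<in> X" using x y Comp_subset by auto
  obtain z l where z: "z \<in> X" "\<And>k. k \<le> 0 \<Longrightarrow> st z k = st x k"
    "\<And>k. 0 + l \<le> k \<Longrightarrow> st z k = st y (k - 0 - l + 0)"
    using connect_reach[OF xX yX, of 0 0] r x y by metis
  have "C_alpha A X z = Comp u" by (rule C_alpha_eq[OF z(1) u, of 0]) (use z x in \<open>auto simp: Comp_def\<close>)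
  moreover have "C_omega A X z = Comp v" by (rule C_omega_eq[OF z(1) v, of l]) (use z y in \<open>auto simp: Comp_def\<close>)
  ultimately show "comp_le A X (Comp u) (Comp v)" unfolding comp_le_def using z by blast
qed

definition rmin :: "'a list \<Rightarrow> bool" where "rmin u \<longleftrightarrow> (\<forall>v. recurrent v \<and> reach v u \<longrightarrow> reach u v)"
definition rmax :: "'a list \<Rightarrow> bool" where "rmax u \<longleftrightarrow> (\<forall>v. recurrent v \<and> reach u v \<longrightarrow> reach v u)"

lemma minimal_comp_iff: assumes u: "recurrent u" shows "minimal_comp A X (Comp u) \<longleftrightarrow> rmin u"
proof -
  have "minimal_comp A X (Comp u) \<longleftrightarrow> (\<forall>v. recurrent v \<longrightarrow> comp_le A X (Comp v) (Comp u) \<longrightarrow> Comp v = Comp u)"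
    unfolding minimal_comp_def irred_components_eq comps_def using u by blast
  then show ?thesis
    unfolding rmin_def using comp_le_iff[OF _ u] Comp_eq_iff unfolding mutual_def by blast
qed

lemma maximal_comp_iff: assumes u: "recurrent u" shows "maximal_comp A X (Comp u) \<longleftrightarrow> rmax u"
proof -
  have "maximal_comp A X (Comp u) \<longleftrightarrow> (\<forall>v. recurrent v \<longrightarrow> comp_le A X (Comp u) (Comp v) \<longrightarrow> Comp v = Comp u)"
    unfolding maximal_comp_def irred_components_eq comps_def using u by blast
  then show ?thesis
    unfolding rmax_def using comp_le_iff[OF u] Comp_eq_iff unfolding mutual_def by blast
qed

text \<open>Condition (c) in terms of states, with which each of the other four conditions is
  compared.\<close>

definition low_poset :: bool
  where "low_poset \<longleftrightarrow> (\<forall>u. recurrent u \<longrightarrow> rmin u \<or> rmax u) \<and>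
    (\<forall>u. recurrent u \<and> infinite (Comp u) \<longrightarrow> rmin u \<and> rmax u)"

lemma low_poset_iff:
  "low_poset \<longleftrightarrow> (\<forall>C\<in>irred_components A X. extremal_comp A X C) \<and>
       (\<forall>C\<in>irred_components A X. infinite C \<longrightarrow> isolated_comp A X C)"
  unfolding low_poset_def irred_components_eq comps_def extremal_comp_def isolated_comp_def
  using minimal_comp_iff maximal_comp_iff by auto

text \<open>Among the recurrent states above \<open>u\<close>, take one that reaches the fewest
  states: a step that cannot be undone would lose some of them.\<close>

lemma ex_rmax_above: assumes u: "recurrent u" shows "\<exists>v. recurrent v \<and> rmax v \<and> reach u v"
proof -
  let ?P = "\<lambda>v. recurrent v \<and> reach u v"
  have "?P u" using u reach_refl recurrent_state by blast
  then obtain v where v: "?P v" "\<And>w. ?P w \<Longrightarrow> card {s. reach v s} \<le> card {s. reach w s}"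
    using ex_has_least_nat[of ?P u "\<lambda>v. card {s. reach v s}"] by blast
  have fin: "finite {s. reach v s}" for v using finite_states finite_subset reach_states by (metis (no_types, lifting) mem_Collect_eq subsetI)
  have "reach w v" if w: "recurrent w" "reach v w" for w
  proof (rule ccontr)
    assume n: "\<not> reach w v"
    have "{s. reach w s} \<subset> {s. reach v s}"
      using n w v reach_trans reach_refl recurrent_state by blast
    then have "card {s. reach w s} < card {s. reach v s}" using psubset_card_mono fin by blast
    moreover have "?P w" using w v reach_trans by blast
    ultimately show False using v(2)[of w] by simp
  qed
  then show ?thesis using v unfolding rmax_def by blast
qed

section \<open>Finite and infinite components\<close>

lemma finite_periodic: assumes "p > 0" shows "finite {x \<in> X. sh p x = x}"
proof (rule inj_on_finite)
  have eq: "x (k mod p) = x k" if "sh p x = x" for x :: "int \<Rightarrow> 'a" and k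
  proof -
    have "x (k mod p) = x (k mod p + p * (k div p))"
    proof (cases "k div p \<ge> 0")
      case True
      have "sh (int (nat (k div p)) * p) x = x" by (rule sh_mult[OF that])
      then have "sh (p * (k div p)) x (k mod p) = x (k mod p)" using True by (simp add: mult.commute)
      then show ?thesis by (simp add: sh_apply)
    next
      case False
      have "sh (int (nat (- (k div p))) * p) x = x" by (rule sh_mult[OF that])
      then have "sh (- (k div p) * p) x k = x k" using False by simp
      moreover have "k + - (k div p) * p = k mod p" by (simp add: minus_div_mult_eq_mod)
      ultimately show ?thesis by (simp add: sh_apply)
    qed
    then show ?thesis by (simp add: mult.commute)
  qed
  show "inj_on (\<lambda>x. win (nat p) x 0) {x \<in> X. sh p x = x}"
  proof (rule inj_onI)
    fix x y assume xy: "x \<in> {x \<in> X. sh p x = x}" "y \<in> {x \<in> X. sh p x = x}" "win (nat p) x 0 = win (nat p) y 0"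
    show "x = y"
    proof
      fix k
      have "x (k mod p) = y (k mod p)" using xy(3) assms unfolding win_eq_Ico by simp
      then show "x k = y k" using eq[of x k] eq[of y k] xy by simp
    qed
  qed
  show "(\<lambda>x. win (nat p) x 0) ` {x \<in> X. sh p x = x} \<subseteq> {w. set w \<subseteq> A \<and> length w = nat p}"
    using X_topspace unfolding topspace_full_shift win_def by fastforce
  show "finite {w. set w \<subseteq> A \<and> length w = nat p}" using finite_lists_length_eq[OF finite_A] .
qed

lemma sh_prod_period:
  assumes "finite F" "\<And>x. x \<in> F \<Longrightarrow> sh (p x) x = x \<and> p x > 0" "x \<in> F"
  shows "sh (\<Prod>y\<in>F. p y) x = x"
proof -
  have "(\<Prod>y\<in>F. p y) = (\<Prod>y\<in>F - {x}. p y) * p x" using assms by (simp add: prod.remove mult.commute)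
  moreover have "(\<Prod>y\<in>F - {x}. p y) \<ge> 0" using assms by (intro prod_nonneg) (auto simp: less_imp_le)
  moreover have "sh (int (nat (\<Prod>y\<in>F - {x}. p y)) * p x) x = x" using sh_mult assms by blast
  ultimately show ?thesis by simp
qed

lemma finite_Comp_period:
  assumes fin: "finite (Comp u)"
  shows "\<exists>p>0. \<forall>x\<in>Comp u. sh p x = x"
proof -
  interpret C: window_shift A N "S \<inter> {w. mutual u w}" "Comp u" by (rule Comp_window)
  have "\<exists>p>0. sh p x = x" if x: "x \<in> Comp u" for x
  proof -
    have "range (\<lambda>n::nat. sh (int n) x) \<subseteq> Comp u" using x C.sh_X by blast
    then have "\<not> inj (\<lambda>n::nat. sh (int n) x)" using fin finite_subset range_inj_infinite by blast
    then obtain m n :: nat where "m \<noteq> n" "sh (int m) x = sh (int n) x" unfolding inj_def by blast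
    then obtain m n :: nat where "m < n" "sh (int m) x = sh (int n) x" by (metis linorder_neqE_nat)
    then have "sh (- int m) (sh (int m) x) = sh (- int m) (sh (int n) x)" "int n - int m > 0" by auto
    then show ?thesis by (intro exI[of _ "int n - int m"]) auto
  qed
  then obtain p where p: "\<And>x. x \<in> Comp u \<Longrightarrow> sh (p x) x = x \<and> p x > 0" by metis
  have "\<forall>x\<in>Comp u. sh (\<Prod>y\<in>Comp u. p y) x = x" using sh_prod_period[OF fin] p by blast
  moreover have "(\<Prod>y\<in>Comp u. p y) > 0" using p by (intro prod_pos) blast
  ultimately show ?thesis by blast
qed

text \<open>Switching from \<open>z\<close> to \<open>w\<close> at \<open>i\<close> gives a point of
  the component, which has the common period. Being \<open>z\<close> on the left and
  \<open>w\<close> on the right, it equals both.\<close>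

lemma finite_Comp_unique:
  assumes fin: "finite (Comp u)" and zw: "z \<in> Comp u" "w \<in> Comp u" "st z i = st w i"
  shows "z = w"
proof -
  interpret C: window_shift A N "S \<inter> {w. mutual u w}" "Comp u" by (rule Comp_window)
  obtain p where p: "p > 0" "\<And>x. x \<in> Comp u \<Longrightarrow> sh p x = x" using finite_Comp_period[OF fin] by blast
  let ?v = "glue i z w"
  have v: "?v \<in> Comp u" using C.glue_X zw by blast
  have mv: "x (k + int n * p) = x k" if "x \<in> Comp u" for x k n
    using sh_mult[OF p(2)[OF that], of n] by (metis sh_apply)
  have large: "int (nat \<bar>a\<bar>) * p \<ge> a" for a
    using p(1) mult_left_mono[of 1 p "int (nat \<bar>a\<bar>)"] by auto
  have "z k = ?v k" for k
  proof -
    let ?n = "nat \<bar>k - i\<bar> + 1"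
    have "int ?n * p > k - i" using large[of "k - i"] p by (simp add: algebra_simps)
    then have k': "k - int ?n * p < i" by linarith
    have "z (k - int ?n * p) = ?v (k - int ?n * p)" using k' by (simp add: glue_def)
    then show ?thesis using mv[OF zw(1), of "k - int ?n * p" ?n] mv[OF v, of "k - int ?n * p" ?n] by simp
  qed
  moreover have "w k = ?v k" for k
  proof -
    let ?n = "nat \<bar>i - k\<bar>"
    have "i \<le> k + int ?n * p" using large[of "i - k"] by linarith
    then have "w (k + int ?n * p) = ?v (k + int ?n * p)" by (simp add: glue_def)
    then show ?thesis using mv[OF zw(2), of k ?n] mv[OF v, of k ?n] by metis
  qed
  ultimately show ?thesis by auto
qed

text \<open>Transfers this rigidity to segments of arbitrary points of \<open>X\<close>, which are
  replaced by periodic points of the component.\<close>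

lemma finite_Comp_det:
  assumes u: "recurrent u" and fin: "finite (Comp u)" and xy: "x \<in> X" "y \<in> X"
    and m: "mutual u (st x i)" "mutual u (st x j)" "mutual u (st y i)" "mutual u (st y j)"
    and l: "i \<le> l" "l \<le> j" "st x l = st y l" and k: "i \<le> k" "k < j + int N"
  shows "x k = y k"
proof -
  obtain z where z: "z \<in> Comp u" "\<forall>k. i \<le> k \<and> k < j + int N \<longrightarrow> z k = x k" "\<forall>k. i \<le> k \<and> k \<le> j \<longrightarrow> st z k = st x k"
    using periodic_approx[OF u xy(1) _ m(1,2)] l by force
  obtain w where w: "w \<in> Comp u" "\<forall>k. i \<le> k \<and> k < j + int N \<longrightarrow> w k = y k" "\<forall>k. i \<le> k \<and> k \<le> j \<longrightarrow> st w k = st y k"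
    using periodic_approx[OF u xy(2) _ m(3,4)] l by force
  have "z = w" using finite_Comp_unique[OF fin z(1) w(1), of l] z(3) w(3) l by simp
  then show ?thesis using z(2) w(2) k by metis
qed

lemma loop_through:
  assumes z: "z \<in> X" "a \<le> b" and r: "reach u (st z a)" "reach (st z b) u"
  obtains q l m where "q \<in> X" "0 \<le> l" "l + (b - a) \<le> m" "st q 0 = u" "st q m = u"
    "\<And>k. 0 \<le> k \<Longrightarrow> k < b - a + int N \<Longrightarrow> q (l + k) = z (a + k)"
proof -
  have "u \<in> states" using r reach_states by blast
  then obtain xu where xu: "xu \<in> X" "st xu 0 = u" by (rule stateE)
  obtain y l where y: "y \<in> X" "0 \<le> l" "\<And>k. k \<le> 0 \<Longrightarrow> st y k = st xu k"
    "\<And>k. 0 + l \<le> k \<Longrightarrow> y k = z (k - 0 - l + a)" "\<And>k. 0 + l \<le> k \<Longrightarrow> st y k = st z (k - 0 - l + a)"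
    using connect_reach[OF xu(1) z(1), of 0 a] r xu by metis
  have "reach (st y (l + (b - a))) (st xu 0)" using y z r xu by simp
  then obtain q l' where q: "q \<in> X" "0 \<le> l'" "\<And>k. k < l + (b - a) + int N \<Longrightarrow> q k = y k"
    "\<And>k. k \<le> l + (b - a) \<Longrightarrow> st q k = st y k"
    "\<And>k. l + (b - a) + l' \<le> k \<Longrightarrow> st q k = st xu (k - (l + (b - a)) - l' + 0)"
    using connect_reach[OF y(1) xu(1)] by metis
  show ?thesis
    by (rule that[of q l "l + (b - a) + l'"]) (use q y z xu in \<open>auto simp: add.commute\<close>)
qed

text \<open>Suppose loops at \<open>u\<close> of equal length always coincide. Then a loop of length
  \<open>m\<close> run \<open>p\<close> times is the loop of length \<open>p\<close> run
  \<open>m\<close> times. Every segment of the component lies on a loop at \<open>u\<close>, so all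
  its points would have period \<open>p\<close>, and there are finitely many of these.\<close>

lemma infinite_Comp_loops:
  assumes u: "recurrent u" and inf: "infinite (Comp u)"
  obtains x y d where "d > 0" "x \<in> X" "y \<in> X" "st x 0 = u" "st x d = u" "st y 0 = u" "st y d = u"
    "\<exists>k. 0 \<le> k \<and> k < d \<and> x k \<noteq> y k"
proof (rule ccontr)
  assume nt: "\<not> thesis"
  note T = that
  have uniq: "x k = y k" if "d > 0" "x \<in> X" "y \<in> X" "st x 0 = u" "st x d = u" "st y 0 = u" "st y d = u"
    "0 \<le> k" "k < d" for x y d k
    using nt T[OF that(1-7)] that(8,9) by blast
  obtain x0 p where x0: "x0 \<in> X" "p > 0" "st x0 0 = u" "st x0 p = u" using u recurrent_def by blast
  have "sh p z = z" if z: "z \<in> Comp u" for z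
  proof
    fix a
    have zX: "z \<in> X" "reach u (st z a)" "reach (st z (a + p)) u" using z by (auto simp: Comp_def mutual_def)
    obtain q l m where q: "q \<in> X" "0 \<le> l" "l + p \<le> m" "st q 0 = u" "st q m = u"
      "\<And>k. 0 \<le> k \<Longrightarrow> k < p + int N \<Longrightarrow> q (l + k) = z (a + k)"
      by (rule loop_through[of z a "a + p" u]) (use zX x0 in auto)
    have m: "m > 0" using q x0 by linarith
    \<comment> \<open>Both loops are run up to the common length \<open>m * p\<close>, where
      uniqueness applies.\<close>
    have *: "per m q k = per p x0 k" if k: "0 \<le> k" "k < m * p" for k
    proof (rule uniq[of "m * p"])
      show "st (per m q) 0 = u" "st (per m q) (m * p) = u" "st (per p x0) 0 = u" "st (per p x0) (m * p) = u"
        using win_per[of m N q] win_per[of p N x0] m x0 q by auto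
      show "per m q \<in> X" "per p x0 \<in> X" using per_X m x0 q by auto
    qed (use k m x0 in auto)
    have "st q 0 = st q m" using q by simp
    note pp = per_eq[OF m this]
    \<comment> \<open>The comparison at \<open>l + p\<close> requires \<open>l + p < m * p\<close>.
      This can fail only if \<open>p = 1\<close> and \<open>l + p = m\<close>; position 0 is then
      used instead.\<close>
    have lt: "l + p < m * p \<or> l + p = m"
    proof (cases "p = 1")
      case False
      then have "m * 2 \<le> m * p" using x0 m by (intro mult_left_mono) auto
      then show ?thesis using q m by linarith
    qed (use q in auto)
    have "q (l + p) = q l"
    proof -
      have per1: "per p x0 (l + p) = per p x0 l" by (simp add: per_def)
      have "per m q (l + p) = per p x0 (l + p)"
      proof (cases "l + p < m * p")
        case True then show ?thesis using * q x0 by auto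
      next
        case False
        then have e: "l + p = m" using lt by blast
        have "per m q m = per m q 0" by (simp add: per_def)
        also have "\<dots> = per p x0 0" using *[of 0] m x0 by simp
        also have "per p x0 0 = per p x0 m"
        proof -
          have "m \<ge> m * p" using False e by linarith
          then have "p = 1" using m x0 by (simp add: mult_le_cancel_left1)
          then show ?thesis by (simp add: per_def)
        qed
        finally show ?thesis using e by simp
      qed
      moreover have "l < m * p" using q x0 m mult_left_mono[of 1 p m] by linarith
      then have "per m q l = per p x0 l" using * q by auto
      ultimately have "per m q (l + p) = per m q l" using per1 by simp
      then show ?thesis using pp[of l] pp[of "l + p"] q x0 N_pos by auto
    qed
    then show "sh p z a = z a" using q(6)[of 0] q(6)[of p] x0 N_pos by (simp add: sh_apply)
  qed
  then have "Comp u \<subseteq> {x \<in> X. sh p x = x}" using Comp_subset by blast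
  then show False using inf finite_periodic[of p] x0 finite_subset by blast
qed

text \<open>At the window at \<open>m + 1\<close> there are two different periodic continuations
  inside the component, and at most one of the resulting points equals \<open>x\<close>.\<close>

lemma infinite_Comp_perfect:
  assumes u: "recurrent u" and inf: "infinite (Comp u)" and x: "x \<in> Comp u"
  shows "\<exists>y\<in>Comp u. y \<noteq> x \<and> agree m x y"
proof -
  interpret C: window_shift A N "S \<inter> {w. mutual u w}" "Comp u" by (rule Comp_window)
  let ?w = "st x (int m + 1)"
  have muw: "mutual u ?w" using x by (simp add: Comp_def)
  then have w: "recurrent ?w" "Comp ?w = Comp u" using recurrent_mutual[OF u] Comp_cong by auto
  have inf': "infinite (Comp ?w)" using inf w(2) by simp
  obtain q q' d where q0: "d > 0" "q \<in> X" "q' \<in> X" "st q 0 = ?w" "st q d = ?w" "st q' 0 = ?w" "st q' d = ?w"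
    "\<exists>k. 0 \<le> k \<and> k < d \<and> q k \<noteq> q' k"
    by (rule infinite_Comp_loops[OF w(1) inf'])
  then obtain k where "0 \<le> k" "k < d" "q k \<noteq> q' k" by blast
  note q = q0(1-7) this
  let ?y = "\<lambda>q. glue (int m + 1) x (sh (- (int m + 1)) (per d q))"
  have y: "?y q \<in> Comp u \<and> agree m x (?y q) \<and> ?y q (k + (int m + 1)) = q k"
    if qq: "q \<in> X" "st q 0 = ?w" "st q d = ?w" for q
  proof -
    have st0: "st (per d q) 0 = ?w" using win_per[of d N q 0] q(1) qq by simp
    have "per d q \<in> Comp ?w"
    proof (rule periodic_Comp[OF per_X q(1) sh_per])
      show "mutual ?w (st (per d q) 0)" unfolding st0 by (rule mutual_refl[OF recurrent_state[OF w(1)]])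
    qed (use q(1) qq in auto)
    then have "sh (- (int m + 1)) (per d q) \<in> Comp u" using w C.sh_X by simp
    then have "?y q \<in> Comp u" using C.glue_X[OF x] st0 by (simp add: win_sh)
    moreover have "agree m x (?y q)" by (auto simp: agree_def glue_def)
    moreover have "?y q (k + (int m + 1)) = q k" using q(8,9) by (simp add: glue_def sh_apply per_def)
    ultimately show ?thesis by blast
  qed
  have "?y q \<noteq> ?y q'" using y[OF q(2,4,5)] y[OF q(3,6,7)] q(10) by metis
  then show ?thesis using y[OF q(2,4,5)] y[OF q(3,6,7)] by metis
qed

end

section \<open>Endomorphisms defined by surgery at an entry time\<close>

text \<open>Bundled into one condition so that it can be carried over from the reversed subshift as
  a whole (\<open>has_split_rv\<close>).\<close>

definition has_split :: "'a set \<Rightarrow> (int \<Rightarrow> 'a) set \<Rightarrow> bool"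
  where "has_split A X \<longleftrightarrow> (\<exists>g h. endomorphism A X g \<and> endomorphism A X h \<and> (\<forall>x\<in>X. h (g x) = x) \<and>
    (\<exists>y\<in>X. homoclinic y (g (h y)) \<and> g (h y) \<noteq> y))"

lemma has_splitI:
  assumes "endomorphism A X g" "endomorphism A X h" "\<And>x. x \<in> X \<Longrightarrow> h (g x) = x"
    "y \<in> X" "homoclinic y (g (h y))" "g (h y) \<noteq> y"
  shows "has_split A X"
  using assms unfolding has_split_def by blast

lemma endomorphism_into:
  assumes "X \<subseteq> topspace (full_shift A)" "endomorphism A X f" "x \<in> X" shows "f x \<in> X"
  using assms unfolding endomorphism_def continuous_map_shift_top[OF assms(1) assms(1)] by blast

lemma has_split_not_surjunctive:
  assumes "X \<subseteq> topspace (full_shift A)" "has_split A X" shows "\<not> surjunctive A X"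
proof
  assume s: "surjunctive A X"
  obtain g h y where gh: "endomorphism A X g" "endomorphism A X h" "\<And>x. x \<in> X \<Longrightarrow> h (g x) = x"
    "y \<in> X" "g (h y) \<noteq> y" using assms(2) unfolding has_split_def by blast
  have "inj_on g X" using gh(3) by (metis inj_onI)
  then have "g ` X = X" using s gh(1) unfolding surjunctive_def by blast
  then obtain x where "x \<in> X" "y = g x" using gh(4) by blast
  then show False using gh(3,5) by simp
qed

lemma has_split_not_moore:
  assumes X: "X \<subseteq> topspace (full_shift A)" and "has_split A X" shows "\<not> moore A X"
proof
  assume s: "moore A X"
  obtain g h y where gh: "endomorphism A X g" "endomorphism A X h" "\<And>x. x \<in> X \<Longrightarrow> h (g x) = x"
    "y \<in> X" "homoclinic y (g (h y))" "g (h y) \<noteq> y" using assms(2) unfolding has_split_def by blast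
  note into = endomorphism_into[OF X]
  have "h ` X = X"
  proof
    show "X \<subseteq> h ` X" using gh(3) into[OF gh(1)] by (metis image_eqI subsetI)
  qed (use into[OF gh(2)] in blast)
  then have "pre_injective X h" using s gh(2) unfolding moore_def by blast
  then have "inj_on h {z \<in> X. homoclinic y z}" using gh(4) unfolding pre_injective_def by blast
  moreover have "h (g (h y)) = h y" using gh(3) into[OF gh(2) gh(4)] by blast
  moreover have "g (h y) \<in> X" using into gh by blast
  moreover have "homoclinic y y" by (simp add: homoclinic_def)
  ultimately show False using gh(4-6) unfolding inj_on_def by blast
qed

text \<open>The \<open>l + D\<close> symbols of \<open>x\<close> from \<open>a\<close> on give way
  to \<open>l\<close> symbols of \<open>p\<close>: pure insertion is \<open>D = - l\<close>, pure
  deletion is \<open>l = 0\<close>.\<close>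

definition surg :: "(int \<Rightarrow> 'a) \<Rightarrow> int \<Rightarrow> int \<Rightarrow> (int \<Rightarrow> 'a) \<Rightarrow> int \<Rightarrow> int \<Rightarrow> 'a"
  where "surg x a l p D = glue a x (glue (a + l) (sh (- a) p) (sh D x))"

lemma surg_sh: "surg (sh n x) a l p D = sh n (surg x (a + n) l p D)"
  by (auto simp: surg_def glue_def sh_def fun_eq_iff algebra_simps)

lemma surg_left: "k < a \<Longrightarrow> surg x a l p D k = x k"
  by (simp add: surg_def glue_def)

lemma surg_mid: "a \<le> k \<Longrightarrow> k < a + l \<Longrightarrow> surg x a l p D k = p (k - a)"
  by (simp add: surg_def glue_def sh_apply)

lemma surg_right: "0 \<le> l \<Longrightarrow> a + l \<le> k \<Longrightarrow> surg x a l p D k = x (k + D)"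
  by (simp add: surg_def glue_def sh_apply)

lemma win_surg_right: "0 \<le> l \<Longrightarrow> a + l \<le> k \<Longrightarrow> win N (surg x a l p D) k = win N x (k + D)"
  by (simp add: win_eq_iff surg_right algebra_simps)

lemma homoclinicI: assumes "\<And>k. k < a \<Longrightarrow> x k = y k" "\<And>k. k \<ge> b \<Longrightarrow> x k = y k" shows "homoclinic x y"
proof -
  have "{i. x i \<noteq> y i} \<subseteq> {a..b}"
  proof
    fix i assume "i \<in> {i. x i \<noteq> y i}"
    then have "\<not> i < a" "\<not> b \<le> i" using assms[of i] by auto
    then show "i \<in> {a..b}" by simp
  qed
  then show ?thesis unfolding homoclinic_def using finite_subset by blast
qed

context window_shift begin

lemma surg_win_left:
  assumes "0 \<le> l" "st p 0 = st x a" "st p l = st x (a + l + D)" "k \<le> a"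
  shows "st (surg x a l p D) k = st x k"
proof -
  have e1: "st (sh (- a) p) (a + l) = st (sh D x) (a + l)" using assms by (simp add: win_sh algebra_simps)
  have "st x a = st (glue (a + l) (sh (- a) p) (sh D x)) a"
    using assms(1,2) win_glue_left[OF e1, of a] by (simp add: win_sh)
  from win_glue_left[OF this assms(4)] show ?thesis by (simp add: surg_def)
qed

lemma surg_X:
  assumes "x \<in> X" "p \<in> X" "0 \<le> l" "st p 0 = st x a" "st p l = st x (a + l + D)"
  shows "surg x a l p D \<in> X"
proof -
  have e1: "st (sh (- a) p) (a + l) = st (sh D x) (a + l)" using assms by (simp add: win_sh algebra_simps)
  have "st x a = st (glue (a + l) (sh (- a) p) (sh D x)) a"
    using assms win_glue_left[OF e1, of a] by (simp add: win_sh)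
  then show ?thesis unfolding surg_def
    using glue_X[OF assms(1) glue_X[OF _ _ e1]] assms sh_X by blast
qed

lemma endomorphismI:
  assumes into: "\<And>x. x \<in> X \<Longrightarrow> f x \<in> X"
    and eq: "\<And>x n. x \<in> X \<Longrightarrow> f (sh n x) = sh n (f x)"
    and loc: "\<And>x. x \<in> X \<Longrightarrow> \<exists>m. \<forall>y\<in>X. agree m x y \<longrightarrow> f y 0 = f x 0"
  shows "endomorphism A X f"
  unfolding endomorphism_def continuous_map_shift_top[OF X_topspace X_topspace]
proof (intro conjI ballI allI)
  show "f (shift x) = shift (f x)" if "x \<in> X" for x using eq that by (simp add: shift_eq_sh)
  fix x i assume x: "x \<in> X"
  then obtain m where m: "\<forall>y\<in>X. agree m (sh i x) y \<longrightarrow> f y 0 = f (sh i x) 0" using loc sh_X by blast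
  have "f y i = f x i" if y: "y \<in> X" "agree (m + nat \<bar>i\<bar>) x y" for y
  proof -
    have "agree m (sh i x) (sh i y)" using y(2) by (auto simp: agree_def sh_apply)
    then have "f (sh i y) 0 = f (sh i x) 0" using m y(1) sh_X by blast
    then show ?thesis using eq x y(1) by (simp add: sh_apply)
  qed
  then show "\<exists>m. \<forall>y\<in>X. agree m x y \<longrightarrow> f y i = f x i" by blast
qed (use into in auto)

lemma endomorphism_sh:
  assumes f: "endomorphism A X f" and x: "x \<in> X"
  shows "f (sh n x) = sh n (f x)"
proof -
  have pos: "f (sh (int k) x) = sh (int k) (f x)" if "x \<in> X" for k x
  proof (induction k)
    case (Suc k)
    have "f (sh 1 (sh (int k) x)) = sh 1 (f (sh (int k) x))"
      using f that sh_X unfolding endomorphism_def shift_eq_sh by blast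
    then show ?case using Suc by simp
  qed simp
  show ?thesis
  proof (cases "n \<ge> 0")
    case True then show ?thesis using pos[OF x, of "nat n"] by simp
  next
    case False
    have "f (sh (- n) (sh n x)) = sh (- n) (f (sh n x))" using pos[of "sh n x" "nat (- n)"] x sh_X False by simp
    then have "f x = sh (- n) (f (sh n x))" by simp
    then show ?thesis by simp
  qed
qed

text \<open>\<open>rmax\<close> speaks of recurrent states only, but every path continues to a
  recurrent state, so no path at all leaves the class.\<close>

lemma rmax_closed:
  assumes b: "recurrent b" "rmax b" and v: "reach b v" shows "mutual b v"
proof -
  obtain x where x: "x \<in> X" "st x 0 = v" using v reach_states stateE by blast
  obtain j where j: "j \<ge> 0" "recurrent (st x j)" using forward_class[OF x(1)] by blast
  have "reach v (st x j)" using reachI[OF x(1) j(1)] x by simp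
  then show ?thesis using b v j reach_trans unfolding rmax_def mutual_def by blast
qed

section \<open>Entry into a maximal class\<close>

definition entry :: "'a list \<Rightarrow> (int \<Rightarrow> 'a) \<Rightarrow> int \<Rightarrow> bool"
  where "entry b x t \<longleftrightarrow> mutual b (st x t) \<and> \<not> mutual b (st x (t - 1))"

lemma entry_sh: "entry b (sh n x) t \<longleftrightarrow> entry b x (t + n)"
  by (simp add: entry_def win_sh algebra_simps)

lemma ex_entry:
  assumes "\<not> mutual b (st x i)" "mutual b (st x j)" "i < j"
  shows "\<exists>t. i < t \<and> t \<le> j \<and> entry b x t"
proof -
  let ?P = "\<lambda>n. mutual b (st x (i + int n))"
  have "?P (nat (j - i))" using assms by simp
  then obtain n where n: "?P n" "\<forall>k<n. \<not> ?P k" "n \<le> nat (j - i)"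
    using exists_least_iff[of ?P] by (metis linorder_not_le)
  have "n \<noteq> 0" using n(1) assms(1) by (metis add.right_neutral of_nat_0)
  then have "n - 1 < n" "int (n - 1) = int n - 1" by auto
  moreover from this have "\<not> ?P (n - 1)" using n(2) by blast
  ultimately have "entry b x (i + int n)" using n(1) by (simp add: entry_def algebra_simps)
  then show ?thesis using n(3) \<open>n \<noteq> 0\<close> assms(3) by (intro exI[of _ "i + int n"]) auto
qed

end

locale max_class = window_shift +
  fixes b
  assumes rec_b: "recurrent b" and rmax_b: "rmax b"
begin

lemma K_stays: "x \<in> X \<Longrightarrow> mutual b (st x i) \<Longrightarrow> i \<le> j \<Longrightarrow> mutual b (st x j)"
  using rmax_closed[OF rec_b rmax_b] reachI reach_trans mutual_def by blast

lemma entry_unique: assumes "x \<in> X" "entry b x t" "entry b x t'" shows "t = t'"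
proof -
  have "\<not> t < t'" if "entry b x t" "entry b x t'" for t t'
    using that K_stays[OF assms(1), of t "t' - 1"] unfolding entry_def by auto
  then show ?thesis using assms by (meson linorder_neqE)
qed

lemma entry_before: "x \<in> X \<Longrightarrow> entry b x t \<Longrightarrow> mutual b (st x k) \<longleftrightarrow> t \<le> k"
  using K_stays[of x t k] K_stays[of x k "t - 1"] unfolding entry_def by force

lemma entry_not_Comp: "entry b x t \<Longrightarrow> x \<notin> Comp b"
  by (auto simp: entry_def Comp_def)

lemma no_entry: assumes "x \<in> X" "x \<notin> Comp b" "\<And>t. \<not> entry b x t" shows "\<not> mutual b (st x i)"
proof
  assume i: "mutual b (st x i)"
  obtain j where "\<not> mutual b (st x j)" using assms unfolding Comp_def by blast
  then show False using ex_entry[of b x j i] i assms K_stays[OF assms(1) i, of j] by force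
qed

text \<open>In the locale \<open>surgery\<close> at most one \<open>a\<close> satisfies
  \<open>P x a\<close> (\<open>P_unique\<close>), so the choice operator picks no arbitrary
  value.\<close>

definition surgery_map :: "((int \<Rightarrow> 'a) \<Rightarrow> int \<Rightarrow> bool) \<Rightarrow> int \<Rightarrow> ((int \<Rightarrow> 'a) \<Rightarrow> int \<Rightarrow> int \<Rightarrow> 'a) \<Rightarrow> int
    \<Rightarrow> (int \<Rightarrow> 'a) \<Rightarrow> int \<Rightarrow> 'a"
  where "surgery_map P l p D x =
    (if \<exists>a. P x a then surg x (SOME a. P x a) l (p x (SOME a. P x a)) D
     else if x \<in> Comp b then sh D x else x)"

end

text \<open>In a point with \<open>P x a\<close> the segment \<open>p x a\<close> of length \<open>l\<close> is put at position \<open>a\<close>, and what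
  lies to the right of it comes from \<open>x\<close> moved by \<open>D\<close>. On the component of \<open>b\<close> itself, where \<open>a\<close> tends
  to minus infinity, continuity forces this to be the shift by \<open>D\<close>.\<close>

locale surgery = max_class +
  fixes P :: "(int \<Rightarrow> 'a) \<Rightarrow> int \<Rightarrow> bool" and l :: int and p :: "(int \<Rightarrow> 'a) \<Rightarrow> int \<Rightarrow> int \<Rightarrow> 'a" and D :: int
    and B m :: nat
  assumes local: "\<And>x y a. x \<in> X \<Longrightarrow> y \<in> X \<Longrightarrow> P x a \<Longrightarrow> (\<And>k. \<bar>k - a\<bar> \<le> int B \<Longrightarrow> x k = y k) \<Longrightarrow>
      P y a \<and> (\<forall>k. 0 \<le> k \<and> k < l \<longrightarrow> p y a k = p x a k)"
    and equi: "\<And>x a n. x \<in> X \<Longrightarrow> P (sh n x) a \<longleftrightarrow> P x (a + n)" "\<And>x a n. x \<in> X \<Longrightarrow> p (sh n x) a = p x (a + n)"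
    and ent: "\<And>x a. x \<in> X \<Longrightarrow> P x a \<Longrightarrow> entry b x (a + int m)"
    and l: "0 \<le> l"
    and join: "\<And>x a. x \<in> X \<Longrightarrow> P x a \<Longrightarrow> p x a \<in> X \<and> st (p x a) 0 = st x a \<and> st (p x a) l = st x (a + l + D)"
    and rest: "(\<forall>x\<in>X. \<forall>t. entry b x t \<longrightarrow> (\<exists>a. P x a)) \<or> (\<forall>x\<in>Comp b. sh D x = x)"
begin

lemma P_unique: "x \<in> X \<Longrightarrow> P x a \<Longrightarrow> P x a' \<Longrightarrow> a = a'"
  using entry_unique ent by fastforce

lemma surgery_map_P: "x \<in> X \<Longrightarrow> P x a \<Longrightarrow> surgery_map P l p D x = surg x a l (p x a) D"
  using P_unique[of x a] someI[of "P x" a] unfolding surgery_map_def by metis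

lemma surgery_map_Comp: assumes "x \<in> Comp b" shows "surgery_map P l p D x = sh D x"
proof -
  have "x \<in> X" using assms Comp_subset by blast
  then have "\<nexists>a. P x a" using ent entry_not_Comp assms by blast
  then show ?thesis using assms by (simp add: surgery_map_def)
qed

lemma surgery_map_else: "x \<notin> Comp b \<Longrightarrow> \<nexists>a. P x a \<Longrightarrow> surgery_map P l p D x = x"
  by (simp add: surgery_map_def)

text \<open>The work is continuity at coordinate 0. Near an entering point, marked by
  \<open>P\<close> or not, the entry and the marker persist. Near a point that avoids the class, any
  marker lies to the right of 0. Near the component every marker lies far to the left, where only
  the shift by \<open>D\<close> is seen.\<close>

lemma surgery_map_endomorphism: "endomorphism A X (surgery_map P l p D)" (is "endomorphism A X ?f")
proof (rule endomorphismI)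
  fix x assume x: "x \<in> X"
  consider (P) a where "P x a" | (C) "x \<in> Comp b" | (E) "x \<notin> Comp b" "\<nexists>a. P x a" by blast
  then show "?f x \<in> X"
  proof cases
    case P then show ?thesis using surgery_map_P[OF x P] surg_X[OF x _ l] join[OF x P] by simp
  next
    case C then show ?thesis using surgery_map_Comp[OF C] x sh_X by simp
  next
    case E then show ?thesis using surgery_map_else x by simp
  qed
next
  interpret C: window_shift A N "S \<inter> {w. mutual b w}" "Comp b" by (rule Comp_window)
  fix x n assume x: "x \<in> X"
  have nx: "sh n x \<in> X" using x sh_X by blast
  consider (P) a where "P x a" | (C) "x \<in> Comp b" | (E) "x \<notin> Comp b" "\<nexists>a. P x a" by blast
  then show "?f (sh n x) = sh n (?f x)"
  proof cases
    case P
    have "P (sh n x) (a - n)" using equi(1)[OF x] P by simp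
    from surgery_map_P[OF nx this] show ?thesis
      using surgery_map_P[OF x P] equi(2)[OF x] by (simp add: surg_sh)
  next
    case C then show ?thesis using surgery_map_Comp C.sh_X by (simp add: add.commute)
  next
    case E
    then have "sh n x \<notin> Comp b" "\<nexists>a. P (sh n x) a" using C.sh_X equi(1)[OF x] by auto
    then show ?thesis using E surgery_map_else by simp
  qed
next
  fix x assume x: "x \<in> X"
  have st_eq: "st y i = st x i" if "agree M x y" "\<bar>i\<bar> + int N \<le> int M" for y M i
    by (rule win_cong, rule agreeD[OF agree_sym[OF that(1)]]) (use that(2) in auto)
  consider (P) a where "P x a" | (C) "x \<in> Comp b"
    | (E) t where "x \<notin> Comp b" "\<nexists>a. P x a" "entry b x t"
    | (O) "x \<notin> Comp b" "\<nexists>a. P x a" "\<And>t. \<not> entry b x t" by blast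
  then show "\<exists>M. \<forall>y\<in>X. agree M x y \<longrightarrow> ?f y 0 = ?f x 0"
  proof cases
    case P
    let ?M = "B + nat \<bar>a\<bar> + nat \<bar>D\<bar>"
    have "?f y 0 = ?f x 0" if y: "y \<in> X" "agree ?M x y" for y
    proof -
      have "x k = y k" if "\<bar>k - a\<bar> \<le> int B" for k by (rule agreeD[OF y(2)]) (use that in auto)
      then have Py: "P y a" "\<forall>k. 0 \<le> k \<and> k < l \<longrightarrow> p y a k = p x a k"
        using local[OF x y(1) P] by blast+
      have "x 0 = y 0" by (rule agreeD[OF y(2)]) auto
      moreover have "x D = y D" by (rule agreeD[OF y(2)]) auto
      ultimately have "surg y a l (p y a) D 0 = surg x a l (p x a) D 0"
        using Py(2) by (auto simp: surg_def glue_def sh_apply)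
      then show ?thesis using surgery_map_P[OF x P] surgery_map_P[OF y(1) Py(1)] by simp
    qed
    then show ?thesis by blast
  next
    case C
    \<comment> \<open>Any entry of \<open>y\<close> is at or before \<open>- ?M'\<close>, so an
      inserted segment ends at or before 0 and coordinate 0 receives the symbol at
      \<open>D\<close>.\<close>
    let ?M' = "m + nat l + nat \<bar>D\<bar>" and ?M = "m + nat l + nat \<bar>D\<bar> + N"
    have "?f y 0 = ?f x 0" if y: "y \<in> X" "agree ?M x y" for y
    proof -
      have yD: "y D = x D" "y 0 = x 0" using y(2) by (auto simp: agree_def)
      have fx: "?f x 0 = x D" using surgery_map_Comp[OF C] by (simp add: sh_apply)
      have "st y (- int ?M') = st x (- int ?M')" by (rule st_eq[OF y(2)]) auto
      then have yK: "mutual b (st y (- int ?M'))" using C by (simp add: Comp_def)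
      have early: "t \<le> - int ?M'" if "entry b y t" for t using entry_before[OF y(1) that] yK by blast
      consider (P) a where "P y a" | (C) "y \<in> Comp b"
        | (E) t where "y \<notin> Comp b" "\<nexists>a. P y a" "entry b y t"
        | (O) "y \<notin> Comp b" "\<nexists>a. P y a" "\<And>t. \<not> entry b y t" by blast
      then show ?thesis
      proof cases
        case P
        have "a + l \<le> 0" using early[OF ent[OF y(1) P]] l by simp
        then show ?thesis unfolding surgery_map_P[OF y(1) P] surg_right[OF l \<open>a + l \<le> 0\<close>] using fx yD by simp
      next
        case C then show ?thesis using surgery_map_Comp fx yD by (simp add: sh_apply)
      next
        case E
        \<comment> \<open>The point \<open>y\<close> enters without a marker and is left unchanged,
          so the first alternative of \<open>rest\<close> fails; by the second one the shift by
          \<open>D\<close> fixes \<open>x\<close>.\<close>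
        then have "sh D x = x" using rest y(1) C by blast
        then have "x D = x 0" by (metis add.left_neutral sh_apply)
        then show ?thesis using surgery_map_else[OF E(1,2)] fx yD by simp
      next
        case O then show ?thesis using no_entry[OF y(1)] yK by blast
      qed
    qed
    then show ?thesis by blast
  next
    case E
    let ?M = "nat \<bar>t\<bar> + m + B + N + 1"
    have "?f y 0 = ?f x 0" if y: "y \<in> X" "agree ?M x y" for y
    proof -
      have "st y t = st x t" "st y (t - 1) = st x (t - 1)" by (rule st_eq[OF y(2)]; force)+
      then have ey: "entry b y t" using E(3) by (simp add: entry_def)
      have "\<not> P y a" for a
      proof
        assume Py: "P y a"
        then have a: "a = t - int m" using entry_unique[OF y(1) ey ent[OF y(1) Py]] by simp
        have "y k = x k" if "\<bar>k - a\<bar> \<le> int B" for k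
          by (rule agreeD[OF agree_sym[OF y(2)]]) (use that a in auto)
        then show False using local[OF y(1) x Py] E(2) by blast
      qed
      moreover have "y 0 = x 0" using y(2) by (auto simp: agree_def)
      ultimately show ?thesis using surgery_map_else E entry_not_Comp[OF ey] by simp
    qed
    then show ?thesis by blast
  next
    case O
    \<comment> \<open>\<open>y\<close> is still outside the class at \<open>m\<close>, so an entry
      at \<open>a + m\<close> comes later; hence \<open>a > 0\<close> and coordinate 0 is
      untouched.\<close>
    let ?M = "m + N"
    have "?f y 0 = ?f x 0" if y: "y \<in> X" "agree ?M x y" for y
    proof -
      have "st y (int m) = st x (int m)" by (rule st_eq[OF y(2)]) auto
      then have nK: "\<not> mutual b (st y (int m))" using no_entry[OF x O(1,3)] by simp
      have y0: "y 0 = x 0" using y(2) by (auto simp: agree_def)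
      have fx: "?f x = x" using surgery_map_else O by simp
      show ?thesis
      proof (cases "\<exists>a. P y a")
        case True
        then obtain a where a: "P y a" by blast
        have "a > 0" using entry_before[OF y(1) ent[OF y(1) a], of "int m"] nK by simp
        then show ?thesis using surgery_map_P[OF y(1) a] y0 fx by (simp add: surg_left)
      next
        case False
        have "y \<notin> Comp b" using nK by (auto simp: Comp_def)
        then show ?thesis using False surgery_map_else y0 fx by simp
      qed
    qed
    then show ?thesis by blast
  qed
qed

end

section \<open>Insertion and deletion of loops\<close>

context window_shift begin

definition len :: "'a list \<Rightarrow> int \<Rightarrow> 'a list \<Rightarrow> bool"
  where "len s n w \<longleftrightarrow> (\<exists>x\<in>X. st x 0 = s \<and> st x n = w)"

lemma len_window: "x \<in> X \<Longrightarrow> len (st x i) (j - i) (st x j)"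
  unfolding len_def by (rule bexI[of _ "sh i x"]) (auto simp: win_sh sh_X)

lemma len_trans: assumes "len s n v" "len v k w" "0 \<le> n" "0 \<le> k" shows "len s (n + k) w"
proof -
  obtain x y where x: "x \<in> X" "st x 0 = s" "st x n = v" and y: "y \<in> X" "st y 0 = v" "st y k = w"
    using assms unfolding len_def by blast
  have e: "st x n = st (sh (- n) y) n" using x y by (simp add: win_sh)
  have "glue n x (sh (- n) y) \<in> X" using glue_X[OF x(1) _ e] y sh_X by blast
  moreover have "st (glue n x (sh (- n) y)) 0 = s" using win_glue_left[OF e assms(3)] x by simp
  moreover have "st (glue n x (sh (- n) y)) (n + k) = w"
    using win_glue_right[of n "n + k" N x] y assms(4) by (simp add: win_sh)
  ultimately show ?thesis unfolding len_def by blast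
qed

lemma len_mult: assumes "len s d s" "d > 0" shows "len s (int n * d) s"
proof (cases "n = 0")
  case True
  then show ?thesis using assms(1) unfolding len_def by auto
next
  case False
  obtain x where x: "x \<in> X" "st x 0 = s" "st x d = s" using assms(1) len_def by blast
  then show ?thesis unfolding len_def
    by (intro bexI[of _ "per d x"]) (auto simp: win_per[OF assms(2)] per_X[OF _ assms(2)])
qed

text \<open>Two of the positions divisible by \<open>d\<close> carry the same state. Cutting out the part between them
  shortens the path by a positive multiple of \<open>d\<close>, and loops of length \<open>d\<close> put at the beginning
  restore this length except for one \<open>d\<close>.\<close>

lemma len_shrink:
  assumes d: "d > 0" "len s d s" and y: "len s (int (card states + 1) * d) w"
  shows "len s (int (card states) * d) w"
proof -
  let ?n = "card states"
  obtain x where x: "x \<in> X" "st x 0 = s" "st x (int (?n + 1) * d) = w" using y len_def by blast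
  have "(\<lambda>i. st x (int i * d)) ` {0..?n} \<subseteq> states" using x st_in_states by blast
  then have "card ((\<lambda>i. st x (int i * d)) ` {0..?n}) \<le> ?n" using card_mono finite_states by blast
  then have "\<not> inj_on (\<lambda>i. st x (int i * d)) {0..?n}" using card_image by fastforce
  then obtain i j where ij: "i < j" "j \<le> ?n" "st x (int i * d) = st x (int j * d)"
    unfolding inj_on_def by (metis atLeastAtMost_iff linorder_neqE_nat)
  have l1: "len s (int (j - i - 1) * d) s" using len_mult[OF d(2,1)] .
  have l2: "len s (int i * d) (st x (int i * d))" using len_window[OF x(1), of 0 "int i * d"] x by simp
  have l3: "len (st x (int i * d)) (int (?n + 1) * d - int j * d) w"
    using len_window[OF x(1), of "int j * d" "int (?n + 1) * d"] x ij by simp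
  have "int j * d \<le> int (?n + 1) * d" using ij d by (intro mult_right_mono) auto
  then have "len s (int (j - i - 1) * d + int i * d + (int (?n + 1) * d - int j * d)) w"
    using len_trans[OF len_trans[OF l1 l2] l3] d by simp
  moreover have "int (j - i - 1) = int j - int i - 1" using ij by simp
  ultimately show ?thesis by (simp add: algebra_simps)
qed

end

context max_class begin

text \<open>The classes of \<open>v\<close>, \<open>u\<close>, \<open>b\<close> increase strictly.
  \<open>g\<close> inserts a loop \<open>c\<close> at \<open>u\<close> in front of a word
  \<open>\<beta>\<close> that leads from \<open>u\<close> into the class of \<open>b\<close>, and
  \<open>h\<close> deletes a \<open>c\<close> standing in front of \<open>\<beta>\<close>. A point
  that comes from \<open>v\<close> to \<open>u\<close> by a shortest path and continues with
  \<open>\<beta>\<close> has no \<open>c\<close> there, so it is not in the image of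
  \<open>g\<close>.\<close>

lemma finite_max_split:
  assumes fin: "finite (Comp b)" and u: "recurrent u" and ub: "reach u b" and nbu: "\<not> reach b u"
    and v: "reach v u" and nuv: "\<not> reach u v"
  shows "has_split A X"
proof -
  obtain e where e: "e > 0" "\<And>x. x \<in> Comp b \<Longrightarrow> sh e x = x" using finite_Comp_period[OF fin] by blast
  obtain c0 f where c0: "c0 \<in> X" "f > 0" "st c0 0 = u" "st c0 f = u" using u recurrent_def by blast
  \<comment> \<open>A multiple of the period \<open>e\<close>, so that the shift by \<open>d\<close>
    is trivial on \<open>Comp b\<close>, and of the loop length \<open>f\<close> at
    \<open>u\<close>.\<close>
  define d where "d = e * f"
  have d: "d > 0" using e c0 by (simp add: d_def)
  define c where "c = per f c0"
  have c: "c \<in> X" "st c 0 = u" "st c d = u"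
    using per_X[OF c0(1,2)] win_per[of f N c0] c0 unfolding c_def d_def by auto
  have shd: "sh d x = x" "sh (- d) x = x" if "x \<in> Comp b" for x
  proof -
    have "sh (int (nat f) * e) x = x" by (rule sh_mult[OF e(2)[OF that]])
    then show "sh d x = x" using c0(2) by (simp add: d_def mult.commute)
    then have "sh (- d) (sh d x) = sh (- d) x" by simp
    then show "sh (- d) x = x" by simp
  qed
  have per: "x (k - d) = x k" if x: "x \<in> X" "entry b x t" "t \<le> k - d" for x t k
  proof -
    have "mutual b (st x t)" "mutual b (st x k)" using entry_before[OF x(1,2)] x(3) d by auto
    then obtain z where z: "z \<in> Comp b" "\<forall>i. t \<le> i \<and> i < k + int N \<longrightarrow> z i = x i"
      using periodic_approx[OF rec_b x(1), of t k] x(3) d by auto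
    have "z (k - d) = z k" using shd(2)[OF z(1)] by (metis sh_apply uminus_add_conv_diff add.commute)
    then show ?thesis using z(2) x(3) d N_pos by simp
  qed
  obtain \<beta> n where \<beta>0: "\<beta> \<in> X" "0 \<le> n" "st \<beta> 0 = u" "st \<beta> n = b" using ub by (rule reachE)
  have nb0: "\<not> mutual b (st \<beta> 0)" using \<beta>0 nbu by (simp add: mutual_def)
  moreover have bb: "mutual b (st \<beta> n)" using \<beta>0 mutual_refl recurrent_state[OF rec_b] by simp
  moreover have "n \<noteq> 0" using nb0 bb by auto
  ultimately obtain m0 where m0: "m0 > 0" "entry b \<beta> m0" using ex_entry[of b \<beta> 0 n] \<beta>0(2) by auto
  define m where "m = nat m0"
  have \<beta>: "\<beta> \<in> X" "st \<beta> 0 = u" "entry b \<beta> (int m)" using \<beta>0 m0 by (auto simp: m_def)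
  \<comment> \<open>\<open>m + N\<close> symbols fix the windows at \<open>a, ..., a + m\<close>,
    hence both the state \<open>u\<close> at \<open>a\<close> and the entry at
    \<open>a + m\<close>.\<close>
  define Occ where "Occ = (\<lambda>x a. \<forall>k. 0 \<le> k \<and> k < int m + int N \<longrightarrow> x (a + k) = \<beta> k)"
  have Occ_st: "st x (a + k) = st \<beta> k" if "Occ x a" "0 \<le> k" "k \<le> int m" for x a k
    using that unfolding Occ_def win_eq_iff by (auto simp: add.assoc)
  have Occ_entry: "entry b x (a + int m)" if "Occ x a" for x a
  proof -
    have "m > 0" using m0 by (simp add: m_def)
    then have "st x (a + int m - 1) = st \<beta> (int m - 1)" using Occ_st[OF that, of "int m - 1"] by (simp add: algebra_simps)
    then show ?thesis using Occ_st[OF that, of "int m"] \<beta>(3) by (simp add: entry_def)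
  qed
  have Occ_u: "st x a = u" if "Occ x a" for x a using Occ_st[OF that, of 0] \<beta> by simp
  interpret g: surgery A N S X b Occ d "\<lambda>x a. c" "- d" "m + N" m
  proof
    show "Occ y a \<and> (\<forall>k. 0 \<le> k \<and> k < d \<longrightarrow> c k = c k)"
      if "x \<in> X" "y \<in> X" "Occ x a" "\<And>k. \<bar>k - a\<bar> \<le> int (m + N) \<Longrightarrow> x k = y k" for x y a
      using that(3,4) unfolding Occ_def by auto
    show "Occ (sh n x) a \<longleftrightarrow> Occ x (a + n)" for x a n by (simp add: Occ_def sh_apply algebra_simps)
    show "entry b x (a + int m)" if "x \<in> X" "Occ x a" for x a using Occ_entry that by blast
    show "c \<in> X \<and> st c 0 = st x a \<and> st c d = st x (a + d + - d)" if "x \<in> X" "Occ x a" for x a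
      using c Occ_u[OF that(2)] by simp
  qed (use d shd in auto)
  define P' where "P' = (\<lambda>x a. (\<forall>k. 0 \<le> k \<and> k < d \<longrightarrow> x (a + k) = c k) \<and> Occ x (a + d))"
  have P'_u: "st x a = u" if "P' x a" for x a
  proof -
    have "x (a + k) = c k" if k: "0 \<le> k" "k < d + int N" for k
    proof (cases "k < d")
      case True then show ?thesis using \<open>P' x a\<close> k unfolding P'_def by blast
    next
      case False
      have "\<forall>j. 0 \<le> j \<and> j < int m + int N \<longrightarrow> x (a + d + j) = \<beta> j"
        using \<open>P' x a\<close> unfolding P'_def Occ_def by blast
      then have "x (a + d + (k - d)) = \<beta> (k - d)" by (rule allE[of _ "k - d"]) (use k False in auto)
      then have "x (a + d + (k - d)) = \<beta> (0 + (k - d))" by simp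
      also have "\<beta> (0 + (k - d)) = c (d + (k - d))"
        using c(3) \<beta>(2) k False win_eq_iff[of N \<beta> 0 c d] by auto
      finally show ?thesis by simp
    qed
    then have "st x a = st c 0" unfolding win_eq_iff using d by auto
    then show ?thesis using c by simp
  qed
  interpret h: surgery A N S X b P' 0 "\<lambda>x a. c" d "m + N + nat d" "m + nat d"
  proof
    show "P' y a \<and> (\<forall>k. 0 \<le> k \<and> k < 0 \<longrightarrow> c k = c k)"
      if "x \<in> X" "y \<in> X" "P' x a" "\<And>k. \<bar>k - a\<bar> \<le> int (m + N + nat d) \<Longrightarrow> x k = y k" for x y a
    proof -
      have "y (a + k) = c k" if "0 \<le> k" "k < d" for k
        using \<open>P' x a\<close> that(1,2) \<open>\<And>k. \<bar>k - a\<bar> \<le> int (m + N + nat d) \<Longrightarrow> x k = y k\<close>[of "a + k"]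
        unfolding P'_def by auto
      moreover have "y (a + d + k) = \<beta> k" if "0 \<le> k" "k < int m + int N" for k
        using \<open>P' x a\<close> that(1,2) \<open>\<And>k. \<bar>k - a\<bar> \<le> int (m + N + nat d) \<Longrightarrow> x k = y k\<close>[of "a + d + k"] d
        unfolding P'_def Occ_def by auto
      ultimately show ?thesis unfolding P'_def Occ_def by blast
    qed
    show "P' (sh n x) a \<longleftrightarrow> P' x (a + n)" for x a n by (simp add: P'_def Occ_def sh_apply algebra_simps)
    show "entry b x (a + int (m + nat d))" if "x \<in> X" "P' x a" for x a
      using Occ_entry[of x "a + d"] that d unfolding P'_def by (simp add: algebra_simps)
    show "c \<in> X \<and> st c 0 = st x a \<and> st c 0 = st x (a + 0 + d)" if "x \<in> X" "P' x a" for x a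
      using c P'_u[OF that(2)] Occ_u[of x "a + d"] that(2) unfolding P'_def by simp
  qed (use d shd in auto)
  let ?g = "surgery_map Occ d (\<lambda>x a. c) (- d)" and ?h = "surgery_map P' 0 (\<lambda>x a. c) d"
  have hg: "?h (?g x) = x" if x: "x \<in> X" for x
  proof -
    consider (P) a where "Occ x a" | (C) "x \<in> Comp b" | (E) "x \<notin> Comp b" "\<nexists>a. Occ x a" by blast
    then show ?thesis
    proof cases
      case P
      let ?z = "surg x a d c (- d)"
      have gx: "?g x = ?z" using g.surgery_map_P[OF x P] by simp
      then have zX: "?z \<in> X" using endomorphism_into[OF X_topspace g.surgery_map_endomorphism x] by simp
      have "P' ?z a" unfolding P'_def Occ_def
      proof (intro conjI allI impI)
        show "?z (a + k) = c k" if "0 \<le> k \<and> k < d" for k using that by (simp add: surg_mid)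
        show "?z (a + d + k) = \<beta> k" if "0 \<le> k \<and> k < int m + int N" for k
          using that P d unfolding Occ_def by (simp add: surg_right)
      qed
      then have "?h ?z = surg ?z a 0 c d" using h.surgery_map_P[OF zX] by simp
      also have "\<dots> = x" using d by (auto simp: fun_eq_iff surg_def glue_def sh_apply)
      finally show ?thesis using gx by simp
    next
      case C
      then show ?thesis using g.surgery_map_Comp[OF C] h.surgery_map_Comp[OF C] shd by simp
    next
      case E
      then have "\<nexists>a. P' x a" unfolding P'_def by blast
      then show ?thesis using g.surgery_map_else[OF E] h.surgery_map_else[OF E(1)] by simp
    qed
  qed
  let ?L = "\<lambda>n. \<exists>x\<in>X. st x 0 = v \<and> st x (int n) = u"
  have "\<exists>n. ?L n" using v unfolding reach_def by blast
  \<comment> \<open>A copy of \<open>c\<close> directly before \<open>\<beta>\<close> would show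
    \<open>u\<close> already \<open>d\<close> places earlier, which gives either a shorter path from
    \<open>v\<close> or a path from \<open>u\<close> back to \<open>v\<close>.\<close>
  then obtain n where n: "?L n" "\<And>k. k < n \<Longrightarrow> \<not> ?L k" using exists_least_iff[of ?L] by blast
  then obtain x where x: "x \<in> X" "st x 0 = v" "st x (int n) = u" by blast
  let ?y = "glue (int n) x (sh (- int n) \<beta>)"
  have e: "st x (int n) = st (sh (- int n) \<beta>) (int n)" using x \<beta> by (simp add: win_sh)
  have y: "?y \<in> X" using glue_X[OF x(1) _ e] \<beta> sh_X by blast
  have Oy: "Occ ?y (int n)" unfolding Occ_def by (simp add: glue_def sh_apply)
  have nP: "\<not> P' ?y a" for a
  proof
    assume P: "P' ?y a"
    then have "a + d = int n" using g.P_unique[OF y Oy, of "a + d"] unfolding P'_def by simp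
    then have "st ?y (int n - d) = u" using P'_u[OF P] by (metis add_diff_cancel_right')
    then have su: "st x (int n - d) = u" using win_glue_left[OF e, of "int n - d"] d by simp
    show False
    proof (cases "int n \<ge> d")
      case True
      then have "?L (nat (int n - d))" using x su by auto
      moreover have "nat (int n - d) < n" using d True by linarith
      ultimately show False using n(2) by blast
    next
      case False
      then have "reach (st x (int n - d)) (st x 0)" using reachI[OF x(1)] by simp
      then show False using su x nuv by simp
    qed
  qed
  have hy: "?h ?y = ?y"
    using h.surgery_map_else nP entry_not_Comp[OF Occ_entry[OF Oy]] by blast
  have gy: "?g ?y = surg ?y (int n) d c (- d)" by (rule g.surgery_map_P[OF y Oy])
  have gyX: "?g ?y \<in> X" using endomorphism_into[OF X_topspace g.surgery_map_endomorphism y] .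
  have "?g ?y \<noteq> ?y"
  proof
    assume eq: "?g ?y = ?y"
    have "Occ (surg ?y (int n) d c (- d)) (int n + d)"
      using d Oy unfolding Occ_def by (simp add: surg_right)
    then have "Occ (?g ?y) (int n + d)" unfolding gy .
    then have "Occ ?y (int n + d)" using eq by simp
    then show False using g.P_unique[OF y Oy] d by fastforce
  qed
  \<comment> \<open>From the entry at \<open>n + m\<close> on the point has period \<open>d\<close>,
    so the displacement by \<open>d\<close> is invisible from \<open>n + m + d\<close> on.\<close>
  moreover have "homoclinic ?y (?g ?y)"
  proof (rule homoclinicI[of "int n" _ _ "int n + int m + d"])
    show "?y k = ?g ?y k" if "k < int n" for k using that unfolding gy by (simp only: surg_left)
    show "?y k = ?g ?y k" if k: "k \<ge> int n + int m + d" for k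
    proof -
      have "?g ?y k = ?y (k + - d)" unfolding gy by (rule surg_right) (use k d in auto)
      also have "\<dots> = ?y k" using per[OF y Occ_entry[OF Oy], of k] k by simp
      finally show ?thesis by simp
    qed
  qed
  ultimately have "homoclinic ?y (?g (?h ?y))" "?g (?h ?y) \<noteq> ?y" unfolding hy by blast+
  then show ?thesis
    by (intro has_splitI[OF g.surgery_map_endomorphism h.surgery_map_endomorphism hg y])
qed

lemma common_loop_length:
  "\<exists>d>0. \<forall>s. mutual b s \<longrightarrow> len s d s"
proof -
  let ?K = "{s. mutual b s}"
  have fin: "finite ?K" by (rule finite_subset[OF _ finite_states]) (auto simp: mutual_def dest: reach_states)
  have "\<exists>e>0. len s e s" if "s \<in> ?K" for s
    using recurrent_mutual[OF rec_b] that unfolding recurrent_def len_def by blast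
  then obtain e where e: "\<And>s. s \<in> ?K \<Longrightarrow> e s > 0 \<and> len s (e s) s" by metis
  have "len s (\<Prod>s\<in>?K. e s) s" if s: "s \<in> ?K" for s
  proof -
    have "(\<Prod>s\<in>?K. e s) = int (nat (\<Prod>s\<in>?K - {s}. e s)) * e s"
    proof -
      have "(\<Prod>s\<in>?K - {s}. e s) \<ge> 0" using e by (intro prod_nonneg) (auto simp: less_imp_le)
      then show ?thesis using prod.remove[OF fin s, of e] by (simp add: mult.commute)
    qed
    then show ?thesis using len_mult[of s "e s"] e[OF s] by metis
  qed
  moreover have "(\<Prod>s\<in>?K. e s) > 0" using e by (intro prod_pos) blast
  ultimately show ?thesis by blast
qed

text \<open>\<open>g\<close> inserts a loop \<open>P s\<close> of length \<open>d\<close> at the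
  entry, where \<open>s\<close> is the state entered. \<open>h\<close> has to shorten every entering
  point by \<open>d\<close>: it deletes \<open>P s\<close> if it is there, and otherwise replaces a
  path of length \<open>T + d\<close> by one of length \<open>T\<close>. A point with another loop
  of length \<open>d\<close> in this place is not in the image of \<open>g\<close>.\<close>

lemma infinite_max_split:
  assumes inf: "infinite (Comp b)" and v: "reach v b" "\<not> reach b v"
  shows "has_split A X"
proof -
  obtain x1 n1 where x1: "x1 \<in> X" "0 \<le> n1" "st x1 0 = v" "st x1 n1 = b" using v(1) by (rule reachE)
  have "\<not> mutual b (st x1 0)" using x1 v by (simp add: mutual_def)
  moreover have "mutual b (st x1 n1)" using x1 mutual_refl recurrent_state[OF rec_b] by simp
  moreover from calculation have "n1 \<noteq> 0" by auto
  ultimately obtain t0 where t0: "entry b x1 t0" using ex_entry[of b x1 0 n1] x1(2) by auto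
  define x0 where "x0 = sh t0 x1"
  define s0 where "s0 = st x0 0"
  have x0: "x0 \<in> X" "entry b x0 0" "st x0 0 = s0"
    using x1 t0 sh_X by (auto simp: x0_def s0_def entry_sh)
  have s0: "mutual b s0" using x0 by (simp add: entry_def)
  have "infinite (Comp s0)" using inf Comp_cong[OF s0] by simp
  then obtain q1 q2 l where q: "l > 0" "q1 \<in> X" "q2 \<in> X" "st q1 0 = s0" "st q1 l = s0" "st q2 0 = s0" "st q2 l = s0"
    "\<exists>k. 0 \<le> k \<and> k < l \<and> q1 k \<noteq> q2 k"
    by (rule infinite_Comp_loops[OF recurrent_mutual[OF rec_b s0]])
  obtain d0 where d0: "d0 > 0" "\<And>s. mutual b s \<Longrightarrow> len s d0 s" using common_loop_length by blast
  \<comment> \<open>All states of the class have loops of length \<open>d0\<close>, hence of length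
    \<open>d\<close>; as a multiple of \<open>l\<close>, \<open>d\<close> is also the length of
    repetitions of the two different loops at \<open>s0\<close>.\<close>
  define d where "d = l * d0"
  have d: "d > 0" using q d0 by (simp add: d_def)
  have "len s d s" if "mutual b s" for s
    using len_mult[OF d0(2)[OF that] d0(1), of "nat l"] q by (simp add: d_def)
  then obtain P where P: "\<And>s. mutual b s \<Longrightarrow> P s \<in> X \<and> st (P s) 0 = s \<and> st (P s) d = s"
    unfolding len_def by metis
  \<comment> \<open>The length for which \<open>len_shrink\<close> turns paths of length
    \<open>T + d\<close> into paths of length \<open>T\<close>.\<close>
  define T where "T = int (card states) * d"
  have T: "T \<ge> 0" using d by (simp add: T_def)
  have Td: "int (card states + 1) * d = T + d" by (simp add: T_def algebra_simps)
  have "\<exists>Q\<in>X. st Q 0 = st x t \<and> st Q T = st x (t + T + d)" if x: "x \<in> X" "mutual b (st x t)" for x t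
  proof -
    have "len (st x t) (int (card states + 1) * d) (st x (t + T + d))"
      using len_window[OF x(1), of t "t + T + d"] unfolding Td by simp
    moreover have "len (st x t) d (st x t)" using P[OF x(2)] unfolding len_def by blast
    ultimately show ?thesis using len_shrink[OF d] unfolding T_def len_def by blast
  qed
  \<comment> \<open>The replacement path is chosen as a function of the two end windows alone, so
    that the resulting map is local and commutes with the shift.\<close>
  then have "\<forall>s w. \<exists>Q. (\<exists>x t. x \<in> X \<and> mutual b (st x t) \<and> s = st x t \<and> w = st x (t + T + d)) \<longrightarrow>
      Q \<in> X \<and> st Q 0 = s \<and> st Q T = w" by blast
  then obtain Q where Q0: "\<And>s w. (\<exists>x t. x \<in> X \<and> mutual b (st x t) \<and> s = st x t \<and> w = st x (t + T + d)) \<Longrightarrow>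
      Q s w \<in> X \<and> st (Q s w) 0 = s \<and> st (Q s w) T = w" by metis
  have Q: "Q (st x t) (st x (t + T + d)) \<in> X \<and> st (Q (st x t) (st x (t + T + d))) 0 = st x t \<and>
      st (Q (st x t) (st x (t + T + d))) T = st x (t + T + d)" if "x \<in> X" "mutual b (st x t)" for x t
    using Q0 that by blast
  define del where "del = (\<lambda>x t. st x (t + d) = st x t \<and> (\<forall>k. 0 \<le> k \<and> k < d \<longrightarrow> x (t + k) = P (st x t) k))"
  \<comment> \<open>If the loop is present, \<open>p\<close> is the part of \<open>x\<close> behind
    it, and replacing \<open>T + d\<close> symbols by \<open>T\<close> amounts to deleting the
    loop.\<close>
  define p where "p = (\<lambda>x t. if del x t then sh (t + d) x else Q (st x t) (st x (t + T + d)))"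
  have entry_win: "entry b y a" if "entry b x a" "\<And>k. \<bar>k - a\<bar> \<le> int (N + 1) \<Longrightarrow> x k = y k" for x y a
  proof -
    have "st x a = st y a" "st x (a - 1) = st y (a - 1)"
      by (rule win_cong, rule that(2), force)+
    then show ?thesis using that(1) by (simp add: entry_def)
  qed
  interpret g: surgery A N S X b "entry b" d "\<lambda>x t. P (st x t)" "- d" "N + 1" 0
  proof
    show "entry b y a \<and> (\<forall>k. 0 \<le> k \<and> k < d \<longrightarrow> P (st y a) k = P (st x a) k)"
      if "x \<in> X" "y \<in> X" "entry b x a" "\<And>k. \<bar>k - a\<bar> \<le> int (N + 1) \<Longrightarrow> x k = y k" for x y a
    proof -
      have "st y a = st x a" by (rule win_cong, rule that(4)[symmetric]) auto
      then show ?thesis using entry_win[OF that(3,4)] by simp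
    qed
    show "P (st x a) \<in> X \<and> st (P (st x a)) 0 = st x a \<and> st (P (st x a)) d = st x (a + d + - d)"
      if "x \<in> X" "entry b x a" for x a using P that by (simp add: entry_def)
  qed (use d in \<open>auto simp: entry_sh win_sh\<close>)
  interpret h: surgery A N S X b "entry b" T p d "N + 1 + nat T + nat d" 0
  proof
    show "entry b y a \<and> (\<forall>k. 0 \<le> k \<and> k < T \<longrightarrow> p y a k = p x a k)"
      if xy: "x \<in> X" "y \<in> X" "entry b x a" "\<And>k. \<bar>k - a\<bar> \<le> int (N + 1 + nat T + nat d) \<Longrightarrow> x k = y k" for x y a
    proof -
      have st: "st y (a + i) = st x (a + i)" if "0 \<le> i" "i \<le> T + d" for i
        by (rule win_cong, rule xy(4)[symmetric]) (use that T d in auto)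
      have "y (a + k) = x (a + k)" if "0 \<le> k" "k < d" for k
        by (rule xy(4)[symmetric]) (use that T d in auto)
      then have "del y a \<longleftrightarrow> del x a" using st[of 0] st[of d] T d unfolding del_def by auto
      moreover have "sh (a + d) y k = sh (a + d) x k" if "0 \<le> k" "k < T" for k
        unfolding sh_apply by (rule xy(4)[symmetric]) (use that T d in auto)
      moreover have "st y a = st x a" "st y (a + T + d) = st x (a + T + d)"
        using st[of 0] st[of "T + d"] T d by (auto simp: add.assoc)
      ultimately have "p y a k = p x a k" if "0 \<le> k" "k < T" for k
        using that unfolding p_def by (cases "del x a") simp_all
      then show ?thesis using entry_win[OF xy(3)] xy(4) by force
    qed
    show "p (sh n x) a = p x (a + n)" for x a n
    proof -
      have "del (sh n x) a \<longleftrightarrow> del x (a + n)"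
        unfolding del_def win_sh sh_apply by (simp add: algebra_simps)
      then show ?thesis unfolding p_def by (simp add: win_sh algebra_simps)
    qed
    show "p x a \<in> X \<and> st (p x a) 0 = st x a \<and> st (p x a) T = st x (a + T + d)"
      if "x \<in> X" "entry b x a" for x a
    proof (cases "del x a")
      case True
      then show ?thesis using that sh_X unfolding p_def del_def by (auto simp: win_sh algebra_simps)
    next
      case False
      then show ?thesis using Q[OF that(1), of a] that unfolding p_def entry_def by auto
    qed
  qed (use T in \<open>auto simp: entry_sh\<close>)
  let ?g = "surgery_map (entry b) d (\<lambda>x t. P (st x t)) (- d)" and ?h = "surgery_map (entry b) T p d"
  have surg_entry: "entry b (surg x t l r D) t \<and> st (surg x t l r D) t = st x t"
    if "entry b x t" "0 \<le> l" "st r 0 = st x t" "st r l = st x (t + l + D)" for x t l r D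
    using surg_win_left[OF that(2-4), of t] surg_win_left[OF that(2-4), of "t - 1"] that(1)
    by (simp add: entry_def)
  have g_loop: "entry b (?g x) t" "st (?g x) t = st x t" "st (?g x) (t + d) = st x t"
    "\<And>k. 0 \<le> k \<Longrightarrow> k < d \<Longrightarrow> ?g x (t + k) = P (st x t) k" if x: "x \<in> X" "entry b x t" for x t
  proof -
    have gx: "?g x = surg x t d (P (st x t)) (- d)" using g.surgery_map_P[OF x] .
    have Px: "st (P (st x t)) 0 = st x t" "st (P (st x t)) d = st x (t + d + - d)"
      using P x by (auto simp: entry_def)
    show "entry b (?g x) t" "st (?g x) t = st x t" using surg_entry[OF x(2) _ Px] d gx by auto
    show "st (?g x) (t + d) = st x t" unfolding gx using d by (simp add: win_surg_right)
    show "?g x (t + k) = P (st x t) k" if "0 \<le> k" "k < d" for k using that gx by (simp add: surg_mid)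
  qed
  have gX: "?g x \<in> X" if "x \<in> X" for x using endomorphism_into[OF X_topspace g.surgery_map_endomorphism that] .
  have hX: "?h x \<in> X" if "x \<in> X" for x using endomorphism_into[OF X_topspace h.surgery_map_endomorphism that] .
  have hg: "?h (?g x) = x" if x: "x \<in> X" for x
  proof -
    consider (P) t where "entry b x t" | (C) "x \<in> Comp b" | (E) "x \<notin> Comp b" "\<nexists>a. entry b x a" by blast
    then show ?thesis
    proof cases
      case P
      note gl = g_loop[OF x P]
      have "del (?g x) t" using gl by (simp add: del_def)
      then have "?h (?g x) = surg (?g x) t T (sh (t + d) (?g x)) d"
        using h.surgery_map_P[OF gX[OF x] gl(1)] unfolding p_def by simp
      moreover have "surg (?g x) t T (sh (t + d) (?g x)) d k = x k" for k
        unfolding g.surgery_map_P[OF x P] using d T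
        by (simp add: surg_def glue_def sh_apply)
      ultimately show ?thesis by auto
    next
      case C
      then have "sh (- d) x \<in> Comp b" using window_shift.sh_X[OF Comp_window] by blast
      then show ?thesis using g.surgery_map_Comp[OF C] h.surgery_map_Comp by simp
    next
      case E
      then show ?thesis using g.surgery_map_else[OF E] h.surgery_map_else[OF E] by simp
    qed
  qed
  have per_q: "per l r \<in> X" "st (per l r) 0 = s0" "st (per l r) d = s0" "\<And>k. 0 \<le> k \<Longrightarrow> k < l \<Longrightarrow> per l r k = r k"
    if "r \<in> X" "st r 0 = s0" "st r l = s0" for r
    using that q(1) per_X[OF that(1) q(1)] win_per[OF q(1), of N r]
    by (auto simp: d_def per_def)
  have ld: "l \<le> d" using q(1) d0(1) mult_left_mono[of 1 d0 l] by (simp add: d_def)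
  \<comment> \<open>The two loops at \<open>s0\<close> differ from each other within the first
    \<open>l\<close> places, so one of them differs from \<open>P s0\<close>.\<close>
  obtain r where r: "r \<in> X" "st r 0 = s0" "st r d = s0" "\<exists>k. 0 \<le> k \<and> k < d \<and> r k \<noteq> P s0 k"
  proof -
    obtain k where k: "0 \<le> k" "k < l" "per l q1 k \<noteq> per l q2 k"
      using q(8) per_q(4)[OF q(2,4,5)] per_q(4)[OF q(3,6,7)] by metis
    then show ?thesis using that[OF per_q(1-3)[OF q(2,4,5)]] that[OF per_q(1-3)[OF q(3,6,7)]] ld
      by (metis order_less_le_trans)
  qed
  let ?y = "surg x0 0 d r (- d)"
  have rx: "st r 0 = st x0 0" "st r d = st x0 (0 + d + - d)" using r x0 by auto
  have y: "?y \<in> X" using surg_X[OF x0(1) r(1) _ rx] d by simp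
  have ye: "entry b ?y 0" "st ?y 0 = s0" using surg_entry[OF x0(2) _ rx] d x0 by auto
  have yk: "?y k = r k" if "0 \<le> k" "k < d" for k using that by (simp add: surg_mid)
  have hy: "?h ?y = surg ?y 0 T (p ?y 0) d" by (rule h.surgery_map_P[OF y ye(1)])
  have hye: "entry b (?h ?y) 0" "st (?h ?y) 0 = s0"
    using surg_entry[OF ye(1) T] h.join[OF y ye(1)] hy ye(2) by auto
  have ghy: "?g (?h ?y) = surg (?h ?y) 0 d (P s0) (- d)"
    using g.surgery_map_P[OF hX[OF y] hye(1)] hye(2) by simp
  obtain k where k: "0 \<le> k" "k < d" "r k \<noteq> P s0 k" using r(4) by blast
  have "?g (?h ?y) k = P s0 k" using k(1,2) unfolding ghy by (simp add: surg_mid)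
  then have "?g (?h ?y) \<noteq> ?y" using yk[OF k(1,2)] k(3) by metis
  \<comment> \<open>Both maps act from the entry at 0 on, and beyond \<open>T + d\<close> their
    displacements by \<open>d\<close> and \<open>- d\<close> cancel.\<close>
  moreover have "homoclinic ?y (?g (?h ?y))"
  proof (rule homoclinicI[of 0 _ _ "T + d"])
    show "?y k = ?g (?h ?y) k" if "k < 0" for k
    proof -
      have "?g (?h ?y) k = ?h ?y k" unfolding ghy using that by (rule surg_left)
      also have "\<dots> = ?y k" unfolding hy using that by (rule surg_left)
      finally show ?thesis by simp
    qed
    show "?y k = ?g (?h ?y) k" if "k \<ge> T + d" for k
    proof -
      have "?g (?h ?y) k = ?h ?y (k + - d)" unfolding ghy by (rule surg_right) (use that d T in auto)
      also have "\<dots> = ?y (k + - d + d)" unfolding hy by (rule surg_right) (use that d T in auto)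
      finally show ?thesis by simp
    qed
  qed
  ultimately show ?thesis
    by (intro has_splitI[OF g.surgery_map_endomorphism h.surgery_map_endomorphism hg y])
qed

end

section \<open>Reversal of time\<close>

definition rv :: "(int \<Rightarrow> 'a) \<Rightarrow> int \<Rightarrow> 'a" where "rv x = (\<lambda>i. x (- i))"

lemma rv_rv [simp]: "rv (rv x) = x"
  by (simp add: rv_def)

lemma rv_image_rv [simp]: "rv ` rv ` X = X"
  by (simp add: image_image)

lemma inj_rv: "inj_on rv X"
  by (metis inj_onI rv_rv)

lemma sh_rv: "sh n (rv x) = rv (sh (- n) x)"
  by (simp add: sh_def rv_def fun_eq_iff)

text \<open>The window of \<open>rv x\<close> at \<open>i\<close> reads \<open>x\<close> from
  position \<open>- i\<close> down to \<open>- i - N + 1\<close>.\<close>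

lemma win_rv: "win N (rv x) i = rev (win N x (- i - int N + 1))"
proof (rule nth_equalityI)
  fix k assume k: "k < length (win N (rv x) i)"
  then have "- i - int N + 1 + int (N - Suc k) = - (i + int k)" by simp
  then show "win N (rv x) i ! k = rev (win N x (- i - int N + 1)) ! k"
    using k by (simp add: win_def rev_nth rv_def)
qed simp

lemma agree_rv: "agree m (rv x) (rv y) \<longleftrightarrow> agree m x y"
proof -
  have "agree m x y \<Longrightarrow> agree m (rv x) (rv y)" for x y :: "int \<Rightarrow> 'a" by (simp add: agree_def rv_def)
  from this[of x y] this[of "rv x" "rv y"] show ?thesis by auto
qed

lemma homoclinic_rv: assumes "homoclinic x y" shows "homoclinic (rv x) (rv y)"
proof -
  have "{i. rv x i \<noteq> rv y i} = uminus ` {i. x i \<noteq> y i}"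
    by (auto simp: rv_def image_iff) (metis minus_minus)
  then show ?thesis using assms by (simp add: homoclinic_def)
qed

context window_shift begin

lemma window_shift_rv: "window_shift A N (rev ` S) (rv ` X)"
proof
  show "rv ` X = {y. \<forall>i. win N y i \<in> rev ` S}"
  proof (intro set_eqI iffI)
    fix y assume "y \<in> rv ` X"
    then show "y \<in> {y. \<forall>i. win N y i \<in> rev ` S}" using X_iff by (auto simp: win_rv)
  next
    fix y assume y: "y \<in> {y. \<forall>i. win N y i \<in> rev ` S}"
    have "st (rv y) i \<in> S" for i
    proof -
      have "st y (- i - int N + 1) \<in> rev ` S" using y by blast
      then show ?thesis by (auto simp: win_rv)
    qed
    then have "rv y \<in> X" using X_iff by blast
    then show "y \<in> rv ` X" by (metis rv_rv image_eqI)
  qed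
  show "rev ` S \<subseteq> {w. length w = N \<and> set w \<subseteq> A}"
  proof
    fix w assume "w \<in> rev ` S"
    then obtain v where v: "v \<in> S" "w = rev v" by blast
    then have "v \<in> {w. length w = N \<and> set w \<subseteq> A}" using S_words by blast
    then show "w \<in> {w. length w = N \<and> set w \<subseteq> A}" using v(2) by simp
  qed
qed (use finite_A N_pos in auto)

text \<open>The converse is obtained by applying this to the reversed subshift, since
  \<open>rv\<close> and \<open>rev\<close> are involutions.\<close>

lemma reach_rv:
  assumes "reach v u" shows "window_shift.reach N (rv ` X) (rev u) (rev v)"
proof -
  interpret R: window_shift A N "rev ` S" "rv ` X" by (rule window_shift_rv)
  obtain x n where x: "x \<in> X" "0 \<le> n" "st x 0 = v" "st x n = u" using assms by (rule reachE)
  have "R.reach (st (rv x) (- int N + 1 - n)) (st (rv x) (- int N + 1))"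
    using R.reachI[of "rv x"] x by simp
  then show ?thesis using x by (simp add: win_rv)
qed

lemma recurrent_rv:
  assumes "recurrent u" shows "window_shift.recurrent N (rv ` X) (rev u)"
proof -
  interpret R: window_shift A N "rev ` S" "rv ` X" by (rule window_shift_rv)
  obtain x n where x: "x \<in> X" "n > 0" "st x 0 = u" "st x n = u" using assms recurrent_def by blast
  have "st (rv x) (- int N + 1 - n) = rev u" "st (rv x) (- int N + 1) = rev u"
    using x by (simp_all add: win_rv)
  then show ?thesis using R.recurrentI[of "rv x" "- int N + 1 - n" "- int N + 1"] x by auto
qed

lemma infinite_Comp_rv:
  assumes "infinite (Comp u)" shows "infinite (window_shift.Comp N (rv ` X) (rev u))"
proof -
  interpret R: window_shift A N "rev ` S" "rv ` X" by (rule window_shift_rv)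
  have "rv ` Comp u \<subseteq> R.Comp (rev u)"
    unfolding Comp_def R.Comp_def mutual_def R.mutual_def using reach_rv by (auto simp: win_rv)
  then show ?thesis using assms finite_subset finite_imageD[OF _ inj_rv] by blast
qed

lemma has_split_rv:
  assumes "has_split A (rv ` X)" shows "has_split A X"
proof -
  interpret R: window_shift A N "rev ` S" "rv ` X" by (rule window_shift_rv)
  have endo: "endomorphism A X (\<lambda>x. rv (f (rv x)))" if f: "endomorphism A (rv ` X) f" for f
  proof (rule endomorphismI)
    have fc: "\<And>x i. x \<in> rv ` X \<Longrightarrow> \<exists>m. \<forall>y\<in>rv ` X. agree m x y \<longrightarrow> f y i = f x i"
      using f unfolding endomorphism_def continuous_map_shift_top[OF R.X_topspace R.X_topspace] by blast
    fix x assume x: "x \<in> X"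
    then have rx: "rv x \<in> rv ` X" by blast
    show "rv (f (rv x)) \<in> X" using endomorphism_into[OF R.X_topspace f rx] by auto
    show "rv (f (rv (sh n x))) = sh n (rv (f (rv x)))" for n
      using R.endomorphism_sh[OF f rx, of "- n"] by (simp add: sh_rv)
    obtain m where m: "\<forall>y\<in>rv ` X. agree m (rv x) y \<longrightarrow> f y 0 = f (rv x) 0" using fc[OF rx] by blast
    have "\<forall>y\<in>X. agree m x y \<longrightarrow> rv (f (rv y)) 0 = rv (f (rv x)) 0"
      using m by (auto simp: agree_rv rv_def[of "f _"])
    then show "\<exists>m. \<forall>y\<in>X. agree m x y \<longrightarrow> rv (f (rv y)) 0 = rv (f (rv x)) 0" by blast
  qed
  obtain g h y where gh: "endomorphism A (rv ` X) g" "endomorphism A (rv ` X) h"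
    "\<forall>x\<in>rv ` X. h (g x) = x" "y \<in> X" "homoclinic (rv y) (g (h (rv y)))" "g (h (rv y)) \<noteq> rv y"
    using assms unfolding has_split_def by blast
  show ?thesis
  proof (rule has_splitI[OF endo[OF gh(1)] endo[OF gh(2)]])
    show "homoclinic y (rv (g (rv (rv (h (rv y))))))" using homoclinic_rv[OF gh(5)] by simp
    show "rv (g (rv (rv (h (rv y))))) \<noteq> y" using gh(6) by (metis rv_rv)
  qed (use gh in auto)
qed

lemma infinite_rmax_split:
  assumes "recurrent u" "rmax u" "\<not> rmin u" "infinite (Comp u)" shows "has_split A X"
proof -
  interpret max_class A N S X u by standard (use assms in auto)
  show ?thesis using infinite_max_split assms unfolding rmin_def by blast
qed

text \<open>Reversal inverts \<open>reach\<close> and so exchanges minimal and maximal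
  classes.\<close>

lemma infinite_rmin_split:
  assumes u: "recurrent u" "rmin u" "\<not> rmax u" "infinite (Comp u)" shows "has_split A X"
proof (rule has_split_rv)
  interpret R: window_shift A N "rev ` S" "rv ` X" by (rule window_shift_rv)
  have R_reach: "reach v u" if "R.reach (rev u) (rev v)" for u v
    using R.reach_rv[OF that] by simp
  have reach_iff: "R.reach (rev u) (rev v) \<longleftrightarrow> reach v u" for u v
    using R_reach reach_rv by blast
  have rec_iff: "R.recurrent (rev v) \<longleftrightarrow> recurrent v" for v
    using recurrent_rv R.recurrent_rv[of "rev v"] by auto
  show "has_split A (rv ` X)"
  proof (rule R.infinite_rmax_split)
    show "R.recurrent (rev u)" using u rec_iff by blast
    show "R.rmax (rev u)" unfolding R.rmax_def
    proof (intro allI impI)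
      fix v assume "R.recurrent v \<and> R.reach (rev u) v"
      then have "recurrent (rev v)" "reach (rev v) u"
        using rec_iff[of "rev v"] reach_iff[of u "rev v"] by auto
      then have "reach u (rev v)" using u(2) unfolding rmin_def by blast
      then show "R.reach v (rev u)" using reach_iff[of "rev v" u] by simp
    qed
    obtain v where "recurrent v" "reach u v" "\<not> reach v u" using u(3) unfolding rmax_def by blast
    then show "\<not> R.rmin (rev u)" unfolding R.rmin_def using rec_iff reach_iff by blast
    show "infinite (R.Comp (rev u))" using infinite_Comp_rv u by blast
  qed
qed

text \<open>If \<open>u\<close> is neither minimal nor maximal, a maximal class above it decides:
  with a finite component, \<open>u\<close> is the intermediate class at which the loop is inserted;
  with an infinite one, that class is itself infinite, maximal and not minimal.\<close>

lemma not_low_poset_split: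
  assumes "\<not> low_poset" shows "has_split A X"
proof -
  consider u where "recurrent u" "\<not> rmin u" "\<not> rmax u"
    | u where "recurrent u" "infinite (Comp u)" "rmax u" "\<not> rmin u"
    | u where "recurrent u" "infinite (Comp u)" "rmin u" "\<not> rmax u"
    using assms unfolding low_poset_def by blast
  then show ?thesis
  proof cases
    case 1
    obtain b where b: "recurrent b" "rmax b" "reach u b" using ex_rmax_above 1 by blast
    have nbu: "\<not> reach b u"
    proof
      assume "reach b u"
      then have "rmax u" using b unfolding rmax_def using reach_trans by blast
      then show False using 1 by blast
    qed
    show ?thesis
    proof (cases "finite (Comp b)")
      case True
      interpret max_class A N S X b by standard (use b in auto)
      obtain v where "reach v u" "\<not> reach u v" using 1 unfolding rmin_def by blast
      then show ?thesis using finite_max_split[OF True 1(1) b(3) nbu] by blast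
    next
      case False
      have "\<not> rmin b" using 1 b nbu unfolding rmin_def by blast
      then show ?thesis using infinite_rmax_split b False by blast
    qed
  next
    case 2 then show ?thesis using infinite_rmax_split by blast
  next
    case 3 then show ?thesis using infinite_rmin_split by blast
  qed
qed

end

section \<open>Transient points and surjunctivity\<close>

definition orbit :: "(int \<Rightarrow> 'a) \<Rightarrow> (int \<Rightarrow> 'a) set" where "orbit x = range (\<lambda>n. sh n x)"

lemma self_orbit: "x \<in> orbit x"
  unfolding orbit_def using rangeI[of "\<lambda>n. sh n x" 0] by auto

lemma orbit_sh: "orbit (sh n x) = orbit x"
proof -
  have "sh k x \<in> range (\<lambda>m. sh (m + n) x)" for k
    by (rule range_eqI[of _ _ "k - n"]) simp
  then show ?thesis unfolding orbit_def by auto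
qed

context window_shift begin

lemma rmin_closed:
  assumes b: "recurrent b" "rmin b" and v: "reach v b" shows "mutual b v"
proof -
  obtain x where x: "x \<in> X" "st x 0 = v" using v reach_states stateE by blast
  obtain j where j: "j \<le> 0" "recurrent (st x j)" using backward_class[OF x(1)] by blast
  have "reach (st x j) v" using reachI[OF x(1) j(1)] x by simp
  then show ?thesis using b v j reach_trans unfolding rmin_def mutual_def by blast
qed

lemma NW_subset: "NW A X \<subseteq> X" using NW_iff by blast

lemma NW_sh: "sh n x \<in> NW A X \<longleftrightarrow> x \<in> NW A X"
proof -
  have "sh n x \<in> Comp u \<longleftrightarrow> x \<in> Comp u" for u by (rule window_shift.sh_X[OF Comp_window])
  then show ?thesis unfolding NW_eq by blast
qed

lemma closed_NW: "closedin (full_shift A) (NW A X)"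
proof -
  have "NW A X = \<Union>comps" using partition_comps by (simp add: partition_on_def)
  moreover have "closedin (full_shift A) C" if "C \<in> comps" for C
    using that window_shift.closed_X[OF Comp_window] unfolding comps_def by blast
  ultimately show ?thesis using finite_comps by (simp add: closedin_Union)
qed

lemma periodic_NW: assumes "x \<in> X" "p \<noteq> 0" "sh p x = x" shows "x \<in> NW A X"
proof -
  have "sh (- p) x = x" using assms(3) by (metis add.left_inverse sh_0 sh_sh)
  then have "sh \<bar>p\<bar> x = x" using assms(3) by (simp add: abs_if)
  then show ?thesis
    using periodic_Comp[of x "\<bar>p\<bar>" "st x 0" 0] assms mutual_refl st_in_states Comp_NW by fastforce
qed

lemma periodic_dense_NW:
  assumes x: "x \<in> NW A X" shows "\<exists>z\<in>NW A X. \<exists>p>0. sh p z = z \<and> agree m x z"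
proof -
  have xC: "x \<in> Comp (st x 0)" and r: "recurrent (st x 0)" using NW_Comp[OF x] NW_recurrent[OF x] by auto
  then have "mutual (st x 0) (st x i)" for i by (simp add: Comp_def)
  then obtain z p where z: "z \<in> Comp (st x 0)" "p > 0" "sh p z = z"
    "\<forall>k. - int m \<le> k \<and> k < int m + 1 + int N \<longrightarrow> z k = x k"
    using periodic_approx[OF r, of x "- int m" "int m + 1"] x NW_subset by auto
  have "agree m x z" using z(4) by (auto simp: agree_def abs_le_iff)
  then show ?thesis using z Comp_NW by blast
qed

text \<open>A transient point leaves a minimal class with finite component and soon meets a maximal
  class with finite component. One window determines each of the two tails, so a word across the
  transition determines the point; its length is the same for all transient points.\<close>

lemma transient_determined:
  assumes low: "low_poset" and x: "x \<in> X" "x \<notin> NW A X"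
  shows "\<exists>t. \<forall>y\<in>X. (\<forall>k. t \<le> k \<and> k < t + int (card states + 1 + N) \<longrightarrow> y k = x k) \<longrightarrow> y = x"
proof -
  let ?M = "int (card states)"
  obtain j where j: "recurrent (st x j)" "\<forall>k\<le>j. mutual (st x j) (st x k)"
    using backward_class[OF x(1)] by blast
  define u where "u = st x j"
  have u: "recurrent u" "\<And>k. k \<le> j \<Longrightarrow> mutual u (st x k)" using j by (auto simp: u_def)
  have "x \<notin> Comp u" using x(2) Comp_NW by blast
  then obtain k0 where k0: "\<not> mutual u (st x k0)" using x(1) by (auto simp: Comp_def)
  then have "k0 > j" using u(2)[of k0] by (meson not_le)
  let ?P = "\<lambda>n. \<not> mutual u (st x (j + int n))"
  have "?P (nat (k0 - j))" using k0 \<open>k0 > j\<close> by simp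
  then obtain n where n: "?P n" "\<forall>k<n. \<not> ?P k" using exists_least_iff[of ?P] by blast
  have "n \<noteq> 0"
  proof
    assume "n = 0" then show False using n(1) u(2)[of j] by simp
  qed
  \<comment> \<open>The last time at which \<open>x\<close> is in the class of
    \<open>u\<close>.\<close>
  define t where "t = j + int n - 1"
  have tl: "mutual u (st x k)" if "k \<le> t" for k
  proof (cases "k \<le> j")
    case False
    then have "nat (k - j) < n" using that by (auto simp: t_def)
    then show ?thesis using n(2) False by force
  qed (use u in blast)
  have t1: "\<not> mutual u (st x (t + 1))" using n(1) by (simp add: t_def)
  have tr: "\<not> mutual u (st x k)" if "k > t" for k
    using t1 mutual_between[OF x(1), of t "t + 1" k u] tl[of t] that by auto
  have nr: "reach u (st x k) \<and> \<not> reach (st x k) u" if "k > t" for k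
  proof -
    have "reach u (st x k)" using reachI[OF x(1), of t k] tl[of t] that reach_trans by (auto simp: mutual_def)
    then show ?thesis using tr[OF that] by (simp add: mutual_def)
  qed
  obtain j2 where j2: "j2 \<ge> t + 1" "recurrent (st x j2)" using forward_class[OF x(1)] by blast
  have "\<not> rmax u" using nr[of j2] j2 unfolding rmax_def by auto
  then have umin: "rmin u" "finite (Comp u)" using low u(1) unfolding low_poset_def by blast+
  \<comment> \<open>Two of the \<open>card states + 1\<close> windows after \<open>t\<close>
    coincide, so a recurrent state is met within this many steps. It has \<open>u\<close> strictly
    below it, so its class is not minimal.\<close>
  have "(\<lambda>i. st x (t + 1 + int i)) ` {0..card states} \<subseteq> states" using x(1) st_in_states by blast
  then have "card ((\<lambda>i. st x (t + 1 + int i)) ` {0..card states}) \<le> card states"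
    using card_mono finite_states by blast
  then have "\<not> inj_on (\<lambda>i. st x (t + 1 + int i)) {0..card states}" using card_image by fastforce
  then obtain i1 i2 where i12: "i1 < i2" "i2 \<le> card states" "st x (t + 1 + int i1) = st x (t + 1 + int i2)"
    unfolding inj_on_def by (metis atLeastAtMost_iff linorder_neqE_nat)
  define i where "i = t + 1 + int i1"
  define r where "r = st x i"
  have i: "t < i" "i \<le> t + ?M" using i12 by (auto simp: i_def)
  have r: "recurrent r" using recurrentI[OF x(1) _ i12(3)] i12(1) by (simp add: r_def i_def)
  have "\<not> rmin r" using nr[OF i(1)] u(1) unfolding rmin_def r_def by blast
  then have rmx: "rmax r" "finite (Comp r)" using low r unfolding low_poset_def by blast+
  show ?thesis
  proof (intro exI[of _ t] ballI impI)
    fix y assume y: "y \<in> X" "\<forall>k. t \<le> k \<and> k < t + int (card states + 1 + N) \<longrightarrow> y k = x k"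
    have sty: "st y k = st x k" if "t \<le> k" "k \<le> t + ?M" for k
      by (rule win_cong) (use y(2) that in auto)
    \<comment> \<open>Minimality of the class of \<open>u\<close> keeps the left tail of
      \<open>y\<close> in it, and maximality of the class of \<open>r\<close> keeps the right tail
      in that one.\<close>
    have yl: "mutual u (st y k)" if "k \<le> t" for k
    proof (rule rmin_closed[OF u(1) umin(1)])
      have "reach (st y k) (st y t)" using reachI[OF y(1) that] .
      then show "reach (st y k) u" using sty[of t] tl[of t] reach_trans by (auto simp: mutual_def)
    qed
    have right: "mutual r (st z k)" if "z \<in> X" "st z i = r" "i \<le> k" for z k
      using rmax_closed[OF r rmx(1)] reachI[OF that(1,3)] that(2) by simp
    have styi: "st y i = r" using sty[of i] i by (simp add: r_def)
    have "y k = x k" for k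
    proof -
      consider "k \<le> t" | "t < k" "k < i" | "i \<le> k" by linarith
      then show ?thesis
      proof cases
        case 1
        show ?thesis
          by (rule finite_Comp_det[OF u(1) umin(2) y(1) x(1) yl[OF 1] yl tl[OF 1] tl 1 order_refl])
            (use sty[of t] 1 N_pos in auto)
      next
        case 2 then show ?thesis using y(2) i by simp
      next
        case 3
        show ?thesis
          by (rule finite_Comp_det[OF r rmx(2) y(1) x(1), where l = i and i = i and j = k])
            (use right[OF y(1) styi] right[OF x(1)] styi 3 N_pos in \<open>auto simp: r_def\<close>)
      qed
    qed
    then show "y = x" by blast
  qed
qed

lemma transient_isolated:
  assumes "low_poset" "x \<in> X" "x \<notin> NW A X"
  shows "\<exists>m. \<forall>y\<in>X. agree m x y \<longrightarrow> y = x"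
proof -
  obtain t where t: "\<forall>y\<in>X. (\<forall>k. t \<le> k \<and> k < t + int (card states + 1 + N) \<longrightarrow> y k = x k) \<longrightarrow> y = x"
    using transient_determined[OF assms] by blast
  let ?m = "nat \<bar>t\<bar> + card states + 1 + N"
  have "y = x" if y: "y \<in> X" "agree ?m x y" for y
  proof -
    have "y k = x k" if "t \<le> k" "k < t + int (card states + 1 + N)" for k
      by (rule agreeD[OF agree_sym[OF y(2)]]) (use that in auto)
    then show ?thesis using t y(1) by blast
  qed
  then show ?thesis by blast
qed

lemma inj_on_win_finite:
  assumes "R \<subseteq> X" "inj_on (\<lambda>x. win L x 0) R" shows "finite R"
proof (rule inj_on_finite[OF assms(2)])
  show "(\<lambda>x. win L x 0) ` R \<subseteq> {w. set w \<subseteq> A \<and> length w = L}"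
    using X_topspace assms(1) unfolding topspace_full_shift win_def by fastforce
  show "finite {w. set w \<subseteq> A \<and> length w = L}" using finite_lists_length_eq[OF finite_A] .
qed

lemma finite_transient_orbits:
  assumes low: "low_poset" shows "finite (orbit ` (X - NW A X))"
proof -
  let ?L = "card states + 1 + N"
  \<comment> \<open>The points determined by their word of length \<open>?L\<close> at 0 are
    finitely many, and every transient orbit contains one of them.\<close>
  let ?R = "{z \<in> X. \<forall>y\<in>X. win ?L y 0 = win ?L z 0 \<longrightarrow> y = z}"
  have "finite ?R" by (rule inj_on_win_finite[of _ ?L]) (auto simp: inj_on_def)
  moreover have "orbit ` (X - NW A X) \<subseteq> orbit ` ?R"
  proof
    fix o' assume "o' \<in> orbit ` (X - NW A X)"
    then obtain x where x: "x \<in> X" "x \<notin> NW A X" "o' = orbit x" by blast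
    then obtain t where t: "\<forall>y\<in>X. (\<forall>k. t \<le> k \<and> k < t + int ?L \<longrightarrow> y k = x k) \<longrightarrow> y = x"
      using transient_determined[OF low] by blast
    have "y = sh t x" if y: "y \<in> X" "win ?L y 0 = win ?L (sh t x) 0" for y
    proof -
      have "sh (- t) y k = x k" if "t \<le> k" "k < t + int ?L" for k
        using y(2)[unfolded win_eq_iff, rule_format, of "k - t"] that by (simp add: sh_apply)
      then have "sh (- t) y = x" using t y(1) sh_X by blast
      then show ?thesis by auto
    qed
    then have "sh t x \<in> ?R" using x sh_X by blast
    then show "o' \<in> orbit ` ?R" using x(3) orbit_sh by blast
  qed
  ultimately show ?thesis by (rule finite_surj)
qed

lemma endo_orbit:
  assumes f: "endomorphism A X f" and x: "x \<in> X"
  shows "f ` orbit x = orbit (f x)"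
  unfolding orbit_def image_image using endomorphism_sh[OF f x] by simp

lemma orbit_transient: "x \<in> X - NW A X \<Longrightarrow> orbit x \<subseteq> X - NW A X"
  unfolding orbit_def using NW_sh sh_X by blast

lemma endo_closed_image:
  assumes f: "endomorphism A X f" and C: "closedin (full_shift A) C" "C \<subseteq> X"
  shows "closedin (full_shift A) (f ` C)"
proof -
  have "compactin (full_shift A) C"
    by (rule closedin_compact_space[OF compact_space_full_shift[OF finite_A] C(1)])
  then have "compactin (shift_top A X) C" using C(2) by (simp add: compactin_subtopology)
  then have "compactin (shift_top A X) (f ` C)"
    using f image_compactin unfolding endomorphism_def by blast
  then have "compactin (full_shift A) (f ` C)" by (simp add: compactin_subtopology)
  then show ?thesis using compactin_imp_closedin Hausdorff_space_full_shift by blast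
qed

lemma endo_uniform:
  assumes f: "endomorphism A X f" and x: "x \<in> X"
  shows "\<exists>m. \<forall>y\<in>X. agree m x y \<longrightarrow> agree k (f x) (f y)"
proof -
  have "openin (shift_top A X) {y \<in> X. agree k (f x) y}"
    unfolding openin_shift_top[OF X_topspace] using agree_trans by blast
  then have "openin (shift_top A X) {y \<in> topspace (shift_top A X). f y \<in> {y \<in> X. agree k (f x) y}}"
    using f openin_continuous_map_preimage unfolding endomorphism_def by blast
  then have "openin (shift_top A X) {y \<in> X. f y \<in> {y \<in> X. agree k (f x) y}}"
    unfolding topspace_shift_top[OF X_topspace] .
  moreover have "x \<in> {y \<in> X. f y \<in> {y \<in> X. agree k (f x) y}}"
    using x endomorphism_into[OF X_topspace f x] by simp
  ultimately show ?thesis unfolding openin_shift_top[OF X_topspace] by fast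
qed

lemma low_poset_surjunctive:
  assumes low: "low_poset" shows "surjunctive A X"
  unfolding surjunctive_def
proof (intro allI impI, elim conjE)
  fix \<tau> assume \<tau>: "endomorphism A X \<tau>" and inj: "inj_on \<tau> X"
  note into = endomorphism_into[OF X_topspace \<tau>]
  have per: "\<exists>q'\<in>NW A X. q = \<tau> q'" if q: "q \<in> X" "p > 0" "sh p q = q" for q p
  proof -
    let ?F = "{x \<in> X. sh p x = x}"
    have "\<tau> x \<in> ?F" if "x \<in> ?F" for x using into endomorphism_sh[OF \<tau>, of x p] that by auto
    then have "\<tau> ` ?F \<subseteq> ?F" by (rule image_subsetI)
    moreover have "inj_on \<tau> ?F" by (rule inj_on_subset[OF inj]) simp
    ultimately have "\<tau> ` ?F = ?F" by (intro endo_inj_surj finite_periodic[OF q(2)])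
    moreover have "q \<in> ?F" using q by simp
    ultimately have "q \<in> \<tau> ` ?F" by simp
    then obtain q' where "q' \<in> X" "sh p q' = q'" "q = \<tau> q'" by (elim imageE) auto
    then show ?thesis using periodic_NW[of q' p] q(2) by auto
  qed
  have NWim: "NW A X \<subseteq> \<tau> ` NW A X"
  proof
    fix x assume x: "x \<in> NW A X"
    have "\<exists>y\<in>\<tau> ` NW A X. agree m x y" for m
      using periodic_dense_NW[OF x, of m] per NW_subset by (metis imageI subsetD)
    moreover have "closedin (full_shift A) (\<tau> ` NW A X)"
      by (rule endo_closed_image[OF \<tau> closed_NW NW_subset])
    ultimately show "x \<in> \<tau> ` NW A X"
      using x NW_subset X_topspace unfolding closedin_full_shift by blast
  qed
  let ?W = "X - NW A X"
  \<comment> \<open>The set \<open>NW A X\<close> is already covered by its own image, so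
    injectivity keeps transient points out of it.\<close>
  have tW: "\<tau> x \<in> ?W" if x: "x \<in> ?W" for x
  proof -
    have "\<tau> x \<notin> NW A X"
    proof
      assume "\<tau> x \<in> NW A X"
      then obtain y where "y \<in> NW A X" "\<tau> x = \<tau> y" using NWim by blast
      then have "x = y" using inj x NW_subset by (auto dest: inj_onD)
      then show False using x \<open>y \<in> NW A X\<close> by blast
    qed
    then show ?thesis using into x by blast
  qed
  let ?O = "orbit ` ?W"
  have "(`) \<tau> ` ?O \<subseteq> ?O" using tW endo_orbit[OF \<tau>] by blast
  moreover have "inj_on ((`) \<tau>) ?O"
  proof (rule inj_onI)
    fix a b assume "a \<in> ?O" "b \<in> ?O" "\<tau> ` a = \<tau> ` b"
    moreover from this have "a \<subseteq> X" "b \<subseteq> X" using orbit_transient by blast+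
    ultimately show "a = b" using inj_on_image_eq_iff[OF inj] by blast
  qed
  ultimately have O: "(`) \<tau> ` ?O = ?O" by (intro endo_inj_surj finite_transient_orbits[OF low])
  show "\<tau> ` X = X"
  proof
    show "X \<subseteq> \<tau> ` X"
    proof
      fix x assume x: "x \<in> X"
      show "x \<in> \<tau> ` X"
      proof (cases "x \<in> NW A X")
        case True then show ?thesis using NWim NW_subset by blast
      next
        case False
        then have "orbit x \<in> (`) \<tau> ` ?O" using x O by blast
        then obtain y where "y \<in> ?W" "orbit x = \<tau> ` orbit y" by blast
        then show ?thesis using self_orbit[of x] orbit_transient[of y] by auto
      qed
    qed
  qed (use into in blast)
qed

end

section \<open>The Moore property of irreducible subshifts of finite type\<close>

text \<open>Paths with \<open>k\<close> edges starting at \<open>v\<close> in the directed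
  multigraph with edge set \<open>T\<close>.\<close>

primrec chains :: "('c \<Rightarrow> 'v) \<Rightarrow> ('c \<Rightarrow> 'v) \<Rightarrow> 'c set \<Rightarrow> nat \<Rightarrow> 'v \<Rightarrow> 'c list set"
  where
    "chains src tgt T 0 v = {[]}"
  | "chains src tgt T (Suc k) v = (\<Union>c\<in>{c \<in> T. src c = v}. (#) c ` chains src tgt T k (tgt c))"

lemma finite_chains: "finite T \<Longrightarrow> finite (chains src tgt T k v)"
  by (induction k arbitrary: v) auto

lemma card_chains_Suc:
  assumes "finite T"
  shows "card (chains src tgt T (Suc k) v) = (\<Sum>c\<in>{c \<in> T. src c = v}. card (chains src tgt T k (tgt c)))"
proof -
  have "card (chains src tgt T (Suc k) v) = (\<Sum>c\<in>{c \<in> T. src c = v}. card ((#) c ` chains src tgt T k (tgt c)))"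
    unfolding chains.simps using assms
    by (intro card_UN_disjoint) (auto intro: finite_chains)
  then show ?thesis by (simp add: card_image)
qed

text \<open>Assign to each edge a parallel forbidden one; a forbidden edge is assigned to at most
  \<open>card T - 1\<close> allowed edges. So in each step the allowed edges carry at most the
  fraction \<open>(card T - 1) / card T\<close> of all continuations.\<close>

lemma card_chains_avoiding:
  assumes fin: "finite T" and B: "\<And>c. c \<in> T \<Longrightarrow> \<exists>b\<in>B \<inter> T. src b = src c \<and> tgt b = tgt c"
  shows "card T ^ k * card (chains src tgt (T - B) k v) \<le> (card T - 1) ^ k * card (chains src tgt T k v)"
proof (induction k arbitrary: v)
  case (Suc k)
  let ?M = "card T" and ?g = "\<lambda>v. card (chains src tgt (T - B) k v)" and ?f = "\<lambda>v. card (chains src tgt T k v)"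
  let ?G = "{c \<in> T - B. src c = v}" and ?H = "{c \<in> T \<inter> B. src c = v}"
  define a where "a = (\<lambda>v. (?M - 1) ^ k * ?f v)"
  obtain \<beta> where \<beta>: "\<And>c. c \<in> T \<Longrightarrow> \<beta> c \<in> B \<inter> T \<and> src (\<beta> c) = src c \<and> tgt (\<beta> c) = tgt c" using B by metis
  have finG: "finite ?G" and finH: "finite ?H" using fin by auto
  \<comment> \<open>The allowed edges are grouped by the forbidden edge assigned to them, which has
    the same target and hence the same weight.\<close>
  have "(\<Sum>c\<in>?G. a (tgt c)) = (\<Sum>b\<in>?H. \<Sum>c\<in>{c \<in> ?G. \<beta> c = b}. a (tgt c))"
  proof (rule sum.group[OF finG finH, symmetric], rule image_subsetI)
    fix c assume c: "c \<in> ?G"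
    then have "\<beta> c \<in> B \<inter> T \<and> src (\<beta> c) = src c" using \<beta>[of c] by blast
    then show "\<beta> c \<in> ?H" using c by (simp add: Int_commute)
  qed
  also have "\<dots> \<le> (\<Sum>b\<in>?H. (?M - 1) * a (tgt b))"
  proof (rule sum_mono)
    fix b assume b: "b \<in> ?H"
    have "(\<Sum>c\<in>{c \<in> ?G. \<beta> c = b}. a (tgt c)) = (\<Sum>c\<in>{c \<in> ?G. \<beta> c = b}. a (tgt b))"
    proof (rule sum.cong[OF refl])
      fix c assume c: "c \<in> {c \<in> ?G. \<beta> c = b}"
      then have "c \<in> T" "\<beta> c = b" by blast+
      then have "tgt b = tgt c" using \<beta>[of c] by metis
      then show "a (tgt c) = a (tgt b)" by simp
    qed
    also have "\<dots> = card {c \<in> ?G. \<beta> c = b} * a (tgt b)" by simp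
    also have "card {c \<in> ?G. \<beta> c = b} \<le> card (T - {b})"
    proof (rule card_mono)
      show "{c \<in> ?G. \<beta> c = b} \<subseteq> T - {b}" using b by blast
    qed (use fin in simp)
    also have "card (T - {b}) = ?M - 1" using b fin by simp
    finally show "(\<Sum>c\<in>{c \<in> ?G. \<beta> c = b}. a (tgt c)) \<le> (?M - 1) * a (tgt b)" by simp
  qed
  also have "\<dots> = (?M - 1) * (\<Sum>b\<in>?H. a (tgt b))" by (simp add: sum_distrib_left)
  finally have GH: "(\<Sum>c\<in>?G. a (tgt c)) \<le> (?M - 1) * (\<Sum>b\<in>?H. a (tgt b))" .
  have split: "(\<Sum>c\<in>{c \<in> T. src c = v}. a (tgt c)) = (\<Sum>c\<in>?G. a (tgt c)) + (\<Sum>b\<in>?H. a (tgt b))"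
  proof -
    have e: "{c \<in> T. src c = v} = ?G \<union> ?H" by blast
    show ?thesis unfolding e by (rule sum.union_disjoint[OF finG finH]) blast
  qed
  have "?M ^ Suc k * card (chains src tgt (T - B) (Suc k) v) = ?M * (\<Sum>c\<in>?G. ?M ^ k * ?g (tgt c))"
    using fin by (simp add: card_chains_Suc sum_distrib_left mult.assoc del: chains.simps)
  also have "\<dots> \<le> ?M * (\<Sum>c\<in>?G. a (tgt c))"
    unfolding a_def using Suc by (intro mult_le_mono2 sum_mono) blast
  \<comment> \<open>With \<open>G\<close>, \<open>H\<close> for the sums over \<open>?G\<close>,
    \<open>?H\<close> and \<open>M\<close> for \<open>?M\<close>, the claim
    \<open>M * G \<le> (M - 1) * (G + H)\<close> is \<open>G \<le> (M - 1) * H\<close>. The case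
    \<open>M = 0\<close> is separate because subtraction is truncated.\<close>
  also have "\<dots> \<le> (?M - 1) * (\<Sum>c\<in>{c \<in> T. src c = v}. a (tgt c))"
  proof (cases "?M")
    case 0
    then have "T = {}" using fin by simp
    then show ?thesis by simp
  next
    case (Suc n)
    then show ?thesis using GH unfolding split by (simp add: algebra_simps)
  qed
  also have "\<dots> = (?M - 1) ^ Suc k * card (chains src tgt T (Suc k) v)"
    unfolding a_def using fin by (simp add: card_chains_Suc sum_distrib_left mult.assoc del: chains.simps)
  finally show ?case .
qed simp

lemma exponential_beats_constant:
  fixes M C :: nat
  assumes "0 < M" "\<And>k. M ^ k \<le> C * (M - 1) ^ k"
  shows False
proof -
  let ?t = "real (M - 1) / real M"
  have "?t < 1" using assms(1) by simp
  moreover have "0 < 1 / (real C + 1)" by simp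
  ultimately obtain k where k: "?t ^ k < 1 / (real C + 1)" using real_arch_pow_inv by blast
  have "real (M ^ k) \<le> real (C * (M - 1) ^ k)" using assms(2) of_nat_le_iff by blast
  then have "1 \<le> real C * ?t ^ k" using assms(1) by (simp add: field_simps power_divide)
  also have "\<dots> \<le> real C * (1 / (real C + 1))" using k by (intro mult_left_mono) auto
  also have "\<dots> < 1" by simp
  finally show False by simp
qed

context window_shift begin

text \<open>The Curtis-Hedlund-Lyndon theorem: compactness gives one radius for coordinate 0, and
  commutation with the shift moves it to every coordinate.\<close>

lemma endo_radius:
  assumes f: "endomorphism A X f"
  shows "\<exists>r::nat. \<forall>x\<in>X. \<forall>y\<in>X. \<forall>i. (\<forall>k. \<bar>k - i\<bar> \<le> int r \<longrightarrow> x k = y k) \<longrightarrow> f x i = f y i"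
proof -
  have "\<forall>x\<in>X. \<exists>m. \<forall>y\<in>X. agree m x y \<longrightarrow> f y 0 = f x 0"
    using f unfolding endomorphism_def continuous_map_shift_top[OF X_topspace X_topspace] by blast
  then obtain m where m: "\<And>x y. x \<in> X \<Longrightarrow> y \<in> X \<Longrightarrow> agree (m x) x y \<Longrightarrow> f y 0 = f x 0" by metis
  let ?U = "\<lambda>x. {y \<in> topspace (full_shift A). agree (m x) x y}"
  have "openin (full_shift A) (?U x)" for x
    unfolding openin_full_shift using agree_trans by blast
  moreover have "X \<subseteq> \<Union>(?U ` X)" using X_topspace by auto
  ultimately have "\<exists>\<W>. finite \<W> \<and> \<W> \<subseteq> ?U ` X \<and> X \<subseteq> \<Union>\<W>"
    by (intro compactinD[OF compactin_X]) auto
  then obtain \<W> where W: "finite \<W>" "\<W> \<subseteq> ?U ` X" "X \<subseteq> \<Union>\<W>" by blast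
  obtain F where F0: "F \<subseteq> X" "finite F" "\<W> = ?U ` F" using finite_subset_image[OF W(1,2)] by blast
  then have F: "F \<subseteq> X" "finite F" "X \<subseteq> \<Union>(?U ` F)" using W(3) by auto
  let ?r = "Max (insert 0 (m ` F))"
  have main: "f y 0 = f z 0" if yz: "y \<in> X" "z \<in> X" "agree ?r y z" for y z
  proof -
    obtain x where x: "x \<in> F" "agree (m x) x y" using F(3) yz by blast
    have "m x \<le> ?r" using F(2) x(1) by (intro Max_ge) auto
    then have "agree (m x) x z" using agree_trans[OF x(2)] agree_mono yz(3) by blast
    then show ?thesis using m x yz F(1) by (metis subsetD)
  qed
  have "f x i = f y i" if "x \<in> X" "y \<in> X" "\<forall>k. \<bar>k - i\<bar> \<le> int ?r \<longrightarrow> x k = y k" for x y i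
  proof -
    have "agree ?r (sh i x) (sh i y)" using that(3) by (simp add: agree_def sh_apply)
    then have "f (sh i x) 0 = f (sh i y) 0" using main that sh_X by blast
    then show ?thesis using endomorphism_sh[OF f] that(1,2) by (simp add: sh_apply)
  qed
  then show ?thesis by blast
qed

text \<open>A letter is a path of \<open>R\<close> steps: \<open>take N\<close> gives its initial
  state and \<open>drop R\<close> its final one.\<close>

definition letters :: "nat \<Rightarrow> 'a list set"
  where "letters R = (\<lambda>z. win (R + N) z 0) ` X"

text \<open>Consecutive blocks overlap in \<open>N\<close> symbols, which makes the list a path in
  the graph whose edges are the letters.\<close>

definition blocks :: "nat \<Rightarrow> (int \<Rightarrow> 'a) \<Rightarrow> nat \<Rightarrow> 'a list list"
  where "blocks R z k = map (\<lambda>j. win (R + N) z (int j * int R)) [0..<k]"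

lemma finite_words_X: "finite ((\<lambda>z. win L z i) ` X)"
proof (rule finite_subset)
  show "(\<lambda>x. win L x i) ` X \<subseteq> {w. set w \<subseteq> A \<and> length w = L}"
    using X_topspace unfolding topspace_full_shift win_def by fastforce
  show "finite {w. set w \<subseteq> A \<and> length w = L}" using finite_lists_length_eq[OF finite_A] .
qed

lemma finite_letters: "finite (letters R)"
  unfolding letters_def by (rule finite_words_X)

lemma take_win: "take n (win (n + m) z i) = win n z i"
  by (simp add: win_def take_map)

lemma drop_win: "drop n (win (n + m) z i) = win m z (i + int n)"
  by (rule nth_equalityI) (auto simp: win_def algebra_simps)

lemma take_letter: "take N (win (R + N) z i) = st z i"
  using take_win[of N R z i] by (simp add: add.commute)

lemma drop_letter: "drop R (win (R + N) z i) = st z (i + int R)"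
  by (rule drop_win)

lemma blocks_Suc: "blocks R z (Suc k) = win (R + N) z 0 # blocks R (sh (int R) z) k"
  unfolding blocks_def by (simp add: upt_conv_Cons map_Suc_upt[symmetric] win_sh algebra_simps del: upt_Suc)

lemma blocks_in_chains:
  assumes "z \<in> X" "\<And>j. j < k \<Longrightarrow> win (R + N) z (int j * int R) \<in> T"
  shows "blocks R z k \<in> chains (take N) (drop R) T k (st z 0)"
  using assms
proof (induction k arbitrary: z)
  case 0 then show ?case by (simp add: blocks_def)
next
  case (Suc k)
  have "win (R + N) (sh (int R) z) (int j * int R) \<in> T" if "j < k" for j
    using Suc.prems(2)[of "Suc j"] that by (simp add: win_sh algebra_simps)
  then have "blocks R (sh (int R) z) k \<in> chains (take N) (drop R) T k (st (sh (int R) z) 0)"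
    using Suc.IH[of "sh (int R) z"] Suc.prems(1) sh_X by blast
  then show ?case unfolding blocks_Suc chains.simps
    using Suc.prems(2)[of 0] by (auto simp: take_letter drop_letter win_sh)
qed

lemma win_in_letters: "z \<in> X \<Longrightarrow> win (R + N) z i \<in> letters R"
  unfolding letters_def by (rule image_eqI[of _ _ "sh i z"]) (auto simp: win_sh sh_X)

lemma chains_realized:
  assumes "v \<in> states" "cs \<in> chains (take N) (drop R) (letters R) k v"
  shows "\<exists>z\<in>X. st z 0 = v \<and> blocks R z k = cs"
  using assms
proof (induction k arbitrary: v cs)
  case 0
  then show ?case using stateE[of v] by (auto simp: blocks_def)
next
  case (Suc k)
  then obtain c cs' where c: "cs = c # cs'" "c \<in> letters R" "take N c = v"
    "cs' \<in> chains (take N) (drop R) (letters R) k (drop R c)" by auto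
  obtain z0 where z0: "z0 \<in> X" "c = win (R + N) z0 0" using c(2) letters_def by auto
  have "drop R c = st z0 (int R)" using z0 drop_letter[of R z0 0] by simp
  then obtain z' where z': "z' \<in> X" "st z' 0 = st z0 (int R)" "blocks R z' k = cs'"
    using Suc.IH[OF _ c(4)] z0(1) st_in_states by metis
  let ?z = "glue (int R) z0 (sh (- int R) z')"
  have e: "st z0 (int R) = st (sh (- int R) z') (int R)" using z' by (simp add: win_sh)
  have zX: "?z \<in> X" using glue_X[OF z0(1) _ e] z' sh_X by blast
  have w0: "win (R + N) ?z 0 = c" unfolding z0(2)
    by (rule win_cong, rule glue_left'[OF e]) auto
  have "win (R + N) (sh (int R) ?z) (int j * int R) = win (R + N) z' (int j * int R)" for j
  proof (rule win_cong)
    fix k assume "int j * int R \<le> k"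
    moreover have "0 \<le> int j * int R" by simp
    ultimately have "0 \<le> k" by (rule order_trans[rotated])
    then show "sh (int R) ?z k = z' k" by (simp add: sh_apply glue_def)
  qed
  then have "blocks R (sh (int R) ?z) k = cs'" using z'(3) unfolding blocks_def by simp
  moreover have "st ?z 0 = v" using take_letter[of R ?z 0] w0 c(3) by simp
  ultimately show ?case using zX w0 c(1) by (intro bexI[of _ ?z]) (auto simp: blocks_Suc)
qed

lemma blocks_determine:
  assumes "st x 0 = st y 0" "blocks R x k = blocks R y k" "0 \<le> i" "i < int k * int R + int N"
  shows "x i = y i"
  using assms
proof (induction k arbitrary: x y i)
  case 0 then show ?case unfolding win_eq_Ico by auto
next
  case (Suc k)
  have w: "win (R + N) x 0 = win (R + N) y 0" "blocks R (sh (int R) x) k = blocks R (sh (int R) y) k"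
    using Suc.prems(2) by (auto simp: blocks_Suc)
  show ?case
  proof (cases "i < int R")
    case True then show ?thesis using w(1) Suc.prems(3) unfolding win_eq_Ico by auto
  next
    case False
    have "st (sh (int R) x) 0 = st (sh (int R) y) 0"
      using drop_letter[of R x 0] drop_letter[of R y 0] w(1) by (simp add: win_sh)
    then have "sh (int R) x (i - int R) = sh (int R) y (i - int R)"
      using Suc.IH[OF _ w(2), of "i - int R"] False Suc.prems(4) by (simp add: algebra_simps)
    then show ?thesis by (simp add: sh_apply)
  qed
qed

text \<open>Two homoclinic points with the same image give two blocks that can be exchanged without
  changing the image. Forbidding one of them leaves exponentially fewer words, while
  surjectivity would keep their number up to a constant factor.\<close>

lemma irreducible_moore:
  assumes irr: "\<And>v w. v \<in> states \<Longrightarrow> w \<in> states \<Longrightarrow> reach v w"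
    and f: "endomorphism A X f" "f ` X = X"
    and xy: "x \<in> X" "y \<in> X" "homoclinic x y" "f x = f y"
  shows "x = y"
proof (rule ccontr)
  assume ne: "x \<noteq> y"
  obtain r :: nat where r: "\<And>x y i. x \<in> X \<Longrightarrow> y \<in> X \<Longrightarrow> (\<And>k. \<bar>k - i\<bar> \<le> int r \<Longrightarrow> x k = y k) \<Longrightarrow> f x i = f y i"
    using endo_radius[OF f(1)] by metis
  obtain a :: nat where a: "\<And>k. \<bar>k\<bar> > int a \<Longrightarrow> x k = y k"
  proof -
    have "finite (insert 0 (abs ` {i. x i \<noteq> y i}))" using xy(3) by (simp add: homoclinic_def)
    then have "\<bar>k\<bar> \<le> Max (insert 0 (abs ` {i. x i \<noteq> y i}))" if "x k \<noteq> y k" for k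
      using that by (intro Max_ge) auto
    note bound = this
    have "x k = y k" if "\<bar>k\<bar> > int (nat (Max (insert 0 (abs ` {i. x i \<noteq> y i}))))" for k
      by (rule ccontr) (use that bound[of k] in linarith)
    then show ?thesis using that by blast
  qed
  \<comment> \<open>The places where \<open>x\<close> and \<open>y\<close> differ are moved into
    \<open>[0, L)\<close>, away from its ends. Because of the margins \<open>2 * r\<close>, a
    coordinate of the image sees either only the exchanged word or no change; the additional
    \<open>N\<close> keeps the first window of a block intact.\<close>
  define s where "s = int (a + 2 * r + N + 1)"
  define L where "L = 2 * s + 1"
  define x' where "x' = sh (- s) x"
  define y' where "y' = sh (- s) y"
  have L: "L > 0" by (simp add: L_def s_def)
  have x'X: "x' \<in> X" and y'X: "y' \<in> X" using xy sh_X by (auto simp: x'_def y'_def)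
  have x'y': "x' k = y' k" if "k < 2 * int r + int N \<or> L - 2 * int r \<le> k" for k
    unfolding x'_def y'_def sh_apply by (rule a) (use that in \<open>auto simp: L_def s_def\<close>)
  have ne': "x' \<noteq> y'" using ne by (simp add: x'_def y'_def sh_eq_iff)
  have fx'y': "f x' = f y'" using endomorphism_sh[OF f(1)] xy by (simp add: x'_def y'_def)
  have st0: "st x' 0 = st y' 0" by (rule win_cong, rule x'y') auto
  have stL: "st x' L = st y' L" by (rule win_cong, rule x'y') auto
  define occ where "occ = (\<lambda>z i. \<forall>k. 0 \<le> k \<and> k < L + int N \<longrightarrow> z (i + k) = y' k)"
  define rep where "rep = (\<lambda>z i. surg z i L x' 0)"
  have occ_st: "st z (i + k) = st y' k" if "occ z i" "0 \<le> k" "k \<le> L" for z i k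
    using that unfolding occ_def win_eq_iff by (auto simp: add.assoc)
  have rep_X: "rep z i \<in> X" if "z \<in> X" "occ z i" for z i
    unfolding rep_def
    by (rule surg_X[OF that(1) x'X]) (use L occ_st[OF that(2), of 0] occ_st[OF that(2), of L] st0 stL in auto)
  have rep_in: "rep z i (i + k) = x' k" if "0 \<le> k" "k < L" for z i k
    unfolding rep_def using that by (simp add: surg_mid)
  have rep_eq: "rep z i k = z k" if "occ z i" "k < i + 2 * int r + int N \<or> i + L - 2 * int r \<le> k" for z i k
  proof (cases "i \<le> k \<and> k < i + L")
    case True
    then have "rep z i k = x' (k - i)" unfolding rep_def by (simp add: surg_mid)
    also have "\<dots> = y' (k - i)" by (rule x'y') (use that(2) in auto)
    also have "\<dots> = z k" using that(1)[unfolded occ_def, rule_format, of "k - i"] True by simp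
    finally show ?thesis .
  next
    case False
    then show ?thesis unfolding rep_def by (auto simp: surg_def glue_def)
  qed
  have f_rep: "f (rep z i) = f z" if z: "z \<in> X" "occ z i" for z i
  proof
    fix j
    show "f (rep z i) j = f z j"
    proof (cases "i + int r \<le> j \<and> j < i + L - int r")
      case True
      have "f (rep z i) j = f (sh (- i) x') j"
      proof (rule r[OF rep_X[OF z]])
        show "rep z i k = sh (- i) x' k" if "\<bar>k - j\<bar> \<le> int r" for k
        proof -
          have "0 \<le> k - i" "k - i < L" using that True by linarith+
          then show ?thesis using rep_in[of "k - i" z i] by (simp add: sh_apply)
        qed
      qed (use x'X sh_X in blast)
      also have "\<dots> = f (sh (- i) y') j" using endomorphism_sh[OF f(1)] x'X y'X fx'y' by simp
      also have "\<dots> = f z j"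
      proof (rule r)
        show "sh (- i) y' k = z k" if "\<bar>k - j\<bar> \<le> int r" for k
        proof -
          have "0 \<le> k - i" "k - i < L + int N" using that True by linarith+
          then show ?thesis using z(2)[unfolded occ_def, rule_format, of "k - i"] by (simp add: sh_apply)
        qed
      qed (use y'X sh_X z in blast)+
      finally show ?thesis .
    next
      case False
      show ?thesis
        by (rule r[OF rep_X[OF z] z(1)], rule rep_eq[OF z(2)]) (use False in auto)
    qed
  qed
  have xst: "states \<noteq> {}" using xy(1) st_in_states by blast
  have "\<exists>q l m. q \<in> X \<and> 0 \<le> l \<and> l + L \<le> m \<and> st q 0 = w \<and> st q m = w \<and> occ q l" if w: "w \<in> states" for w
  proof -
    obtain q l m where "q \<in> X" "0 \<le> l" "l + (L - 0) \<le> m" "st q 0 = w" "st q m = w"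
      "\<And>k. 0 \<le> k \<Longrightarrow> k < L - 0 + int N \<Longrightarrow> q (l + k) = y' (0 + k)"
      by (rule loop_through[OF y'X, of 0 L w]) (use irr[OF w] irr[OF _ w] st_in_states[OF y'X] L in auto)
    then show ?thesis unfolding occ_def by (intro exI[of _ q] exI[of _ l] exI[of _ m]) auto
  qed
  then obtain q0 l0 m0 where q0: "\<And>w. w \<in> states \<Longrightarrow> q0 w \<in> X \<and> 0 \<le> l0 w \<and> l0 w + L \<le> m0 w \<and>
      st (q0 w) 0 = w \<and> st (q0 w) (m0 w) = w \<and> occ (q0 w) (l0 w)" by metis
  \<comment> \<open>A common length for loops through \<open>y'\<close> at all states.\<close>
  define E where "E = (\<Prod>w\<in>states. m0 w)"
  have m0: "m0 w > 0" if "w \<in> states" for w using q0[OF that] L by linarith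
  have E: "E > 0" unfolding E_def using m0 by (rule prod_pos)
  have mE: "\<exists>n::nat. E = int n * m0 w \<and> m0 w \<le> E" if w: "w \<in> states" for w
  proof -
    have Ew: "E = (\<Prod>w\<in>states - {w}. m0 w) * m0 w"
      unfolding E_def using prod.remove[OF finite_states w, of m0] by (simp add: mult.commute)
    have pos: "(\<Prod>w\<in>states - {w}. m0 w) > 0" using m0 by (intro prod_pos) auto
    have "E = int (nat (\<Prod>w\<in>states - {w}. m0 w)) * m0 w" using Ew pos by simp
    moreover have "m0 w \<le> E" using Ew pos m0[OF w] by simp
    ultimately show ?thesis by blast
  qed
  have loopE: "\<exists>q l. q \<in> X \<and> 0 \<le> l \<and> l + L \<le> E \<and> st q 0 = w \<and> st q E = w \<and> occ q l" if w: "w \<in> states" for w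
  proof (intro exI conjI)
    let ?q = "per (m0 w) (q0 w)"
    have e: "st (q0 w) 0 = st (q0 w) (m0 w)" using q0[OF w] by simp
    show "?q \<in> X" using per_X[OF _ m0[OF w] e] q0[OF w] by blast
    show "0 \<le> l0 w" "l0 w + L \<le> E" using q0[OF w] mE[OF w] by auto
    show "st ?q 0 = w" "st ?q E = w" using win_per[OF m0[OF w] e] q0[OF w] mE[OF w] by auto
    show "occ ?q (l0 w)" unfolding occ_def
    proof (intro allI impI)
      fix k assume k: "0 \<le> k \<and> k < L + int N"
      have "?q (l0 w + k) = q0 w (l0 w + k)" by (rule per_eq[OF m0[OF w] e]) (use k q0[OF w] in auto)
      then show "?q (l0 w + k) = y' k" using q0[OF w] k unfolding occ_def by auto
    qed
  qed
  \<comment> \<open>\<open>len_shrink\<close> shortens any path of \<open>R\<close> steps by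
    \<open>E\<close>, and the gap is filled by a loop of length \<open>E\<close> that contains
    \<open>y'\<close>.\<close>
  define R where "R = nat (int (card states + 1) * E)"
  have R: "int R = int (card states + 1) * E" "int R = E + int (card states) * E"
    using E by (auto simp: R_def algebra_simps)
  have RE: "E \<le> int R" using R E by simp
  have "\<exists>z l. z \<in> X \<and> 0 \<le> l \<and> l + L \<le> int R \<and> st z 0 = w \<and> st z (int R) = w' \<and> occ z l"
    if ww': "len w (int R) w'" for w w'
  proof -
    have w: "w \<in> states" using ww' st_in_states unfolding len_def by blast
    obtain q l where q: "q \<in> X" "0 \<le> l" "l + L \<le> E" "st q 0 = w" "st q E = w" "occ q l" using loopE[OF w] by blast
    have "len w E w" using q unfolding len_def by blast
    then have "len w (int (card states) * E) w'" using len_shrink[OF E] ww' R(1) by simp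
    then obtain p where p: "p \<in> X" "st p 0 = w" "st p (int (card states) * E) = w'" unfolding len_def by blast
    have e: "st q E = st (sh (- E) p) E" using q p by (simp add: win_sh)
    let ?z = "glue E q (sh (- E) p)"
    have "?z \<in> X" using glue_X[OF q(1) _ e] p sh_X by blast
    moreover have "st ?z 0 = w" using win_glue_left[OF e, of 0] q E by simp
    moreover have "st ?z (int R) = w'" using win_glue_right[OF RE, of N q "sh (- E) p"] p R(2)
      by (simp add: win_sh algebra_simps)
    moreover have "occ ?z l" unfolding occ_def
    proof (intro allI impI)
      fix k assume k: "0 \<le> k \<and> k < L + int N"
      then have "?z (l + k) = q (l + k)" by (intro glue_left'[OF e]) (use q in auto)
      then show "?z (l + k) = y' k" using q(6) k unfolding occ_def by simp
    qed
    ultimately show ?thesis using q(2,3) RE by (intro exI[of _ ?z] exI[of _ l]) auto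
  qed
  then obtain bad off where bad: "\<And>w w'. len w (int R) w' \<Longrightarrow> bad w w' \<in> X \<and> 0 \<le> off w w' \<and>
      off w w' + L \<le> int R \<and> st (bad w w') 0 = w \<and> st (bad w w') (int R) = w' \<and> occ (bad w w') (off w w')"
    by metis
  \<comment> \<open>One forbidden block containing \<open>y'\<close> for each pair of end states
    joined by \<open>R\<close> steps.\<close>
  define B where "B = {win (R + N) (bad w w') 0 | w w'. len w (int R) w'}"
  let ?blk = "\<lambda>z j. win (R + N) z (int j * int R)"
  \<comment> \<open>A block in \<open>B\<close> is determined by its end states. Exchanging
    \<open>y'\<close> for \<open>x'\<close> keeps the ends but alters the block, and therefore leads
    out of \<open>B\<close>.\<close>
  have B_ends: "?blk z j = win (R + N) (bad (st z (int j * int R)) (st z (int j * int R + int R))) 0"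
    if zB: "?blk z j \<in> B" for z j
  proof -
    obtain w w' where ww': "len w (int R) w'" "?blk z j = win (R + N) (bad w w') 0" using zB B_def by auto
    have "st z (int j * int R) = w"
      using take_letter[of R z "int j * int R"] take_letter[of R "bad w w'" 0] ww' bad[OF ww'(1)] by simp
    moreover have "st z (int j * int R + int R) = w'"
      using drop_letter[of R z "int j * int R"] drop_letter[of R "bad w w'" 0] ww' bad[OF ww'(1)] by simp
    ultimately show ?thesis using ww' by simp
  qed
  have fix_block: "\<exists>z'\<in>X. f z' = f z \<and> ?blk z' j \<notin> B \<and> (\<forall>j'. j' \<noteq> j \<longrightarrow> ?blk z' j' = ?blk z j')"
    if z: "z \<in> X" "?blk z j \<in> B" for z j
  proof -
    let ?c = "int j * int R"
    let ?w = "st z ?c" and ?w' = "st z (?c + int R)"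
    have ln: "len ?w (int R) ?w'" using len_window[OF z(1), of ?c "?c + int R"] by simp
    note b = bad[OF ln]
    let ?i = "?c + off ?w ?w'"
    have occz: "occ z ?i" unfolding occ_def
    proof (intro allI impI)
      fix k assume k: "0 \<le> k \<and> k < L + int N"
      have "z (?c + (off ?w ?w' + k)) = bad ?w ?w' (0 + (off ?w ?w' + k))"
        using B_ends[OF z(2)] unfolding win_eq_iff by (rule allE[of _ "off ?w ?w' + k"]) (use k b in auto)
      then show "z (?i + k) = y' k" using b k unfolding occ_def by (simp add: add.assoc)
    qed
    let ?z' = "rep z ?i"
    \<comment> \<open>The exchange leaves the two end windows of the block intact, and these are all
      that the block shares with its neighbors.\<close>
    have same: "?z' k = z k" if "k < ?c + int N \<or> ?c + int R \<le> k" for k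
      by (rule rep_eq[OF occz]) (use that b in auto)
    have sts: "st ?z' ?c = ?w" "st ?z' (?c + int R) = ?w'" by (rule win_cong, rule same, force)+
    have "?blk ?z' j \<notin> B"
    proof
      assume zB: "?blk ?z' j \<in> B"
      have "?blk ?z' j = ?blk z j" using B_ends[OF zB] B_ends[OF z(2)] sts by simp
      then have eqz: "?z' k = z k" if "?c \<le> k" "k < ?c + int R + int N" for k
        using that unfolding win_eq_Ico by auto
      have "x' k = y' k" for k
      proof (cases "0 \<le> k \<and> k < L")
        case True
        have "x' k = ?z' (?i + k)" using rep_in[of k z ?i] True by simp
        also have "\<dots> = z (?i + k)" by (rule eqz) (use True b in auto)
        also have "\<dots> = y' k" using occz True unfolding occ_def by auto
        finally show ?thesis .
      qed (use x'y' in auto)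
      then show False using ne' by blast
    qed
    moreover have "?blk ?z' j' = ?blk z j'" if "j' \<noteq> j" for j'
    proof (rule win_cong, rule same)
      fix k assume k: "int j' * int R \<le> k" "k < int j' * int R + int (R + N)"
      show "k < ?c + int N \<or> ?c + int R \<le> k"
      proof (cases "j' < j")
        case True
        then have "int (j' + 1) * int R \<le> ?c" by (intro mult_right_mono) auto
        then show ?thesis using k by (simp add: algebra_simps)
      next
        case False
        then have "int (j + 1) * int R \<le> int j' * int R" using that by (intro mult_right_mono) auto
        then show ?thesis using k by (simp add: algebra_simps)
      qed
    qed
    ultimately show ?thesis using rep_X[OF z(1) occz] f_rep[OF z(1) occz] by blast
  qed
  have clean: "\<exists>z'\<in>X. f z' = f z \<and> (\<forall>j<k. ?blk z' j \<notin> B)" if z: "z \<in> X" for z k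
  proof (induction k)
    case 0 then show ?case using z by auto
  next
    case (Suc k)
    then obtain z1 where z1: "z1 \<in> X" "f z1 = f z" "\<forall>j<k. ?blk z1 j \<notin> B" by blast
    show ?case
    proof (cases "?blk z1 k \<in> B")
      case True
      then obtain z2 where z2: "z2 \<in> X" "f z2 = f z1" "?blk z2 k \<notin> B" "\<forall>j. j \<noteq> k \<longrightarrow> ?blk z2 j = ?blk z1 j"
        using fix_block[OF z1(1) True] by blast
      have "?blk z2 j \<notin> B" if "j < Suc k" for j
        using z2(3,4) z1(3) that by (cases "j = k") auto
      then show ?thesis using z2 z1 by auto
    next
      case False
      then show ?thesis using z1 less_Suc_eq by auto
    qed
  qed
  let ?T = "letters R"
  let ?ch = "chains (take N) (drop R)"
  let ?F = "\<lambda>k. \<Sum>v\<in>states. card (?ch ?T k v)" and ?G = "\<lambda>k. \<Sum>v\<in>states. card (?ch (?T - B) k v)"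
  \<comment> \<open>The possible pairs of words of length \<open>r\<close> on the two sides of
    \<open>k\<close> blocks, on which the image of these blocks also depends.\<close>
  let ?P = "\<lambda>k. ((\<lambda>z. win r z (- int r)) ` X) \<times> ((\<lambda>z. win r z (int k * int R + int N)) ` X)"
  define C where "C = card {w. set w \<subseteq> A \<and> length w = r} ^ 2"
  have finw: "finite {w. set w \<subseteq> A \<and> length w = r}" using finite_lists_length_eq[OF finite_A] .
  have cardP: "card (?P k) \<le> C" for k
  proof -
    have "(\<lambda>x. win r x i) ` X \<subseteq> {w. set w \<subseteq> A \<and> length w = r}" for i
      using X_topspace unfolding topspace_full_shift win_def by fastforce
    then have "card ((\<lambda>x. win r x i) ` X) \<le> card {w. set w \<subseteq> A \<and> length w = r}" for i
      by (rule card_mono[OF finw])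
    from mult_le_mono[OF this this] show ?thesis
      unfolding C_def card_cartesian_product power2_eq_square .
  qed
  \<comment> \<open>Each path of letters is read from some \<open>f z\<close>, where
    \<open>z\<close> can be chosen with its first \<open>k\<close> blocks outside \<open>B\<close>.
    The blocks of \<open>z\<close> together with the \<open>r\<close> symbols on either side
    determine those of \<open>f z\<close>, so this encoding of paths is injective.\<close>
  have FG: "?F k \<le> C * ?G k" for k
  proof -
    let ?D = "Sigma states (?ch ?T k)" and ?I = "Sigma states (?ch (?T - B) k) \<times> ?P k"
    have "\<forall>d\<in>?D. \<exists>z. z \<in> X \<and> (\<forall>j<k. ?blk z j \<notin> B) \<and> st (f z) 0 = fst d \<and> blocks R (f z) k = snd d"
    proof
      fix d assume d: "d \<in> ?D"
      then have "fst d \<in> states" "snd d \<in> ?ch ?T k (fst d)" by (cases d; simp)+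
      from chains_realized[OF this] obtain z where z: "z \<in> X" "st z 0 = fst d" "blocks R z k = snd d"
        by blast
      have "z \<in> f ` X" unfolding f(2) by (rule z(1))
      then obtain z1 where z1: "z1 \<in> X" "f z1 = z" by auto
      obtain z2 where "z2 \<in> X" "f z2 = f z1" "\<forall>j<k. ?blk z2 j \<notin> B" using clean[OF z1(1)] by blast
      then show "\<exists>z. z \<in> X \<and> (\<forall>j<k. ?blk z j \<notin> B) \<and> st (f z) 0 = fst d \<and> blocks R (f z) k = snd d"
        using z z1 by auto
    qed
    then obtain \<zeta> where \<zeta>: "\<And>d. d \<in> ?D \<Longrightarrow> \<zeta> d \<in> X \<and> (\<forall>j<k. ?blk (\<zeta> d) j \<notin> B) \<and>
        st (f (\<zeta> d)) 0 = fst d \<and> blocks R (f (\<zeta> d)) k = snd d" by metis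
    let ?h = "\<lambda>d. ((st (\<zeta> d) 0, blocks R (\<zeta> d) k), win r (\<zeta> d) (- int r), win r (\<zeta> d) (int k * int R + int N))"
    have "?h ` ?D \<subseteq> ?I"
    proof
      fix e assume "e \<in> ?h ` ?D"
      then obtain d where d: "d \<in> ?D" "e = ?h d" by blast
      have zX: "\<zeta> d \<in> X" using \<zeta>[OF d(1)] by blast
      have "blocks R (\<zeta> d) k \<in> ?ch (?T - B) k (st (\<zeta> d) 0)"
      proof (rule blocks_in_chains[OF zX])
        show "?blk (\<zeta> d) j \<in> ?T - B" if "j < k" for j
          using \<zeta>[OF d(1)] that win_in_letters[OF zX] by blast
      qed
      then show "e \<in> ?I" unfolding d(2) using st_in_states[OF zX] zX by blast
    qed
    moreover have "inj_on ?h ?D"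
    proof (rule inj_onI)
      fix d e assume d: "d \<in> ?D" and e: "e \<in> ?D" and de: "?h d = ?h e"
      have w1: "win r (\<zeta> d) (- int r) = win r (\<zeta> e) (- int r)"
        and w2: "win r (\<zeta> d) (int k * int R + int N) = win r (\<zeta> e) (int k * int R + int N)"
        and w3: "st (\<zeta> d) 0 = st (\<zeta> e) 0" "blocks R (\<zeta> d) k = blocks R (\<zeta> e) k" using de by auto
      have eq: "\<zeta> d i = \<zeta> e i" if "- int r \<le> i" "i < int k * int R + int N + int r" for i
      proof -
        consider "i < 0" | "0 \<le> i" "i < int k * int R + int N" | "int k * int R + int N \<le> i" by linarith
        then show ?thesis
        proof cases
          case 1 then show ?thesis using w1 that unfolding win_eq_Ico by auto
        next
          case 2 then show ?thesis using blocks_determine[OF w3] by blast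
        next
          case 3 then show ?thesis using w2 that unfolding win_eq_Ico by auto
        qed
      qed
      have feq: "f (\<zeta> d) i = f (\<zeta> e) i" if "0 \<le> i" "i < int k * int R + int N" for i
        by (rule r) (use \<zeta>[OF d] \<zeta>[OF e] eq that in auto)
      have "st (f (\<zeta> d)) 0 = st (f (\<zeta> e)) 0"
        by (rule win_cong, rule feq) (use mult_nonneg_nonneg[of "int k" "int R"] in linarith)+
      moreover have "blocks R (f (\<zeta> d)) k = blocks R (f (\<zeta> e)) k"
        unfolding blocks_def
      proof (rule map_cong)
        fix j assume j: "j \<in> set [0..<k]"
        then have "int (j + 1) * int R \<le> int k * int R" by (intro mult_right_mono) auto
        then have le: "int j * int R + int R \<le> int k * int R" by (simp add: algebra_simps)
        show "?blk (f (\<zeta> d)) j = ?blk (f (\<zeta> e)) j"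
          by (rule win_cong, rule feq) (use le mult_nonneg_nonneg[of "int j" "int R"] in linarith)+
      qed simp
      ultimately show "d = e" using \<zeta>[OF d] \<zeta>[OF e] by (metis prod_eqI)
    qed
    moreover have finI: "finite ?I"
      using finite_states finite_letters finite_chains finite_words_X
      by (intro finite_cartesian_product finite_SigmaI finite_chains finite_Diff) auto
    ultimately have "card ?D \<le> card ?I" using card_inj_on_le by blast
    moreover have "card ?D = ?F k"
      by (rule card_SigmaI[OF finite_states]) (rule ballI, rule finite_chains[OF finite_letters])
    moreover have "finite (?T - B)" using finite_letters by blast
    then have "card (Sigma states (?ch (?T - B) k)) = ?G k"
      by (intro card_SigmaI[OF finite_states] ballI finite_chains)
    ultimately have "?F k \<le> ?G k * card (?P k)" by (simp add: card_cartesian_product)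
    also have "\<dots> \<le> ?G k * C" using cardP by (intro mult_le_mono2)
    finally show ?thesis by (simp add: mult.commute)
  qed
  have bad_letter: "\<exists>b\<in>B \<inter> ?T. take N b = take N c \<and> drop R b = drop R c" if c: "c \<in> ?T" for c
  proof -
    obtain z where z: "z \<in> X" "c = win (R + N) z 0" using c letters_def by auto
    have ln: "len (st z 0) (int R) (st z (int R))" using len_window[OF z(1), of 0 "int R"] by simp
    let ?b = "win (R + N) (bad (st z 0) (st z (int R))) 0"
    have "?b \<in> B \<inter> ?T" using ln bad[OF ln] win_in_letters unfolding B_def by blast
    moreover have "take N ?b = take N c" "drop R ?b = drop R c"
      unfolding z(2) take_letter drop_letter using bad[OF ln] by auto
    ultimately show ?thesis by blast
  qed
  let ?M = "card ?T"
  have "?M ^ k \<le> C * (?M - 1) ^ k" for k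
  proof -
    have "?M ^ k * ?F k \<le> C * (?M ^ k * ?G k)" using FG[of k] by (simp add: mult.left_commute)
    also have "?M ^ k * ?G k \<le> (?M - 1) ^ k * ?F k"
      unfolding sum_distrib_left
      by (intro sum_mono card_chains_avoiding[OF finite_letters]) (use bad_letter in blast)
    finally have le: "?M ^ k * ?F k \<le> C * (?M - 1) ^ k * ?F k" by (simp add: mult.assoc)
    \<comment> \<open>The blocks of \<open>x\<close> form a path, so the common factor
      \<open>?F k\<close> is positive and can be cancelled.\<close>
    have "blocks R x k \<in> ?ch ?T k (st x 0)"
      by (rule blocks_in_chains[OF xy(1)]) (rule win_in_letters[OF xy(1)])
    then have "?ch ?T k (st x 0) \<noteq> {}" by auto
    then have "card (?ch ?T k (st x 0)) > 0"
      by (simp only: card_gt_0_iff finite_chains[OF finite_letters] simp_thms)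
    also have "card (?ch ?T k (st x 0)) \<le> ?F k"
      by (rule member_le_sum[OF st_in_states[OF xy(1)] _ finite_states]) simp
    finally show ?thesis using le by simp
  qed
  moreover have "?M > 0" using win_in_letters[OF xy(1)] finite_letters by (auto simp: card_gt_0_iff)
  ultimately show False using exponential_beats_constant by blast
qed

end

section \<open>The Moore property\<close>

context window_shift begin

lemma Comp_irreducible_moore:
  assumes u: "recurrent u" and f: "endomorphism A (Comp u) f" "f ` Comp u = Comp u"
    and xy: "x \<in> Comp u" "y \<in> Comp u" "homoclinic x y" "f x = f y"
  shows "x = y"
proof -
  interpret C: window_shift A N "S \<inter> {w. mutual u w}" "Comp u" by (rule Comp_window)
  show ?thesis
  proof (rule C.irreducible_moore[OF _ f xy])
    fix v w assume "v \<in> C.states" "w \<in> C.states"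
    then have vw: "mutual u v" "mutual u w" unfolding C.states_def by (auto simp: Comp_def)
    then have "reach v w" using reach_trans unfolding mutual_def by blast
    then obtain p n where p: "p \<in> X" "0 \<le> n" "st p 0 = v" "st p n = w" by (rule reachE)
    \<comment> \<open>A path of \<open>X\<close> between states of the class is copied into the
      component by a periodic point.\<close>
    then obtain z where z: "z \<in> Comp u" "\<forall>k. 0 \<le> k \<and> k \<le> n \<longrightarrow> st z k = st p k"
      using periodic_approx[OF u p(1,2)] vw by auto
    then show "C.reach v w" using C.reachI[OF z(1) p(2)] p by auto
  qed
qed

lemma endo_restrict:
  assumes f: "endomorphism A X f" and Y: "Y \<subseteq> X" "Z \<subseteq> X" "f ` Y \<subseteq> Z"
  shows "continuous_map (shift_top A Y) (shift_top A Z) f"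
proof -
  have Yt: "Y \<subseteq> topspace (full_shift A)" "Z \<subseteq> topspace (full_shift A)" using Y X_topspace by auto
  have "\<forall>x\<in>X. \<forall>i. \<exists>m. \<forall>y\<in>X. agree m x y \<longrightarrow> f y i = f x i"
    using f unfolding endomorphism_def continuous_map_shift_top[OF X_topspace X_topspace] by blast
  then have "\<forall>x\<in>Y. \<forall>i. \<exists>m. \<forall>y\<in>Y. agree m x y \<longrightarrow> f y i = f x i" using Y(1) by (meson subsetD)
  moreover have "f \<in> Y \<rightarrow> Z" using Y(3) by auto
  ultimately show ?thesis unfolding continuous_map_shift_top[OF Yt] by blast
qed

text \<open>Images of periodic points are periodic, and the periodic points are dense in the closed
  set \<open>NW A X\<close>.\<close>

lemma endo_NW: assumes f: "endomorphism A X f" and x: "x \<in> NW A X" shows "f x \<in> NW A X"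
proof -
  have xX: "x \<in> X" using x NW_subset by blast
  have "\<exists>y\<in>NW A X. agree m (f x) y" for m
  proof -
    obtain k where k: "\<forall>y\<in>X. agree k x y \<longrightarrow> agree m (f x) (f y)" using endo_uniform[OF f xX] by blast
    obtain z p where z: "z \<in> NW A X" "p > 0" "sh p z = z" "agree k x z"
      using periodic_dense_NW[OF x] by blast
    have zX: "z \<in> X" using z(1) NW_subset by blast
    have "sh p (f z) = f z" using endomorphism_sh[OF f zX, of p] z(3) by simp
    then have "f z \<in> NW A X" using periodic_NW[of "f z" p] endomorphism_into[OF X_topspace f zX] z(2) by auto
    then show ?thesis using k zX z(4) by blast
  qed
  then show ?thesis
    using closed_NW endomorphism_into[OF X_topspace f xX] X_topspace unfolding closedin_full_shift by blast
qed

lemma endo_pow: assumes f: "endomorphism A X f" shows "endomorphism A X (f ^^ n)"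
proof (induction n)
  case 0 then show ?case by (simp add: endomorphism_def)
next
  case (Suc n)
  have "continuous_map (shift_top A X) (shift_top A X) (f \<circ> (f ^^ n))"
    using Suc f continuous_map_compose unfolding endomorphism_def by blast
  moreover have "\<forall>x\<in>X. (f ^^ Suc n) (shift x) = shift ((f ^^ Suc n) x)"
    using Suc f endomorphism_into[OF X_topspace Suc] unfolding endomorphism_def by simp
  ultimately show ?case by (simp add: endomorphism_def comp_def)
qed

lemma low_poset_moore:
  assumes low: "low_poset" shows "moore A X"
  unfolding moore_def
proof (intro allI impI, elim conjE)
  fix \<tau> assume \<tau>: "endomorphism A X \<tau>" and surj: "\<tau> ` X = X"
  note into = endomorphism_into[OF X_topspace \<tau>]
  have pre: "\<exists>y\<in>X. \<tau> y = x" if "x \<in> X" for x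
  proof -
    have "x \<in> \<tau> ` X" unfolding surj by (rule that)
    then show ?thesis by auto
  qed
  let ?W = "X - NW A X"
  let ?O = "orbit ` ?W"
  \<comment> \<open>Preimages of transient points are transient by \<open>endo_NW\<close>. So every
    transient orbit is the image of a transient orbit, and the choice \<open>G\<close> of one is an
    injection of a finite set into itself, hence a bijection.\<close>
  have "\<exists>o2\<in>?O. \<tau> ` o2 = o1" if o1: "o1 \<in> ?O" for o1
  proof -
    obtain w where w: "w \<in> ?W" "o1 = orbit w" using o1 by blast
    then obtain y where y: "y \<in> X" "\<tau> y = w" using pre by blast
    then have "y \<in> ?W" using endo_NW[OF \<tau>] w by blast
    then show ?thesis using endo_orbit[OF \<tau> y(1)] y(2) w(2) by blast
  qed
  then obtain G where G: "\<And>o1. o1 \<in> ?O \<Longrightarrow> G o1 \<in> ?O \<and> \<tau> ` G o1 = o1" by metis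
  have Gsub: "G ` ?O \<subseteq> ?O" by (rule image_subsetI) (use G in blast)
  have Ginj: "inj_on G ?O" by (rule inj_onI) (metis G)
  have GO: "G ` ?O = ?O" by (rule endo_inj_surj[OF finite_transient_orbits[OF low] Gsub Ginj])
  have orb: "\<tau> ` orbit x \<in> ?O \<and> G (\<tau> ` orbit x) = orbit x" if "x \<in> ?W" for x
  proof -
    have "orbit x \<in> ?O" using that by blast
    then have "orbit x \<in> G ` ?O" unfolding GO .
    then obtain o1 where "o1 \<in> ?O" "orbit x = G o1" by (rule imageE)
    then show ?thesis using G by metis
  qed
  have tW: "\<tau> x \<in> ?W" if x: "x \<in> ?W" for x
  proof -
    have "\<tau> ` orbit x \<in> ?O" using orb[OF x] by blast
    then obtain w where w: "w \<in> ?W" "\<tau> ` orbit x = orbit w" by blast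
    have "\<tau> x \<in> orbit w" using w(2) self_orbit[of x] by blast
    then show ?thesis using orbit_transient[OF w(1)] by blast
  qed
  \<comment> \<open>Equal images force equal orbits, say \<open>y = sh n x\<close>. Then
    \<open>\<tau> x\<close> is fixed by \<open>sh n\<close>, which for a transient point means
    \<open>n = 0\<close>.\<close>
  have injW: "x = y" if x: "x \<in> ?W" and y: "y \<in> ?W" and eq: "\<tau> x = \<tau> y" for x y
  proof -
    have "\<tau> ` orbit x = \<tau> ` orbit y" using endo_orbit[OF \<tau>] x y eq by (metis DiffD1)
    then have "orbit x = orbit y" using orb[OF x] orb[OF y] by metis
    then have "y \<in> orbit x" using self_orbit by blast
    then obtain n where n: "y = sh n x" unfolding orbit_def by blast
    then have "sh n (\<tau> x) = \<tau> x" using endomorphism_sh[OF \<tau>] x eq by simp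
    then have "n = 0" using periodic_NW[of "\<tau> x" n] tW[OF x] by blast
    then show ?thesis using n by simp
  qed
  have NWpre: "\<exists>y\<in>NW A X. \<tau> y = x" if "x \<in> NW A X" for x
    using pre[of x] that NW_subset tW by blast
  have compD: "\<exists>D\<in>comps. \<tau> ` C \<subseteq> D" if C: "C \<in> comps" for C
  proof (rule irreducible_image_in_piece[where Z = "NW A X"])
    show "irreducible_subshift A C" using C Comp_irreducible unfolding comps_def by blast
    have CNW: "C \<subseteq> NW A X" using C Comp_NW unfolding comps_def by blast
    then show "continuous_map (shift_top A C) (shift_top A (NW A X)) \<tau>"
      using endo_restrict[OF \<tau>] NW_subset endo_NW[OF \<tau>] by (metis dual_order.trans image_subsetI subsetD)
    show "\<tau> (shift x) = shift (\<tau> x)" if "x \<in> C" for x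
      using that CNW NW_subset \<tau> unfolding endomorphism_def by blast
    show "subshift A D" if "D \<in> comps" for D
      using that window_shift.subshift_X[OF Comp_window] unfolding comps_def by blast
    show "disjoint comps" "NW A X \<subseteq> \<Union>comps" using partition_comps by (auto simp: partition_on_def)
  qed (use finite_comps NW_subset X_topspace in auto)
  then obtain \<pi> where \<pi>: "\<And>C. C \<in> comps \<Longrightarrow> \<pi> C \<in> comps \<and> \<tau> ` C \<subseteq> \<pi> C" by metis
  have disj: "C = D" if "C \<in> comps" "D \<in> comps" "x \<in> C" "x \<in> D" for C D x
    using partition_onD2[OF partition_comps] that unfolding disjoint_def by blast
  have inNW: "\<exists>C\<in>comps. x \<in> C" if "x \<in> NW A X" for x
    using that partition_comps by (auto simp: partition_on_def)
  have comp_ne: "\<exists>x. x \<in> C \<and> x \<in> NW A X" if "C \<in> comps" for C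
    using that partition_comps Comp_NW Comp_nonempty unfolding comps_def by blast
  have pre_comp: "\<exists>C\<in>comps. \<exists>y\<in>C. \<tau> y = d \<and> \<pi> C = D" if D: "D \<in> comps" "d \<in> D" for D d
  proof -
    have "d \<in> NW A X" using D Comp_NW unfolding comps_def by blast
    then obtain y where y: "y \<in> NW A X" "\<tau> y = d" using NWpre by blast
    obtain C where C: "C \<in> comps" "y \<in> C" using inNW[OF y(1)] by blast
    have "\<pi> C = D" using disj[of "\<pi> C" D d] \<pi>[OF C(1)] C(2) y(2) D by blast
    then show ?thesis using C y by blast
  qed
  \<comment> \<open>A surjection of the finite set of components is a permutation, which turns the
    inclusions of images into equalities.\<close>
  have "comps \<subseteq> \<pi> ` comps" using pre_comp comp_ne by blast
  then have \<pi>inj: "inj_on \<pi> comps"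
    using finite_comps \<pi> by (metis finite_surj_inj image_subsetI)
  have \<tau>\<pi>: "\<tau> ` C = \<pi> C" if C: "C \<in> comps" for C
  proof
    show "\<pi> C \<subseteq> \<tau> ` C"
    proof
      fix d assume "d \<in> \<pi> C"
      then obtain C' y where "C' \<in> comps" "y \<in> C'" "\<tau> y = d" "\<pi> C' = \<pi> C"
        using pre_comp \<pi>[OF C] by metis
      then show "d \<in> \<tau> ` C" using \<pi>inj C by (metis inj_onD image_eqI)
    qed
  qed (use \<pi> C in blast)
  have \<pi>pow: "(\<pi> ^^ n) C \<in> comps \<and> (\<tau> ^^ n) ` C = (\<pi> ^^ n) C" if C: "C \<in> comps" for C n
  proof (induction n)
    case (Suc n)
    have "(\<tau> ^^ Suc n) ` C = \<tau> ` ((\<tau> ^^ n) ` C)" by (simp add: image_image)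
    also have "\<dots> = \<tau> ` ((\<pi> ^^ n) C)" using Suc by simp
    also have "\<dots> = \<pi> ((\<pi> ^^ n) C)" using \<tau>\<pi> Suc by blast
    finally show ?case using Suc \<pi> by simp
  qed (use C in simp)
  \<comment> \<open>A power of \<open>\<tau>\<close> thus maps a given component onto itself, and
    the irreducible case applies to this power.\<close>
  have period: "\<exists>n>0. (\<pi> ^^ n) C = C" if C: "C \<in> comps" for C
  proof -
    have "range (\<lambda>n. (\<pi> ^^ n) C) \<subseteq> comps" using \<pi>pow[OF C] by blast
    then have "\<not> inj (\<lambda>n. (\<pi> ^^ n) C)" using finite_comps finite_subset range_inj_infinite by blast
    then obtain i j where "i \<noteq> j" "(\<pi> ^^ i) C = (\<pi> ^^ j) C" unfolding inj_def by blast
    then obtain i j where ij: "i < j" "(\<pi> ^^ i) C = (\<pi> ^^ j) C" by (metis linorder_neqE_nat)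
    have "(\<pi> ^^ (j - i)) C = C" using ij
    proof (induction i arbitrary: j)
      case (Suc i)
      obtain j' where j': "j = Suc j'" using Suc.prems(1) by (cases j) auto
      have "\<pi> ((\<pi> ^^ i) C) = \<pi> ((\<pi> ^^ j') C)" using Suc.prems(2) j' by simp
      then have "(\<pi> ^^ i) C = (\<pi> ^^ j') C" using \<pi>inj \<pi>pow[OF C] by (meson inj_onD)
      then show ?case using Suc.IH[of j'] Suc.prems(1) j' by simp
    qed simp
    then show ?thesis using ij(1) by (intro exI[of _ "j - i"]) simp
  qed
  show "pre_injective X \<tau>"
    unfolding pre_injective_def
  proof (intro ballI inj_onI)
    fix x0 x y
    assume "x0 \<in> X" and x: "x \<in> {y \<in> X. homoclinic x0 y}" and y: "y \<in> {y \<in> X. homoclinic x0 y}"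
      and eq: "\<tau> x = \<tau> y"
    have "{i. x i \<noteq> y i} \<subseteq> {i. x0 i \<noteq> x i} \<union> {i. x0 i \<noteq> y i}" by auto
    then have hom: "homoclinic x y"
      using x y finite_subset unfolding homoclinic_def by (metis (no_types, lifting) finite_UnI mem_Collect_eq)
    have xX: "x \<in> X" and yX: "y \<in> X" using x y by auto
    show "x = y"
    proof (cases "x \<in> NW A X")
      case False
      then have "\<tau> x \<in> ?W" using tW xX by blast
      then have "y \<notin> NW A X" using eq endo_NW[OF \<tau>] by auto
      then show ?thesis using injW[of x y] False xX yX eq by blast
    next
      case True
      have yN: "y \<in> NW A X"
      proof (rule ccontr)
        assume "y \<notin> NW A X"
        then have "\<tau> y \<in> ?W" using tW yX by blast
        then show False using eq endo_NW[OF \<tau> True] by auto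
      qed
      have "finite (abs ` {i. x i \<noteq> y i})" using hom by (simp add: homoclinic_def)
      then have "\<exists>M. \<forall>i. x i \<noteq> y i \<longrightarrow> \<bar>i\<bar> \<le> M"
        using Max_ge[of "abs ` {i. x i \<noteq> y i}"] by blast
      then obtain M where M: "\<And>i. x i \<noteq> y i \<Longrightarrow> \<bar>i\<bar> \<le> M" by blast
      let ?j = "\<bar>M\<bar> + 1"
      have stj: "st x ?j = st y ?j"
      proof (rule win_cong, rule ccontr)
        fix k assume "?j \<le> k" "x k \<noteq> y k"
        then show False using M[of k] by linarith
      qed
      \<comment> \<open>To the right of all differences both points show the same window; being
        non-wandering, they lie in the same component.\<close>
      define u where "u = st x ?j"
      have u: "recurrent u" "x \<in> Comp u" "y \<in> Comp u"
        using NW_recurrent[OF True, of ?j] NW_Comp[OF True, of ?j] NW_Comp[OF yN, of ?j] stj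
        unfolding u_def by (simp_all only:)
      have C: "Comp u \<in> comps" using u(1) comps_def by blast
      obtain n where n: "n > 0" "(\<pi> ^^ n) (Comp u) = Comp u" using period[OF C] by blast
      have im: "(\<tau> ^^ n) ` Comp u = Comp u" using \<pi>pow[OF C] n(2) by blast
      have "endomorphism A (Comp u) (\<tau> ^^ n)"
        unfolding endomorphism_def
      proof
        show "continuous_map (shift_top A (Comp u)) (shift_top A (Comp u)) (\<tau> ^^ n)"
          by (rule endo_restrict[OF endo_pow[OF \<tau>] Comp_subset Comp_subset]) (simp only: im order_refl)
        show "\<forall>x\<in>Comp u. (\<tau> ^^ n) (shift x) = shift ((\<tau> ^^ n) x)"
          using endo_pow[OF \<tau>, of n] Comp_subset unfolding endomorphism_def by blast
      qed
      moreover have "(\<tau> ^^ n) x = (\<tau> ^^ n) y"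
        using n(1) eq by (cases n) (simp_all add: funpow_swap1)
      ultimately show ?thesis using Comp_irreducible_moore[OF u(1) _ im u(2,3) hom] by blast
    qed
  qed
qed

end

section \<open>Cantor-Bendixson rank and perfect kernel\<close>

text \<open>The hypotheses say that \<open>U\<close> equals its derived set, and a non-empty perfect
  set in a completely metrizable space has at least the cardinality of the continuum.\<close>

lemma perfect_uncountable:
  assumes U: "U \<subseteq> topspace (full_shift A)" "U \<noteq> {}"
    and cl: "\<And>x. x \<in> topspace (full_shift A) \<Longrightarrow> (\<And>m. \<exists>y\<in>U. agree m x y) \<Longrightarrow> x \<in> U"
    and acc: "\<And>x m. x \<in> U \<Longrightarrow> \<exists>y\<in>U. y \<noteq> x \<and> agree m x y"
  shows "uncountable U"
proof
  assume c: "countable U"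
  let ?T = "full_shift A"
  have "shift_top A (topspace ?T) derived_set_of U = {x \<in> topspace ?T. \<forall>m. \<exists>y\<in>U \<inter> topspace ?T. y \<noteq> x \<and> agree m x y}"
    by (rule derived_set_shift_top) simp
  then have "?T derived_set_of U = {x \<in> topspace ?T. \<forall>m. \<exists>y\<in>U \<inter> topspace ?T. y \<noteq> x \<and> agree m x y}" by simp
  also have "\<dots> = U"
  proof
    show "{x \<in> topspace ?T. \<forall>m. \<exists>y\<in>U \<inter> topspace ?T. y \<noteq> x \<and> agree m x y} \<subseteq> U" using cl by blast
    show "U \<subseteq> {x \<in> topspace ?T. \<forall>m. \<exists>y\<in>U \<inter> topspace ?T. y \<noteq> x \<and> agree m x y}" using acc U by blast
  qed
  finally have d: "?T derived_set_of U = U" .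
  have "completely_metrizable_space ?T"
    unfolding full_shift_def completely_metrizable_space_product_topology
    by (auto simp: completely_metrizable_space_discrete_topology)
  then have "(UNIV :: real set) \<lesssim> U" using lepoll_perfect_set d U(2) by blast
  then show False using c countable_lepoll uncountable_UNIV_real by blast
qed

lemma perfect_in_shift_top:
  assumes "X \<subseteq> topspace (full_shift A)"
  shows "perfect_in (shift_top A X) P \<longleftrightarrow> closedin (shift_top A X) P \<and> (\<forall>x\<in>P. \<forall>m. \<exists>y\<in>P. y \<noteq> x \<and> agree m x y)"
proof -
  have "openin (subtopology (shift_top A X) P) {x} \<longleftrightarrow> (\<exists>m. \<forall>y\<in>P. agree m x y \<longrightarrow> y = x)"
    if P: "P \<subseteq> X" "x \<in> P" for x
  proof -
    have "P \<subseteq> topspace (full_shift A)" using P(1) assms by blast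
    from openin_shift_top[OF this, of "{x}"] show ?thesis
      using P by (simp add: subtopology_subtopology Int_absorb1)
  qed
  moreover have "P \<subseteq> X" if "closedin (shift_top A X) P" using closedin_subset[OF that] by simp
  ultimately show ?thesis unfolding perfect_in_def by blast
qed

text \<open>Within \<open>S\<close>, an isolated point is determined by an isolating radius and the
  word it shows in that range, and there are countably many such pairs.\<close>

lemma countable_isolated:
  assumes fin: "finite A" and S: "S \<subseteq> topspace (full_shift A)"
  shows "countable {x \<in> S. \<exists>m. \<forall>y\<in>S. agree m x y \<longrightarrow> y = x}" (is "countable ?I")
proof -
  have "\<forall>x\<in>?I. \<exists>m. \<forall>y\<in>S. agree m x y \<longrightarrow> y = x" by blast
  from bchoice[OF this] obtain m where "\<forall>x\<in>?I. \<forall>y\<in>S. agree (m x) x y \<longrightarrow> y = x" by (elim exE)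
  then have m: "\<And>x y. x \<in> ?I \<Longrightarrow> y \<in> S \<Longrightarrow> agree (m x) x y \<Longrightarrow> y = x" by blast
  let ?f = "\<lambda>x. (m x, win (2 * m x + 1) x (- int (m x)))"
  have "inj_on ?f ?I"
  proof (rule inj_onI)
    fix x y assume x: "x \<in> ?I" and y: "y \<in> ?I" and e: "?f x = ?f y"
    have "m x = m y" using e by simp
    then have "win (2 * m x + 1) x (- int (m x)) = win (2 * m x + 1) y (- int (m x))"
      using e by (metis prod.inject)
    then have "agree (m x) x y" unfolding win_eq_Ico agree_def by (simp add: abs_le_iff)
    then show "x = y" using m[OF x] y by blast
  qed
  moreover have "win L x i \<in> lists A" if "x \<in> S" for x L i
    using subsetD[OF S that] by (auto simp: win_def topspace_full_shift)
  then have "?f ` ?I \<subseteq> UNIV \<times> lists A" by auto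
  moreover have "countable (UNIV \<times> lists A :: (nat \<times> 'a list) set)"
    using countable_lists[OF countable_finite[OF fin]] by simp
  ultimately show ?thesis using countable_subset countable_image_inj_on by blast
qed

text \<open>Uniqueness: if a perfect \<open>P\<close> had a point outside a closed \<open>Q\<close>,
  the trace on \<open>P\<close> of a cylinder that misses \<open>Q\<close> would be perfect, hence
  uncountable, and contained in \<open>X - Q\<close>.\<close>

lemma perfect_kernel_shift_top:
  assumes X: "closedin (full_shift A) X"
    and P: "perfect_in (shift_top A X) P" "countable (X - P)"
  shows "perfect_kernel (shift_top A X) = P"
proof -
  have Xt: "X \<subseteq> topspace (full_shift A)" using closedin_subset[OF X] .
  have sub: "P \<subseteq> Q" if P: "perfect_in (shift_top A X) P" and Q: "perfect_in (shift_top A X) Q" "countable (X - Q)" for P Q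
  proof (rule ccontr)
    assume "\<not> P \<subseteq> Q"
    then obtain p where p: "p \<in> P" "p \<notin> Q" by blast
    have Pcl: "closedin (shift_top A X) P" and Pacc: "\<And>x m. x \<in> P \<Longrightarrow> \<exists>y\<in>P. y \<noteq> x \<and> agree m x y"
      using P unfolding perfect_in_shift_top[OF Xt] by blast+
    have Qcl: "closedin (shift_top A X) Q" using Q unfolding perfect_in_shift_top[OF Xt] by blast
    have PX: "P \<subseteq> X" using Pcl unfolding closedin_shift_top[OF Xt] by blast
    obtain m where m: "\<forall>y\<in>Q. \<not> agree m p y" using Qcl p PX unfolding closedin_shift_top[OF Xt] by blast
    let ?U = "{y \<in> P. agree m p y}"
    have "uncountable ?U"
    proof (rule perfect_uncountable[of _ A])
      show "?U \<subseteq> topspace (full_shift A)" using PX Xt by blast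
      show "?U \<noteq> {}" using p by auto
      show "x \<in> ?U" if x: "x \<in> topspace (full_shift A)" "\<And>k. \<exists>y\<in>?U. agree k x y" for x
      proof -
        have "\<exists>y\<in>X. agree k x y" for k using x(2)[of k] PX by blast
        then have xX: "x \<in> X" using X x(1) unfolding closedin_full_shift by blast
        have "\<exists>y\<in>P. agree k x y" for k using x(2)[of k] by blast
        then have "x \<in> P" using Pcl xX unfolding closedin_shift_top[OF Xt] by blast
        moreover obtain y where "agree m p y" "agree m x y" using x(2)[of m] by blast
        then have "agree m p x" using agree_trans agree_sym by blast
        ultimately show ?thesis by blast
      qed
      show "\<exists>y\<in>?U. y \<noteq> x \<and> agree k x y" if x: "x \<in> ?U" for x k
      proof -
        obtain y where y: "y \<in> P" "y \<noteq> x" "agree (m + k) x y" using Pacc x by blast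
        have "agree m x y" "agree k x y" using agree_mono[OF y(3)] by auto
        then show ?thesis using y(1,2) x agree_trans[of m p x y] by blast
      qed
    qed
    moreover have "?U \<subseteq> X - Q" using m PX by blast
    ultimately show False using Q(2) countable_subset by blast
  qed
  show ?thesis unfolding perfect_kernel_def topspace_shift_top[OF Xt]
  proof (rule the_equality)
    show "perfect_in (shift_top A X) P \<and> countable (X - P)" using P by blast
    fix Q assume "perfect_in (shift_top A X) Q \<and> countable (X - Q)"
    then show "Q = P" using sub[OF P(1)] sub[of Q P] P by blast
  qed
qed

lemma cb_rank_le_2:
  "cb_rank_le X 2 \<longleftrightarrow> X derived_set_of (X derived_set_of (X derived_set_of topspace X)) =
    X derived_set_of (X derived_set_of topspace X)"
  by (simp add: cb_rank_le_iff numeral_2_eq_2)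

context window_shift begin

section \<open>Derived sets under condition (c), and condition (d)\<close>

definition perfect_part :: "(int \<Rightarrow> 'a) set"
  where "perfect_part = \<Union>{C \<in> irred_components A X. isolated_comp A X C \<and> infinite C}"

lemma low_poset_perfect_part:
  assumes low: "low_poset"
  shows "perfect_part = \<Union>(Comp ` {u. recurrent u \<and> infinite (Comp u)})"
proof -
  have "isolated_comp A X (Comp u)" if "recurrent u" "infinite (Comp u)" for u
    using that low minimal_comp_iff maximal_comp_iff unfolding low_poset_def isolated_comp_def by blast
  then show ?thesis unfolding perfect_part_def irred_components_eq comps_def by blast
qed

lemma derived_set_X:
  "shift_top A X derived_set_of T = {x \<in> X. \<forall>m. \<exists>y\<in>T \<inter> X. y \<noteq> x \<and> agree m x y}"
  by (rule derived_set_shift_top[OF X_topspace])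

text \<open>The first derivative loses the transient points, which are isolated. The second loses
  the finite components, whose points are isolated among the non-wandering ones. Infinite components
  have no isolated points and survive.\<close>

lemma low_poset_derived:
  assumes low: "low_poset"
  shows "shift_top A X derived_set_of X \<subseteq> NW A X"
    and "shift_top A X derived_set_of (shift_top A X derived_set_of X) = perfect_part"
    and "shift_top A X derived_set_of perfect_part = perfect_part"
    and "countable (X - perfect_part)"
proof -
  let ?d = "\<lambda>T. shift_top A X derived_set_of T"
  show d1: "?d X \<subseteq> NW A X" using transient_isolated[OF low] unfolding derived_set_X by blast
  note pp = low_poset_perfect_part[OF low]
  have ppX: "perfect_part \<subseteq> X" unfolding pp using Comp_subset by blast
  have d2: "?d (?d X) \<subseteq> perfect_part"
  proof
    fix x assume x: "x \<in> ?d (?d X)"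
    have acc: "\<exists>y\<in>NW A X. y \<noteq> x \<and> agree m x y" for m
      using x d1 unfolding derived_set_X[of "?d X"] by blast
    have xX: "x \<in> X" using x derived_set_X by blast
    have "\<exists>y\<in>NW A X. agree m x y" for m using acc by blast
    then have xN: "x \<in> NW A X" using closed_NW xX X_topspace unfolding closedin_full_shift by blast
    let ?u = "st x 0"
    have u: "recurrent ?u" "x \<in> Comp ?u" using NW_recurrent[OF xN] NW_Comp[OF xN] by auto
    have "infinite (Comp ?u)"
    proof
      assume fin: "finite (Comp ?u)"
      \<comment> \<open>Radius \<open>N\<close> fixes the window at 0, which determines a point of a
        finite component.\<close>
      obtain y where y: "y \<in> NW A X" "y \<noteq> x" "agree N x y" using acc by blast
      have e: "st y 0 = ?u" by (rule win_cong, rule agreeD[OF agree_sym[OF y(3)]]) auto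
      have yC: "y \<in> Comp ?u" using NW_Comp[OF y(1), of 0] unfolding e .
      have "x = y" by (rule finite_Comp_unique[OF fin u(2) yC e[symmetric]])
      then show False using y by blast
    qed
    then show "x \<in> perfect_part" unfolding pp using u by blast
  qed
  have pd: "T \<subseteq> T' \<Longrightarrow> ?d T \<subseteq> ?d T'" for T T' by (rule derived_set_of_mono)
  have p1: "perfect_part \<subseteq> ?d perfect_part"
  proof
    fix x assume x: "x \<in> perfect_part"
    then obtain u where u: "recurrent u" "infinite (Comp u)" "x \<in> Comp u" unfolding pp by blast
    have "\<exists>y\<in>perfect_part \<inter> X. y \<noteq> x \<and> agree m x y" for m
    proof -
      obtain y where "y \<in> Comp u" "y \<noteq> x" "agree m x y" using infinite_Comp_perfect[OF u] by blast
      then show ?thesis unfolding pp using u Comp_subset by blast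
    qed
    then show "x \<in> ?d perfect_part" using x ppX unfolding derived_set_X by blast
  qed
  have "perfect_part \<subseteq> ?d X" using p1 pd[OF ppX] by blast
  then have "perfect_part \<subseteq> ?d (?d X)" using p1 pd by blast
  then show e2: "?d (?d X) = perfect_part" using d2 by blast
  have "?d X \<subseteq> X" unfolding derived_set_X by blast
  then have "?d (?d (?d X)) \<subseteq> ?d (?d X)" using pd by blast
  then show "?d perfect_part = perfect_part" using p1 unfolding e2 by blast
  have "X - perfect_part \<subseteq> \<Union>(orbit ` (X - NW A X)) \<union> \<Union>(Comp ` {u \<in> states. finite (Comp u)})"
  proof
    fix x assume x: "x \<in> X - perfect_part"
    show "x \<in> \<Union>(orbit ` (X - NW A X)) \<union> \<Union>(Comp ` {u \<in> states. finite (Comp u)})"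
    proof (cases "x \<in> NW A X")
      case True
      have "x \<in> Comp (st x 0)" "recurrent (st x 0)" using NW_Comp NW_recurrent True by auto
      then show ?thesis using x recurrent_state unfolding pp by blast
    next
      case False then show ?thesis using x self_orbit[of x] by blast
    qed
  qed
  moreover have "countable (\<Union>o'\<in>orbit ` (X - NW A X). o')"
  proof (rule countable_UN)
    show "countable (orbit ` (X - NW A X))" using finite_transient_orbits[OF low] countable_finite by blast
    show "countable o'" if "o' \<in> orbit ` (X - NW A X)" for o' using that unfolding orbit_def by auto
  qed
  then have "countable (\<Union>(orbit ` (X - NW A X)))" by simp
  moreover have "finite (\<Union>(Comp ` {u \<in> states. finite (Comp u)}))" using finite_states by auto
  ultimately show "countable (X - perfect_part)"
    by (meson countable_Un countable_finite countable_subset)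
qed

lemma Comp_uncountable: assumes u: "recurrent u" "infinite (Comp u)" shows "uncountable (Comp u)"
proof -
  interpret C: window_shift A N "S \<inter> {w. mutual u w}" "Comp u" by (rule Comp_window)
  show ?thesis
  proof (rule perfect_uncountable[of _ A])
    show "Comp u \<noteq> {}" using Comp_nonempty[OF u(1)] by blast
    show "x \<in> Comp u" if "x \<in> topspace (full_shift A)" "\<And>m. \<exists>y\<in>Comp u. agree m x y" for x
      using that C.closed_X unfolding closedin_full_shift by blast
    show "\<exists>y\<in>Comp u. y \<noteq> x \<and> agree m x y" if "x \<in> Comp u" for x m
      by (rule infinite_Comp_perfect[OF u that])
  qed (rule C.X_topspace)
qed

text \<open>A transient orbit that falls onto a periodic point of the component accumulates there.\<close>

lemma not_rmin_accumulation:
  assumes u: "recurrent u" and nm: "\<not> rmin u"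
  obtains z p where "z \<in> Comp u" "p > 0" "sh p z = z" "st z 0 = u"
    "\<And>m. \<exists>y\<in>X - NW A X. \<exists>K\<le>- int m. \<forall>k\<ge>K. y k = z k"
proof -
  obtain v where v: "reach v u" "\<not> reach u v" using nm unfolding rmin_def by blast
  obtain x where x: "x \<in> X" "st x 0 = u" using recurrent_state[OF u] stateE by blast
  obtain z p where z: "z \<in> Comp u" "p > 0" "sh p z = z" "\<forall>k. 0 \<le> k \<and> k \<le> 0 \<longrightarrow> st z k = st x k"
    using periodic_approx[OF u x(1), of 0 0] mutual_refl[OF recurrent_state[OF u]] x(2) by auto
  have zu: "st z 0 = u" using z(4) x by simp
  have zX: "z \<in> X" using z(1) Comp_subset by blast
  obtain a where a: "a \<in> X" "st a 0 = v" using v(1) reach_states stateE by blast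
  obtain y l where y: "y \<in> X" "0 \<le> l" "\<And>k. k \<le> 0 \<Longrightarrow> st y k = st a k" "\<And>k. 0 + l \<le> k \<Longrightarrow> y k = z (k - 0 - l + 0)"
    "\<And>k. 0 + l \<le> k \<Longrightarrow> st y k = st z (k - 0 - l + 0)"
    using connect_reach[OF a(1) zX, of 0 0] v(1) a(2) zu by metis
  have "y \<notin> NW A X" using NW_reach[of y l 0] y(3)[of 0] y(5)[of l] a zu v(2) by auto
  have "\<exists>y\<in>X - NW A X. \<exists>K\<le>- int m. \<forall>k\<ge>K. y k = z k" for m
  proof (intro bexI[of _ "sh (l + int m * p) y"] exI[of _ "- (int m * p)"] conjI allI impI)
    show "- (int m * p) \<le> - int m" using z(2) mult_left_mono[of 1 p "int m"] by simp
    show "sh (l + int m * p) y k = z k" if "k \<ge> - (int m * p)" for k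
    proof -
      have "sh (l + int m * p) y k = z (k + int m * p)" using y(4) that by (simp add: sh_apply)
      also have "\<dots> = sh (int m * p) z k" by (simp add: sh_apply)
      finally show ?thesis using sh_mult[OF z(3)] by simp
    qed
    show "sh (l + int m * p) y \<in> X - NW A X" using y(1) \<open>y \<notin> NW A X\<close> sh_X NW_sh by blast
  qed
  then show ?thesis using that z zu by blast
qed

text \<open>The point follows \<open>z\<close> up to \<open>k\<close> and then takes a path to a
  state from which nothing leads back, so it is transient.\<close>

lemma not_rmax_accumulation:
  assumes u: "recurrent u" and nm: "\<not> rmax u" and z: "z \<in> X" "mutual u (st z k)"
  shows "\<exists>y\<in>X - NW A X. (\<forall>i\<le>k. y i = z i) \<and> (\<exists>i>k. \<not> mutual u (st y i))"
proof -
  obtain w where w: "recurrent w" "reach u w" "\<not> reach w u" using nm unfolding rmax_def by blast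
  obtain a where a: "a \<in> X" "st a 0 = w" using w(2) reach_states stateE by blast
  have "reach (st z k) (st a 0)" using w(2) a(2) z(2) reach_trans unfolding mutual_def by blast
  then obtain y l where y: "y \<in> X" "0 \<le> l" "\<And>i. i < k + int N \<Longrightarrow> y i = z i"
    "\<And>i. i \<le> k \<Longrightarrow> st y i = st z i" "\<And>i. k + l \<le> i \<Longrightarrow> st y i = st a (i - k - l + 0)"
    using connect_reach[OF z(1) a(1)] by metis
  have yl: "st y (k + l) = w" using y(5)[of "k + l"] a by simp
  have nw: "\<not> mutual u w" using w(3) by (simp add: mutual_def)
  have "l \<noteq> 0" using yl y(4)[of k] z(2) nw by auto
  moreover have "y \<notin> NW A X"
  proof
    assume "y \<in> NW A X"
    then have "reach w (st z k)" using NW_reach[of y "k + l" k] yl y(4)[of k] by simp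
    then show False using z(2) w(3) reach_trans unfolding mutual_def by blast
  qed
  ultimately show ?thesis using y(1,2,3) yl nw N_pos
    by (intro bexI[of _ y]) (auto intro!: exI[of _ "k + l"])
qed

text \<open>\<open>z\<close> is a limit of transient points \<open>y\<close> that equal
  \<open>z\<close> from some place on, and each such \<open>y\<close> is a limit of transient points
  that follow it for long and then leave the class. The set \<open>Y\<close> is kept general so as
  to be both \<open>X\<close> in (d) and the countable part in (e).\<close>

lemma not_extremal_second_derivative:
  assumes u: "recurrent u" "\<not> rmin u" "\<not> rmax u"
    and Y: "closedin (full_shift A) Y" "X - NW A X \<subseteq> Y" "Y \<subseteq> X"
  shows "\<exists>z\<in>Comp u. z \<in> shift_top A Y derived_set_of (shift_top A Y derived_set_of Y)"
proof -
  have Yt: "Y \<subseteq> topspace (full_shift A)" using closedin_subset[OF Y(1)] .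
  note d = derived_set_shift_top[OF Yt]
  obtain z p where z: "z \<in> Comp u" "p > 0" "sh p z = z" "st z 0 = u"
    "\<And>m. \<exists>y\<in>X - NW A X. \<exists>K\<le>- int m. \<forall>k\<ge>K. y k = z k"
    using not_rmin_accumulation[OF u(1,2)] by metis
  have zm: "mutual u (st z k)" for k using z(1) by (simp add: Comp_def)
  have "y \<in> shift_top A Y derived_set_of Y" if y: "y \<in> X - NW A X" "\<forall>k\<ge>K. y k = z k" for y K
    unfolding d
  proof (intro CollectI conjI allI)
    fix m
    let ?k = "\<bar>K\<bar> + int m"
    have yst: "st y k = st z k" if "k \<ge> K" for k by (rule win_cong) (use y(2) that in auto)
    have "mutual u (st y ?k)" using yst[of ?k] zm by simp
    then obtain x where x: "x \<in> X - NW A X" "\<forall>i\<le>?k. x i = y i" "\<exists>i>?k. \<not> mutual u (st x i)"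
      using not_rmax_accumulation[OF u(1,3), of y ?k] y(1) by blast
    obtain i where i: "i > ?k" "\<not> mutual u (st x i)" using x(3) by blast
    have "st y i = st z i" using yst[of i] i by simp
    then have "x \<noteq> y" using i(2) zm by metis
    moreover have "agree m y x" unfolding agree_def using x(2) by auto
    ultimately show "\<exists>x\<in>Y \<inter> Y. x \<noteq> y \<and> agree m y x" using x(1) Y(2) by blast
  qed (use y Y in blast)
  note dy = this
  have acc: "\<exists>y\<in>(shift_top A Y derived_set_of Y) \<inter> Y. y \<noteq> z \<and> agree m z y" for m
  proof -
    obtain y K where y: "y \<in> X - NW A X" "K \<le> - int m" "\<forall>k\<ge>K. y k = z k" using z(5) by blast
    have "z \<in> NW A X" using z(1) Comp_NW by blast
    then have "y \<noteq> z" using y(1) by blast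
    moreover have "agree m z y" unfolding agree_def using y(2,3) by auto
    ultimately show ?thesis using dy[OF y(1,3)] y(1) Y(2) by blast
  qed
  have "\<exists>y\<in>Y. agree m z y" for m using acc by blast
  then have "z \<in> Y" using Y(1) z(1) Comp_subset X_topspace unfolding closedin_full_shift by blast
  then have "z \<in> shift_top A Y derived_set_of (shift_top A Y derived_set_of Y)"
    using acc unfolding d[of "shift_top A Y derived_set_of Y"] by blast
  then show ?thesis using z(1) by blast
qed

lemma low_poset_imp_rank:
  assumes low: "low_poset"
  shows "cb_rank_le (shift_top A X) 2 \<and> perfect_kernel (shift_top A X) = perfect_part"
proof
  note D = low_poset_derived[OF low]
  show "cb_rank_le (shift_top A X) 2"
    unfolding cb_rank_le_2 topspace_shift_top[OF X_topspace] D(2,3) ..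
  have "perfect_in (shift_top A X) perfect_part" unfolding perfect_in_shift_top[OF X_topspace]
  proof
    show "closedin (shift_top A X) perfect_part"
      unfolding closedin_contains_derived_set D(3) topspace_shift_top[OF X_topspace]
      using D(3) derived_set_X by blast
    show "\<forall>x\<in>perfect_part. \<forall>m. \<exists>y\<in>perfect_part. y \<noteq> x \<and> agree m x y"
      using D(3) derived_set_X by blast
  qed
  then show "perfect_kernel (shift_top A X) = perfect_part"
    using perfect_kernel_shift_top[OF closed_X] D(4) by blast
qed

text \<open>Rank at most 2 makes the second derivative perfect, and its complement consists of
  points isolated at one of two stages, so it is countable. Hence the second derivative is the
  kernel. A class that is not extremal would have a point in it, and an infinite component meets it
  by uncountability, whereas its points lie in isolated infinite components only.\<close>

lemma rank_imp_low_poset: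
  assumes rank: "cb_rank_le (shift_top A X) 2" and ker: "perfect_kernel (shift_top A X) = perfect_part"
  shows "low_poset"
proof -
  let ?d = "\<lambda>T. shift_top A X derived_set_of T"
  have d3: "?d (?d (?d X)) = ?d (?d X)"
    using rank unfolding cb_rank_le_2 topspace_shift_top[OF X_topspace] .
  have perf: "perfect_in (shift_top A X) (?d (?d X))" unfolding perfect_in_shift_top[OF X_topspace]
  proof
    show "closedin (shift_top A X) (?d (?d X))"
      unfolding closedin_contains_derived_set d3 topspace_shift_top[OF X_topspace]
      using derived_set_X by blast
    show "\<forall>x\<in>?d (?d X). \<forall>m. \<exists>y\<in>?d (?d X). y \<noteq> x \<and> agree m x y"
    proof (intro ballI allI)
      fix x m assume "x \<in> ?d (?d X)"
      then have "x \<in> ?d (?d (?d X))" unfolding d3 .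
      then show "\<exists>y\<in>?d (?d X). y \<noteq> x \<and> agree m x y" unfolding derived_set_X[of "?d (?d X)"] by blast
    qed
  qed
  have cd: "countable (T - ?d T)" if "T \<subseteq> X" for T
  proof (rule countable_subset[OF _ countable_isolated[OF finite_A]])
    show "T - ?d T \<subseteq> {x \<in> T. \<exists>m. \<forall>y\<in>T. agree m x y \<longrightarrow> y = x}"
      unfolding derived_set_X using that by blast
    show "T \<subseteq> topspace (full_shift A)" using that X_topspace by blast
  qed
  have "?d X \<subseteq> X" unfolding derived_set_X by blast
  then have "countable ((X - ?d X) \<union> (?d X - ?d (?d X)))" using cd by blast
  then have cX: "countable (X - ?d (?d X))" by (rule countable_subset[rotated]) blast
  have dP: "?d (?d X) = perfect_part" using perfect_kernel_shift_top[OF closed_X perf cX] ker by simp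
  have inP: "isolated_comp A X (Comp u) \<and> infinite (Comp u)" if u: "recurrent u" "x \<in> Comp u" "x \<in> perfect_part" for u x
  proof -
    obtain v where v: "recurrent v" "isolated_comp A X (Comp v)" "infinite (Comp v)" "x \<in> Comp v"
      using u(3) unfolding perfect_part_def irred_components_eq comps_def by blast
    have "Comp v = Comp u" using Comp_inter[OF v(4) u(2)] Comp_cong by blast
    then show ?thesis using v by simp
  qed
  have iso: "rmin u \<and> rmax u" if "recurrent u" "isolated_comp A X (Comp u)" for u
    using that minimal_comp_iff maximal_comp_iff unfolding isolated_comp_def by blast
  show ?thesis unfolding low_poset_def
  proof (intro conjI allI impI)
    fix u assume u: "recurrent u"
    show "rmin u \<or> rmax u"
    proof (rule ccontr)
      assume "\<not> (rmin u \<or> rmax u)"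
      then have n: "\<not> rmin u" "\<not> rmax u" by auto
      obtain z where z: "z \<in> Comp u" "z \<in> ?d (?d X)"
        using not_extremal_second_derivative[OF u n closed_X] by blast
      then show False using inP[OF u z(1)] iso[OF u] n unfolding dP by blast
    qed
  next
    fix u assume u: "recurrent u \<and> infinite (Comp u)"
    have "\<exists>x\<in>Comp u. x \<in> perfect_part"
    proof (rule ccontr)
      assume "\<not> (\<exists>x\<in>Comp u. x \<in> perfect_part)"
      then have "Comp u \<subseteq> X - perfect_part" using Comp_subset by blast
      then show False using Comp_uncountable cX u countable_subset unfolding dP by blast
    qed
    then show "rmin u" "rmax u" using inP iso u by blast+
  qed
qed

section \<open>The decomposition of condition (e)\<close>

lemma subshift_of_states: "window_shift A N (S \<inter> G) {x \<in> X. \<forall>i. st x i \<in> G}"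
  by standard (use finite_A N_pos S_words X_iff in auto)

text \<open>Infinite classes are isolated, so a single window in such a class puts the whole point
  into its component. Thus all windows of a point lie in \<open>?G\<close> or none does, and both
  parts are of finite type, being given by allowed windows.\<close>

lemma low_poset_imp_splitting:
  assumes low: "low_poset"
  shows "\<exists>Y Z. sft A Y \<and> non_wandering A Y \<and> sft A Z \<and> countable Z \<and> cb_rank_le (shift_top A Z) 2 \<and>
         Y \<inter> Z = {} \<and> X = Y \<union> Z"
proof (intro exI conjI)
  let ?G = "{w. recurrent w \<and> infinite (Comp w)}"
  let ?Y = "{x \<in> X. \<forall>i. st x i \<in> ?G}" and ?Z = "{x \<in> X. \<forall>i. st x i \<in> - ?G}"
  interpret Y: window_shift A N "S \<inter> ?G" ?Y by (rule subshift_of_states)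
  interpret Z: window_shift A N "S \<inter> - ?G" ?Z by (rule subshift_of_states)
  note D = low_poset_derived[OF low]
  note pp = low_poset_perfect_part[OF low]
  have CompG: "Comp u \<subseteq> ?Y" if "u \<in> ?G" for u
  proof
    fix x assume x: "x \<in> Comp u"
    have "st x i \<in> ?G" for i
    proof -
      have m: "mutual u (st x i)" using x by (simp add: Comp_def)
      then show ?thesis using that recurrent_mutual[OF _ m] Comp_cong[OF m] by simp
    qed
    then show "x \<in> ?Y" using x Comp_subset by blast
  qed
  have inG: "x \<in> Comp (st x i)" if x: "x \<in> X" "st x i \<in> ?G" for x i
  proof -
    have "rmin (st x i)" "rmax (st x i)" using low x(2) unfolding low_poset_def by blast+
    then have "mutual (st x i) (st x k)" for k
      using x rmin_closed[of "st x i" "st x k"] rmax_closed[of "st x i" "st x k"] reachI[OF x(1)]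
      by (cases "k \<le> i") auto
    then show ?thesis using x(1) by (simp add: Comp_def)
  qed
  have Yeq: "?Y = perfect_part" unfolding pp using CompG inG[of _ 0] by blast
  show "sft A ?Y" by (rule Y.sft_X)
  show "sft A ?Z" by (rule Z.sft_X)
  show XYZ: "X = ?Y \<union> ?Z"
  proof
    show "X \<subseteq> ?Y \<union> ?Z"
    proof
      fix x assume x: "x \<in> X"
      show "x \<in> ?Y \<union> ?Z"
      proof (cases "\<exists>i. st x i \<in> ?G")
        case True
        then obtain i where "st x i \<in> ?G" by blast
        then show ?thesis using inG[OF x] CompG by blast
      qed (use x in blast)
    qed
  qed blast
  show YZ: "?Y \<inter> ?Z = {}" by blast
  have ZX: "?Z \<subseteq> X - perfect_part" using Yeq YZ by blast
  then show "countable ?Z" using D(4) countable_subset by blast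
  show "non_wandering A ?Y" unfolding non_wandering_def
  proof
    show "NW A ?Y \<subseteq> ?Y" using Y.NW_subset .
    show "?Y \<subseteq> NW A ?Y"
    proof
      fix x assume x: "x \<in> ?Y"
      have "Y.reach (st x (i + 1)) (st x i)" for i
      proof -
        let ?u = "st x i"
        have u: "?u \<in> ?G" and xX: "x \<in> X" using x by auto
        then have "x \<in> Comp ?u" using inG by blast
        then have m: "mutual ?u (st x k)" for k by (simp add: Comp_def)
        have ru: "recurrent ?u" using u by simp
        obtain z p where z: "z \<in> Comp ?u" "p > 0" "sh p z = z" "\<forall>k. i \<le> k \<and> k \<le> i + 1 \<longrightarrow> st z k = st x k"
          using periodic_approx[OF ru xX, of i "i + 1"] m by auto
        have "st z (i + p) = st z i" using z(3) by (metis win_sh)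
        moreover have "z \<in> ?Y" using CompG[OF u] z(1) by blast
        ultimately show ?thesis using Y.reachI[of z "i + 1" "i + p"] z(2,4) by auto
      qed
      then show "x \<in> NW A ?Y" unfolding Y.NW_iff using x by blast
    qed
  qed
  have ss: "shift_top A ?Z derived_set_of T \<subseteq> ?Z \<inter> (shift_top A X derived_set_of T)" for T
    unfolding derived_set_shift_top[OF Z.X_topspace] derived_set_X by blast
  have "shift_top A ?Z derived_set_of ?Z \<subseteq> shift_top A X derived_set_of X"
    using ss[of ?Z] derived_set_of_mono[of ?Z X "shift_top A X"] by blast
  \<comment> \<open>A point of the second derivative of \<open>?Z\<close> would lie in that of
    \<open>X\<close>, which is the perfect part and disjoint from \<open>?Z\<close>.\<close>
  then have "shift_top A ?Z derived_set_of (shift_top A ?Z derived_set_of ?Z) \<subseteq> ?Z \<inter> perfect_part"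
    using ss derived_set_of_mono unfolding D(2)[symmetric] by blast
  then have "shift_top A ?Z derived_set_of (shift_top A ?Z derived_set_of ?Z) = {}" using ZX by blast
  then show "cb_rank_le (shift_top A ?Z) 2"
    unfolding cb_rank_le_2 topspace_shift_top[OF Z.X_topspace] by simp
qed

text \<open>Transient points of \<open>X\<close> lie in \<open>Z\<close>, and infinite components,
  irreducible and uncountable, lie in \<open>Y\<close>. An infinite class that is not isolated would
  be approached by transient points and meet the closed set \<open>Z\<close>. A class that is not
  extremal would make the second derivative of \<open>Z\<close> non-empty; by the rank condition it
  would be perfect, hence uncountable.\<close>

lemma splitting_imp_low_poset:
  assumes Y: "sft A Y" "non_wandering A Y"
    and Z: "sft A Z" "countable Z" "cb_rank_le (shift_top A Z) 2"
    and YZ: "Y \<inter> Z = {}" "X = Y \<union> Z"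
  shows "low_poset"
proof -
  have Yc: "closedin (full_shift A) Y" and Zc: "closedin (full_shift A) Z"
    using Y(1) Z(1) unfolding sft_def subshift_def by blast+
  have Zt: "Z \<subseteq> topspace (full_shift A)" and Yt: "Y \<subseteq> topspace (full_shift A)"
    using closedin_subset Yc Zc by blast+
  have "x \<in> NW A X" if x: "x \<in> Y" for x
  proof -
    have xN: "x \<in> NW A Y" using x Y(2) unfolding non_wandering_def by blast
    show ?thesis unfolding NW_def
    proof (intro CollectI conjI allI impI)
      fix U assume "U \<subseteq> X" "\<exists>V. openin (shift_top A X) V \<and> x \<in> V \<and> V \<subseteq> U"
      then obtain m where m: "\<forall>y\<in>X. agree m x y \<longrightarrow> y \<in> U" unfolding openin_shift_top[OF X_topspace] by blast
      let ?V = "{y \<in> Y. agree m x y}"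
      have "openin (shift_top A Y) ?V" unfolding openin_shift_top[OF Yt] using agree_trans by blast
      moreover have "x \<in> ?V" using x by simp
      ultimately have "\<exists>n\<ge>1. ?V \<inter> (shift ^^ n) ` ?V \<noteq> {}" using xN unfolding NW_def by blast
      moreover have "?V \<subseteq> U" using m YZ by blast
      ultimately show "\<exists>n\<ge>1. U \<inter> (shift ^^ n) ` U \<noteq> {}" by blast
    qed (use x YZ in blast)
  qed
  then have WZ: "X - NW A X \<subseteq> Z" using YZ by blast
  have inf_disj: "Comp u \<inter> Z = {}" if u: "recurrent u" "infinite (Comp u)" for u
  proof -
    have "\<exists>D\<in>{Y, Z}. Comp u \<subseteq> D"
    proof (rule irreducible_in_piece[OF Comp_irreducible[OF u(1)]])
      show "disjoint {Y, Z}" using YZ(1) unfolding disjoint_def by blast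
    qed (use Y(1) Z(1) YZ Comp_subset in \<open>auto simp: sft_def\<close>)
    moreover have "\<not> Comp u \<subseteq> Z" using Comp_uncountable[OF u] Z(2) countable_subset by blast
    ultimately show ?thesis using YZ by blast
  qed
  have closeZ: "z \<in> Z" if "z \<in> X" "\<And>m. \<exists>y\<in>X - NW A X. agree m z y" for z
    using that WZ Zc X_topspace unfolding closedin_full_shift by blast
  show ?thesis unfolding low_poset_def
  proof (intro conjI allI impI)
    fix u assume u: "recurrent u"
    show "rmin u \<or> rmax u"
    proof (rule ccontr)
      assume "\<not> (rmin u \<or> rmax u)"
      then have n: "\<not> rmin u" "\<not> rmax u" by auto
      let ?d = "\<lambda>T. shift_top A Z derived_set_of T"
      have "Z \<subseteq> X" using YZ by blast
      then obtain z where z: "z \<in> ?d (?d Z)"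
        using not_extremal_second_derivative[OF u n Zc WZ] by blast
      note d = derived_set_shift_top[OF Zt]
      have d3: "?d (?d (?d Z)) = ?d (?d Z)" using Z(3) unfolding cb_rank_le_2 topspace_shift_top[OF Zt] .
      let ?Q = "?d (?d Z)"
      have acc: "\<exists>y\<in>?Q. y \<noteq> x \<and> agree m x y" if "x \<in> ?Q" for x m
      proof -
        have "x \<in> ?d ?Q" using that unfolding d3 .
        then show ?thesis unfolding d[of ?Q] by blast
      qed
      have QZ: "?Q \<subseteq> Z" unfolding d by blast
      have "uncountable ?Q"
      proof (rule perfect_uncountable[of _ A])
        show "?Q \<subseteq> topspace (full_shift A)" using QZ Zt by blast
        show "?Q \<noteq> {}" using z by blast
        show "x \<in> ?Q" if x: "x \<in> topspace (full_shift A)" "\<And>m. \<exists>y\<in>?Q. agree m x y" for x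
        proof (rule ccontr)
          assume nx: "x \<notin> ?Q"
          have "\<exists>y\<in>Z. agree m x y" for m using x(2)[of m] QZ by blast
          then have "x \<in> Z" using Zc x(1) unfolding closedin_full_shift by blast
          moreover have "\<exists>y\<in>?Q \<inter> Z. y \<noteq> x \<and> agree m x y" for m
          proof -
            obtain y where "y \<in> ?Q" "agree m x y" using x(2) by blast
            then show ?thesis using nx QZ by (intro bexI[of _ y]) auto
          qed
          ultimately have "x \<in> ?d ?Q" unfolding d[of ?Q] by blast
          then show False using nx unfolding d3 by blast
        qed
      qed (rule acc)
      then show False using QZ Z(2) countable_subset by blast
    qed
  next
    fix u assume u: "recurrent u \<and> infinite (Comp u)"
    show "rmin u"
    proof (rule ccontr)
      assume "\<not> rmin u"
      then obtain z p where z: "z \<in> Comp u" "\<And>m. \<exists>y\<in>X - NW A X. \<exists>K\<le>- int m. \<forall>k\<ge>K. y k = z k"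
        using not_rmin_accumulation u by metis
      have "\<exists>y\<in>X - NW A X. agree m z y" for m
      proof -
        obtain y K where y: "y \<in> X - NW A X" "K \<le> - int m" "\<forall>k\<ge>K. y k = z k" using z(2) by blast
        have "agree m z y" unfolding agree_def using y(2,3) by auto
        then show ?thesis using y(1) by blast
      qed
      then have "z \<in> Z" using closeZ z(1) Comp_subset by blast
      then show False using inf_disj u z(1) by blast
    qed
    show "rmax u"
    proof (rule ccontr)
      assume nm: "\<not> rmax u"
      obtain z where z: "z \<in> Comp u" using Comp_nonempty u by blast
      have "\<exists>y\<in>X - NW A X. agree m z y" for m
      proof -
        have "z \<in> X" "mutual u (st z (int m))" using z by (auto simp: Comp_def)
        then obtain y where "y \<in> X - NW A X" "\<forall>i\<le>int m. y i = z i"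
          using not_rmax_accumulation[of u z "int m"] nm u by blast
        then show ?thesis unfolding agree_def by (intro bexI[of _ y]) auto
      qed
      then have "z \<in> Z" using closeZ z Comp_subset by blast
      then show False using inf_disj u z by blast
    qed
  qed
qed

lemma surjunctive_iff: "surjunctive A X \<longleftrightarrow> low_poset"
  using low_poset_surjunctive not_low_poset_split has_split_not_surjunctive[OF X_topspace] by blast

lemma moore_iff: "moore A X \<longleftrightarrow> low_poset"
  using low_poset_moore not_low_poset_split has_split_not_moore[OF X_topspace] by blast

end

theorem theorem1p1:
  fixes A :: "'a set" and X :: "(int \<Rightarrow> 'a) set"
  assumes "finite A" and "sft A X"
  shows
    "(surjunctive A X \<longleftrightarrow> moore A X) \<and>
     (surjunctive A X \<longleftrightarrow>
       (\<forall>C\<in>irred_components A X. extremal_comp A X C) \<and>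
       (\<forall>C\<in>irred_components A X. infinite C \<longrightarrow> isolated_comp A X C)) \<and>
     (surjunctive A X \<longleftrightarrow>
       cb_rank_le (shift_top A X) 2 \<and>
       perfect_kernel (shift_top A X) =
         \<Union>{C \<in> irred_components A X. isolated_comp A X C \<and> infinite C}) \<and>
     (surjunctive A X \<longleftrightarrow>
       (\<exists>Y Z. sft A Y \<and> non_wandering A Y \<and>
         sft A Z \<and> countable Z \<and> cb_rank_le (shift_top A Z) 2 \<and>
         Y \<inter> Z = {} \<and> X = Y \<union> Z))"
proof -
  obtain N S where "window_shift A N S X" using sft_window_shift[OF assms] by blast
  then interpret window_shift A N S X .
  have d: "low_poset \<longleftrightarrow> cb_rank_le (shift_top A X) 2 \<and>
       perfect_kernel (shift_top A X) = \<Union>{C \<in> irred_components A X. isolated_comp A X C \<and> infinite C}"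
    using low_poset_imp_rank rank_imp_low_poset unfolding perfect_part_def by blast
  have e: "low_poset \<longleftrightarrow> (\<exists>Y Z. sft A Y \<and> non_wandering A Y \<and>
         sft A Z \<and> countable Z \<and> cb_rank_le (shift_top A Z) 2 \<and> Y \<inter> Z = {} \<and> X = Y \<union> Z)"
    using low_poset_imp_splitting splitting_imp_low_poset by metis
  show ?thesis
    unfolding surjunctive_iff moore_iff d[symmetric] e[symmetric] low_poset_iff[symmetric] by simp
qed

end
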